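(* Consider the attitude and gyroscope-bias estimation problem and the Riccati observer described in the context, with $m=p=2$ (so $n_1=n_2=1$). Suppose that the angular velocity $\Omega(t)$ is uniformly continuous and bounded on $[0,\infty)$, that $a_1^{(1)},a_1^{(2)},b_1,b_2\in\mathbb{S}^2$ are constant, that $\Lambda_1=\Lambda_2$ (i.e. $a_1^{(1)}=a_1^{(2)}$), and that $b_1,b_2$ are non-collinear. Assume moreover that there exist $\delta,\mu>0$ such that for all $t\ge0$ $$-\frac1\delta\int_t^{t+\delta}\sum_{i=1}^2b_i^\times R(s)\Lambda_i\Lambda_i^\top R^\top(s)\,b_i^\times\,ds\succeq\mu I_3,$$ and that $\Omega$ is strongly persistently exciting. Then the equilibrium $(\tilde R,\tilde d)=(I_3,0)$ of the estimation error is locally exponentially stable.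
   Context: $\mathbb{S}^2$ is the unit sphere of $\mathbb{R}^3$. For $\omega\in\mathbb{R}^3$, $\omega^\times$ is the skew-symmetric matrix with $\omega^\times y=\omega\times y$ for all $y\in\mathbb{R}^3$. $\mathbf{SO}(3)$ is the group of $3\times3$ rotation matrices. For symmetric matrices, $X\succeq Y$ means $X-Y$ is positive semidefinite. Strong persistence of excitation: $\alpha(t)\in\mathbb{R}^3$ is strongly persistently exciting if there exist $\delta,\beta>0$ such that for all $t\ge0$ the smallest eigenvalue of $\frac1\delta\int_t^{t+\delta}\alpha(s)\alpha^\top(s)\,ds$ is at least $\beta$. System: $R(t)\in\mathbf{SO}(3)$ and an unknown constant bias $d\in\mathbb{R}^3$ satisfy $\dot R=R\,\Omega^\times=R(\Omega_y-d)^\times$, $\dot d=0$, where $\Omega_y=\Omega+d$ is the measured angular velocity. Outputs: for $i=1,\dots,p$, $y_i:=\Lambda_i^\top R^\top b_i\in\mathbb{R}^{n_i}$ with $\Lambda_i:=[a_1^{(i)}\ \cdots\ a_{n_i}^{(i)}]\in\mathbb{R}^{3\times n_i}$, where $a_j^{(i)},b_i\in\mathbb{R}^3$ are known; $m=\sum_{i=1}^pn_i$. Observer: $\dot{\hat R}=\hat R(\Omega_y-\hat d)^\times+\Delta_R^\times\hat R$, $\dot{\hat d}=-\Delta_d$, with $\hat R(0)\in\mathbf{SO}(3)$, $\hat d(0)\in\mathbb{R}^3$. Output errors are $\tilde y_i:=\Lambda_i^\top\hat R^\top b_i-y_i$, stacked as $\bm y=(\tilde y_1,\dots,\tilde y_p)\in\mathbb{R}^m$.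 Let $$A:=\begin{bmatrix}0_{3\times3}&\hat R\\0_{3\times3}&0_{3\times3}\end{bmatrix},\qquad C:=\begin{bmatrix}C_1&0_{n_1\times3}\\\vdots&\vdots\\C_p&0_{n_p\times3}\end{bmatrix},\qquad C_i:=\Lambda_i^\top\hat R^\top b_i^\times .$$ The innovation is $\Delta=(\Delta_R,\Delta_d)=-P\,C^\top Q\,\bm y\in\mathbb{R}^6$, where $P(t)\in\mathbb{R}^{6\times6}$ solves the continuous Riccati equation $\dot P=AP+PA^\top-PC^\top QCP+V$ with $P(0)$ symmetric positive definite. Here $Q(t)\in\mathbb{R}^{m\times m}$ and $V(t)\in\mathbb{R}^{6\times6}$ are bounded continuous symmetric positive definite matrix-valued functions. Errors: $\tilde R:=\hat RR^\top$, $\tilde d:=d-\hat d$, so that $\dot{\tilde R}=(\hat R\tilde d+\Delta_R)^\times\tilde R$, $\dot{\tilde d}=\Delta_d$. Local exponential stability of $(I_3,0)$ means: there exist $r,c,\kappa>0$ such that $\|\tilde R(0)-I_3\|+|\tilde d(0)|\le r$ implies $\|\tilde R(t)-I_3\|+|\tilde d(t)|\le c\,e^{-\kappa t}(\|\tilde R(0)-I_3\|+|\tilde d(0)|)$ for all $t\ge0$.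
   Formalization: Positive definiteness of Q(t) and V(t) is taken uniformly in time (Q(t), V(t) bounded below by a positive multiple of the identity); with pointwise positive definiteness the claim fails, e.g. for V = I and Q(t) = εe^{-t}I with ε small. *)

theory Defs
  imports "HOL-Analysis.Analysis"
begin

definition skew :: "real^3 \<Rightarrow> real^3^3"
  where "skew w = matrix (cross3 w)"

definition symmetric_matrix :: "real^'n^'n \<Rightarrow> bool"
  where "symmetric_matrix M \<longleftrightarrow> transpose M = M"

definition pos_semidef :: "real^'n^'n \<Rightarrow> bool"
  where "pos_semidef M \<longleftrightarrow> symmetric_matrix M \<and> (\<forall>x. 0 \<le> x \<bullet> (M *v x))"

definition pos_def :: "real^'n^'n \<Rightarrow> bool"
  where "pos_def M \<longleftrightarrow> symmetric_matrix M \<and> (\<forall>x. x \<noteq> 0 \<longrightarrow> 0 < x \<bullet> (M *v x))"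

definition loewner_ge :: "real^'n^'n \<Rightarrow> real^'n^'n \<Rightarrow> bool"
  where "loewner_ge X Y \<longleftrightarrow> pos_semidef (X - Y)"

text \<open>
  A time-varying weight matrix on $[0,\infty)$. As usual for time-varying quadratic forms, positive
  definiteness is understood uniformly in time. Pointwise positive definiteness would not do: for
  gains with \<open>Q t\<close> or \<open>V t\<close> vanishing exponentially fast as \<open>t\<close> grows, the observer error need
  not converge at all, or not exponentially.
\<close>

definition admissible_weight :: "(real \<Rightarrow> real^'n^'n) \<Rightarrow> bool"
  where "admissible_weight W \<longleftrightarrow>
    continuous_on {0..} W \<and> bounded (W ` {0..}) \<and>
    (\<forall>t\<ge>0. symmetric_matrix (W t)) \<and>
    (\<exists>\<epsilon>>0. \<forall>t\<ge>0. loewner_ge (W t) (\<epsilon> *\<^sub>R mat 1))"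

definition smallest_eigenvalue :: "real^'n^'n \<Rightarrow> real"
  where "smallest_eigenvalue M = Min {l. \<exists>v. v \<noteq> 0 \<and> M *v v = l *\<^sub>R v}"

definition strongly_persistently_exciting :: "(real \<Rightarrow> real^3) \<Rightarrow> bool"
  where "strongly_persistently_exciting \<alpha> \<longleftrightarrow>
    (\<exists>\<delta>>0. \<exists>\<beta>>0. \<forall>t\<ge>0.
      smallest_eigenvalue
        ((1 / \<delta>) *\<^sub>R integral {t..t + \<delta>} (\<lambda>s. \<chi> i j. \<alpha> s $ i * \<alpha> s $ j)) \<ge> \<beta>)"

definition attitude_kinematics :: "(real \<Rightarrow> real^3) \<Rightarrow> (real \<Rightarrow> real^3^3) \<Rightarrow> bool"
  where "attitude_kinematics \<Omega> R \<longleftrightarrow>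
    (\<forall>t\<ge>0. rotation_matrix (R t) \<and>
      (R has_vector_derivative R t ** skew (\<Omega> t)) (at t within {0..}))"

text \<open>
  There is one block per vector \<open>b i\<close>, and every block has a single row (each \<open>\<Lambda> i\<close> is a
  $3\times1$ matrix), so that stacked quantities are indexed by the type of \<open>i\<close> alone.
  The space $\mathbb{R}^6=\mathbb{R}^3\times\mathbb{R}^3$ is \<open>real^(3+3)\<close>: the index \<open>Inl k\<close>
  is the attitude part and \<open>Inr k\<close> the bias part.
\<close>

definition outputs :: "('p \<Rightarrow> real^1^3) \<Rightarrow> ('p \<Rightarrow> real^3) \<Rightarrow> real^3^3 \<Rightarrow> real^'p"
  where "outputs \<Lambda> b R = (\<chi> i. (transpose (\<Lambda> i) *v (transpose R *v b i)) $ 1)"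

definition A_matrix :: "real^3^3 \<Rightarrow> real^(3+3)^(3+3)"
  where "A_matrix Rh = (\<chi> i j. case (i, j) of (Inl k, Inr l) \<Rightarrow> Rh $ k $ l | _ \<Rightarrow> 0)"

definition C_block :: "real^1^3 \<Rightarrow> real^3 \<Rightarrow> real^3^3 \<Rightarrow> real^3^1"
  where "C_block L v Rh = transpose L ** transpose Rh ** skew v"

definition C_matrix ::
  "('p \<Rightarrow> real^1^3) \<Rightarrow> ('p \<Rightarrow> real^3) \<Rightarrow> real^3^3 \<Rightarrow> real^(3+3)^'p"
  where "C_matrix \<Lambda> b Rh =
    (\<chi> i j. case j of Inl k \<Rightarrow> C_block (\<Lambda> i) (b i) Rh $ 1 $ k | Inr _ \<Rightarrow> 0)"

definition attitude_part :: "real^(3+3) \<Rightarrow> real^3"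
  where "attitude_part x = (\<chi> k. x $ Inl k)"

definition bias_part :: "real^(3+3) \<Rightarrow> real^3"
  where "bias_part x = (\<chi> k. x $ Inr k)"

definition innovation ::
  "('p \<Rightarrow> real^1^3) \<Rightarrow> ('p \<Rightarrow> real^3) \<Rightarrow> real^'p^'p \<Rightarrow> real^(3+3)^(3+3) \<Rightarrow> real^3^3 \<Rightarrow> real^'p
    \<Rightarrow> real^(3+3)"
  where "innovation \<Lambda> b Q P Rh y =
    - ((P ** transpose (C_matrix \<Lambda> b Rh) ** Q) *v (outputs \<Lambda> b Rh - y))"

definition riccati_rhs ::
  "('p \<Rightarrow> real^1^3) \<Rightarrow> ('p \<Rightarrow> real^3) \<Rightarrow> real^'p^'p \<Rightarrow> real^(3+3)^(3+3) \<Rightarrow> real^3^3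
    \<Rightarrow> real^(3+3)^(3+3) \<Rightarrow> real^(3+3)^(3+3)"
  where "riccati_rhs \<Lambda> b Q V Rh P =
    (let A = A_matrix Rh; C = C_matrix \<Lambda> b Rh
     in A ** P + P ** transpose A - P ** transpose C ** Q ** C ** P + V)"

text \<open>
  \<open>(Rh, dh, P)\<close> is a trajectory on $[0,\infty)$ of the observer driven by the measurements
  \<open>\<Omega>y\<close> and \<open>y\<close>; the Riccati equation is started at \<open>P0\<close>.
\<close>

definition riccati_observer ::
  "('p \<Rightarrow> real^1^3) \<Rightarrow> ('p \<Rightarrow> real^3) \<Rightarrow> (real \<Rightarrow> real^'p^'p) \<Rightarrow> (real \<Rightarrow> real^(3+3)^(3+3))
    \<Rightarrow> real^(3+3)^(3+3) \<Rightarrow> (real \<Rightarrow> real^3) \<Rightarrow> (real \<Rightarrow> real^'p)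
    \<Rightarrow> (real \<Rightarrow> real^3^3) \<Rightarrow> (real \<Rightarrow> real^3) \<Rightarrow> (real \<Rightarrow> real^(3+3)^(3+3)) \<Rightarrow> bool"
  where "riccati_observer \<Lambda> b Q V P0 \<Omega>y y Rh dh P \<longleftrightarrow>
    rotation_matrix (Rh 0) \<and> P 0 = P0 \<and>
    (\<forall>t\<ge>0. let \<Delta> = innovation \<Lambda> b (Q t) (P t) (Rh t) (y t) in
      (Rh has_vector_derivative
        Rh t ** skew (\<Omega>y t - dh t) + skew (attitude_part \<Delta>) ** Rh t) (at t within {0..}) \<and>
      (dh has_vector_derivative - bias_part \<Delta>) (at t within {0..}) \<and>
      (P has_vector_derivative riccati_rhs \<Lambda> b (Q t) (V t) (Rh t) (P t)) (at t within {0..}))"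

definition error_trajectories ::
  "('p \<Rightarrow> real^1^3) \<Rightarrow> ('p \<Rightarrow> real^3) \<Rightarrow> (real \<Rightarrow> real^'p^'p) \<Rightarrow> (real \<Rightarrow> real^(3+3)^(3+3))
    \<Rightarrow> real^(3+3)^(3+3) \<Rightarrow> (real \<Rightarrow> real^3) \<Rightarrow> (real \<Rightarrow> real^3^3) \<Rightarrow> real^3
    \<Rightarrow> ((real \<Rightarrow> real^3^3) \<times> (real \<Rightarrow> real^3)) set"
  where "error_trajectories \<Lambda> b Q V P0 \<Omega> R d =
    {(\<lambda>t. Rh t ** transpose (R t), \<lambda>t. d - dh t) | Rh dh P.
      riccati_observer \<Lambda> b Q V P0 (\<lambda>t. \<Omega> t + d) (\<lambda>t. outputs \<Lambda> b (R t)) Rh dh P}"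

definition locally_exponentially_stable ::
  "((real \<Rightarrow> real^3^3) \<times> (real \<Rightarrow> real^3)) set \<Rightarrow> bool"
  where "locally_exponentially_stable E \<longleftrightarrow>
    (\<exists>r>0. \<exists>c>0. \<exists>\<kappa>>0. \<forall>(Re, de)\<in>E.
      norm (Re 0 - mat 1) + norm (de 0) \<le> r \<longrightarrow>
      (\<forall>t\<ge>0. norm (Re t - mat 1) + norm (de t)
        \<le> c * exp (- \<kappa> * t) * (norm (Re 0 - mat 1) + norm (de 0))))"

end

theory Submission
  imports Defs "HOL-Complex_Analysis.Great_Picard"
begin

text \<open>
  To first order the error \<open>x = (\<lambda>, d - dh)\<close>, with \<open>\<lambda>\<close> the skew part of \<open>Rh R\<^sup>T\<close>, satisfies
  \<open>x' = (A - P K) x\<close> where \<open>K = C\<^sup>T Q C\<close>, up to a quadratic remainder, and \<open>x \<bullet> P\<^sup>-\<^sup>1 x\<close> is a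
  Lyapunov function as soon as \<open>P\<close> is bounded above. The upper bound comes from the dual control
  problem on a window of fixed length, which needs uniform observability of \<open>(A, C)\<close> along \<open>Rh\<close>.
  As long as the error is small, \<open>Rh\<close> is uniformly close to \<open>R\<close>; by Arzela-Ascoli,
  a failure of uniform observability would then yield a limit trajectory of the true kinematics with
  a nonzero state that is invisible on a whole window, which the excitation of the outputs and of
  \<open>\<Omega>\<close> excludes. A continuation argument makes the smallness of the error self-sustaining.

  All definiteness and decay estimates for \<open>P\<close> are obtained from one barrier principle for
  matrix-valued functions, so that \<open>P\<^sup>-\<^sup>1\<close> never appears.
\<close>

section \<open>Matrix-valued functions and a barrier principle\<close>

text \<open>Observability is obtained by compactness because its exact version rests on a case
  distinction that is not quantitative: where \<open>(R a) \<bullet> (b1 \<times> b2)\<close> is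
  nonzero, invisibility forces \<open>x\<close> to be parallel to \<open>R a\<close>; where it
  vanishes, \<open>x\<close> is only known to be orthogonal to \<open>b1 \<times> b2\<close>.
  Passing to a limit avoids estimates near the zeros of that function.

  Products of values of \<open>A\<close> vanish, so the transition matrix of \<open>x' = A x\<close>
  is \<open>1\<close> plus the integral of \<open>A\<close>, and the control problem on a window can
  be solved by hand.

  The argument is circular at first sight: the bound on \<open>P\<close> holds only while
  \<open>Rh\<close> stays close to \<open>R\<close>, which is what the decay has to deliver. All
  constants are therefore fixed beforehand: a tolerance \<open>\<rho>\<close> from the true motion,
  \<open>a\<close> and \<open>b\<close>; then the bound \<open>pm\<close> from
  \<open>\<rho>\<close>, the weights and \<open>P0\<close>; then the size of the remainder and the
  threshold \<open>\<sigma>\<close>. None of them depends on the observer trajectory.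
  \<open>P\<close> enters the decay only through a lower bound at time 0 and the upper bound
  \<open>pm\<close>.\<close>

lemma norm_matrix_vector_mult_le: "norm (A *v x) \<le> norm A * norm (x::real^'n)"
proof -
  have "norm (A *v x) = L2_set (\<lambda>i. \<bar>A $ i \<bullet> x\<bar>) UNIV"
    by (simp add: norm_vec_def matrix_vector_mul_component)
  also have "\<dots> \<le> L2_set (\<lambda>i. norm x * norm (A $ i)) UNIV"
    by (rule L2_set_mono) (use Cauchy_Schwarz_ineq2 in \<open>auto simp: mult.commute[of "norm x"]\<close>)
  also have "\<dots> = norm x * norm A"
    by (simp add: norm_vec_def L2_set_right_distrib)
  finally show ?thesis by (simp add: mult.commute)
qed

lemma norm_transpose: "norm (transpose A) = norm (A::real^'n^'m)"
  unfolding norm_eq_sqrt_inner inner_vec_def transpose_def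
  by (simp add: sum.swap[of _ "UNIV::'n set"])

text \<open>The norm of a matrix type is the Frobenius norm. Row \<open>i\<close> of
  \<open>A ** B\<close> is \<open>transpose B\<close> applied to row \<open>i\<close> of
  \<open>A\<close>, so the vector estimate applies row by row.\<close>

lemma norm_matrix_matrix_mult_le: "norm (A ** B) \<le> norm (A::real^'n^'m) * norm (B::real^'k^'n)"
proof -
  have row: "(A ** B) $ i = transpose B *v (A $ i)" for i
    by (simp add: vec_eq_iff matrix_matrix_mult_def matrix_vector_mult_def transpose_def mult.commute)
  have "norm (A ** B) = L2_set (\<lambda>i. norm (transpose B *v (A $ i))) UNIV"
    by (simp add: norm_vec_def[of "A ** B"] row)
  also have "\<dots> \<le> L2_set (\<lambda>i. norm B * norm (A $ i)) UNIV"
    by (rule L2_set_mono) (use norm_matrix_vector_mult_le[of "transpose B"] in \<open>auto simp: norm_transpose\<close>)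
  also have "\<dots> = norm B * norm A"
    by (simp add: norm_vec_def[of A] L2_set_right_distrib)
  finally show ?thesis by (simp add: mult.commute)
qed

lemma bounded_bilinear_matrix_vector_mult:
  "bounded_bilinear ((*v) :: real^'n^'m \<Rightarrow> real^'n \<Rightarrow> real^'m)"
proof
  show "\<exists>K. \<forall>A x. norm ((A::real^'n^'m) *v x) \<le> norm A * norm x * K"
    by (rule exI[of _ 1]) (simp add: norm_matrix_vector_mult_le)
qed (simp_all add: matrix_vector_mult_add_rdistrib matrix_vector_right_distrib
    scaleR_matrix_vector_assoc matrix_vector_mult_scaleR)

lemma bounded_bilinear_matrix_matrix_mult:
  "bounded_bilinear ((**) :: real^'n^'m \<Rightarrow> real^'k^'n \<Rightarrow> real^'k^'m)"
proof
  show "\<exists>K. \<forall>A B. norm ((A::real^'n^'m) ** (B::real^'k^'n)) \<le> norm A * norm B * K"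
    by (rule exI[of _ 1]) (simp add: norm_matrix_matrix_mult_le)
qed (simp_all add: vec_eq_iff matrix_matrix_mult_def sum_distrib_left sum.distrib algebra_simps)

lemma bounded_linear_transpose: "bounded_linear (transpose :: real^'n^'m \<Rightarrow> real^'m^'n)"
proof
  show "\<exists>K. \<forall>A. norm (transpose (A::real^'n^'m)) \<le> norm A * K"
    by (rule exI[of _ 1]) (simp add: norm_transpose)
qed (simp_all add: transpose_def vec_eq_iff)

lemma skew_mult [simp]: "skew w *v x = cross3 w x"
  unfolding skew_def
  using matrix_works[of "cross3 w" x] bilinear_cross by (simp add: bilinear_def linear_matrix_vector_mul_eq)

lemma skew_entries:
  "skew w = vector [vector [0, - w$3, w$2], vector [w$3, 0, - w$1], vector [- w$2, w$1, 0]]"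
  unfolding skew_def matrix_def
  by (simp add: vec_eq_iff forall_3 cross3_simps axis_def)

lemma bounded_linear_skew: "bounded_linear skew"
  unfolding linear_conv_bounded_linear[symmetric]
  by (rule linearI) (simp_all add: skew_entries vec_eq_iff forall_3)

lemma transpose_skew [simp]: "transpose (skew w) = - skew w"
  by (simp add: skew_entries vec_eq_iff forall_3 transpose_def)

lemmas continuous_on_matrix_vector_mult [continuous_intros] =
  bounded_bilinear.continuous_on[OF bounded_bilinear_matrix_vector_mult]
lemmas continuous_on_matrix_matrix_mult [continuous_intros] =
  bounded_bilinear.continuous_on[OF bounded_bilinear_matrix_matrix_mult]
lemmas continuous_on_transpose [continuous_intros] =
  bounded_linear.continuous_on[OF bounded_linear_transpose]
lemmas continuous_on_skew [continuous_intros] =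
  bounded_linear.continuous_on[OF bounded_linear_skew]
lemmas has_vector_derivative_matrix_vector_mult =
  bounded_bilinear.has_vector_derivative[OF bounded_bilinear_matrix_vector_mult]
lemmas has_vector_derivative_matrix_matrix_mult =
  bounded_bilinear.has_vector_derivative[OF bounded_bilinear_matrix_matrix_mult]
lemmas has_vector_derivative_transpose =
  bounded_linear.has_vector_derivative[OF bounded_linear_transpose]

lemma transpose_add: "transpose (A + B) = transpose A + transpose (B::real^'n^'m)"
  and transpose_diff: "transpose (A - B) = transpose A - transpose (B::real^'n^'m)"
  by (simp_all add: transpose_def vec_eq_iff)

lemma inner_symmetric_matrix:
  assumes "symmetric_matrix M"
  shows "x \<bullet> (M *v y) = y \<bullet> (M *v x)"
  using assms dot_lmul_matrix[of x M y] unfolding symmetric_matrix_def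
  by (metis inner_commute transpose_matrix_vector)

text \<open>A zero of a nonnegative quadratic form is a minimum.\<close>
lemma pos_semidef_null_vector:
  assumes "pos_semidef M" and "x \<bullet> (M *v x) = 0"
  shows "M *v x = 0"
proof (rule ccontr)
  assume nz: "M *v x \<noteq> 0"
  define y where "y = M *v x"
  have sym: "symmetric_matrix M" and pos: "\<And>z. 0 \<le> z \<bullet> (M *v z)"
    using assms(1) by (auto simp: pos_semidef_def)
  define c where "c = y \<bullet> (M *v y)"
  have xy: "x \<bullet> (M *v y) = y \<bullet> y" using inner_symmetric_matrix[OF sym, of x y] by (simp add: y_def)
  have q: "(x - s *\<^sub>R y) \<bullet> (M *v (x - s *\<^sub>R y)) = s * (s * c - 2 * (y \<bullet> y))" for s
    using assms(2) xy
    by (simp add: matrix_vector_mult_diff_distrib matrix_vector_mult_scaleR inner_diff_left inner_diff_right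
        c_def y_def[symmetric] algebra_simps)
  have yy: "y \<bullet> y > 0" using nz by (simp add: y_def)
  have c0: "c \<ge> 0" using pos c_def by simp
  \<comment> \<open>The step must be positive and so short that \<open>s * c\<close> stays below
    \<open>2 * (y \<bullet> y)\<close>; \<open>c + 1\<close> keeps the quotient meaningful when
    \<open>c = 0\<close>.\<close>
  define s where "s = (y \<bullet> y) / (c + 1)"
  have s: "s > 0" using yy c0 by (simp add: s_def)
  have "s * c \<le> y \<bullet> y" using yy c0 by (simp add: s_def field_simps)
  then have "s * c - 2 * (y \<bullet> y) < 0" using yy by linarith
  then have "s * (s * c - 2 * (y \<bullet> y)) < 0" using s by (intro mult_pos_neg)
  then show False using q[of s] pos[of "x - s *\<^sub>R y"] by simp
qed

lemma nonpos_derivative_imp_le: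
  fixes f :: "real \<Rightarrow> real"
  assumes "a \<le> b" and der: "\<And>t. t \<in> {a..b} \<Longrightarrow> (f has_vector_derivative f' t) (at t within {a..b})"
    and "\<And>t. t \<in> {a..b} \<Longrightarrow> f' t \<le> 0"
  shows "f b \<le> f a"
proof (cases "a = b")
  case False
  then have ab: "a < b" using assms by simp
  obtain x where "x \<in> {a<..<b}" "f b - f a = (\<lambda>h. h * f' x) (b - a)"
    using mvt_simple[OF ab, of f "\<lambda>t h. h * f' t"] der
    unfolding has_vector_derivative_def by auto
  moreover have "(b - a) * f' x \<le> 0" using \<open>x \<in> _\<close> assms(3)[of x] ab by (intro mult_nonneg_nonpos) auto
  ultimately show ?thesis by simp
qed simp

text \<open>The form first degenerates at some time \<open>\<tau>\<close> and in some direction \<open>\<xi>\<close>; the null direction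
  of a semidefinite matrix lies in its kernel, so the hypothesis makes the form negative just before \<open>\<tau>\<close>.\<close>
lemma pos_def_barrier:
  fixes M :: "real \<Rightarrow> real^'n^'n"
  assumes der: "\<And>t. t \<in> {0..T} \<Longrightarrow> (M has_vector_derivative M' t) (at t within {0..T})"
    and sym: "\<And>t. t \<in> {0..T} \<Longrightarrow> symmetric_matrix (M t)"
    and init: "pos_def (M 0)"
    and crit: "\<And>t \<xi>. t \<in> {0<..T} \<Longrightarrow> \<xi> \<noteq> 0 \<Longrightarrow> pos_semidef (M t) \<Longrightarrow> M t *v \<xi> = 0
      \<Longrightarrow> 0 < \<xi> \<bullet> (M' t *v \<xi>)"
    and t: "t \<in> {0..T}"
  shows "pos_def (M t)"
proof (rule ccontr)
  assume contra: "\<not> pos_def (M t)"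
  define q where "q = (\<lambda>(t, \<xi>). \<xi> \<bullet> (M t *v \<xi>))"
  define D where "D = {0..T} \<times> sphere (0::real^'n) 1"
  \<comment> \<open>The pairs of a time and a unit vector at which the form is not positive.
    Compactness gives the projection to the time axis a least element, the first time of
    degeneration.\<close>
  define B where "B = D \<inter> q -` {..0}"
  have contM: "continuous_on {0..T} M"
    using der has_vector_derivative_continuous continuous_on_eq_continuous_within by blast
  have "continuous_on D q"
    unfolding q_def D_def split_def
    by (intro continuous_intros continuous_on_compose2[OF contM]) auto
  moreover have "compact D" unfolding D_def by (intro compact_Times) auto
  ultimately have "compact B"
    unfolding B_def by (meson compact_Int_closed closed_atMost continuous_closedin_preimage closedin_compact)
  then have cK: "compact (fst ` B)" by (intro compact_continuous_image continuous_intros)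
  have unit: "(s, x /\<^sub>R norm x) \<in> B" if "s \<in> {0..T}" "x \<noteq> 0" "x \<bullet> (M s *v x) \<le> 0" for s x
  proof -
    have "q (s, x /\<^sub>R norm x) = (x \<bullet> (M s *v x)) / (norm x * norm x)"
      by (simp add: q_def matrix_vector_mult_scaleR field_simps)
    also have "\<dots> \<le> 0" using that by (simp add: divide_nonpos_nonneg)
    finally show ?thesis using that by (simp add: B_def D_def)
  qed
  obtain x0 where "x0 \<noteq> 0" "x0 \<bullet> (M t *v x0) \<le> 0"
    using contra sym[OF t] unfolding pos_def_def by (auto simp: not_less)
  then have ne: "fst ` B \<noteq> {}" using unit[OF t] by blast
  obtain \<tau> where \<tau>: "\<tau> \<in> fst ` B" "\<And>s. s \<in> fst ` B \<Longrightarrow> \<tau> \<le> s"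
    using compact_attains_inf[OF cK ne] by blast
  then obtain \<xi> where \<xi>: "(\<tau>, \<xi>) \<in> B" by force
  then have \<tau>T: "\<tau> \<in> {0..T}" and \<xi>1: "norm \<xi> = 1" and q0: "\<xi> \<bullet> (M \<tau> *v \<xi>) \<le> 0"
    by (auto simp: B_def D_def q_def)
  then have \<xi>0: "\<xi> \<noteq> 0" by auto
  have before: "0 < x \<bullet> (M s *v x)" if "s \<in> {0..<\<tau>}" "x \<noteq> 0" for s x
  proof (rule ccontr)
    assume "\<not> 0 < x \<bullet> (M s *v x)"
    then have "(s, x /\<^sub>R norm x) \<in> B" using unit[of s x] that \<tau>T by auto
    then have "\<tau> \<le> s" using \<tau>(2) by force
    then show False using that by auto
  qed
  have "\<tau> \<noteq> 0" using q0 init \<xi>0 unfolding pos_def_def by force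
  then have \<tau>0: "0 < \<tau>" using \<tau>T by auto
  have derq: "((\<lambda>s. x \<bullet> (M s *v x)) has_vector_derivative x \<bullet> (M' \<tau> *v x)) (at \<tau> within {0..T})" for x
    by (rule bounded_linear.has_vector_derivative[OF bounded_linear_inner_right],
        rule bounded_linear.has_vector_derivative[OF bounded_bilinear.bounded_linear_left[OF bounded_bilinear_matrix_vector_mult]],
        rule der[OF \<tau>T])
  have ge: "0 \<le> x \<bullet> (M \<tau> *v x)" for x
  proof (cases "x = 0")
    case False
    have "((\<lambda>s. x \<bullet> (M s *v x)) \<longlongrightarrow> x \<bullet> (M \<tau> *v x)) (at \<tau> within {0..T})"
      using derq[of x] has_vector_derivative_continuous continuous_within by blast
    then have lim: "((\<lambda>s. x \<bullet> (M s *v x)) \<longlongrightarrow> x \<bullet> (M \<tau> *v x)) (at \<tau> within {0..<\<tau>})"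
      by (rule tendsto_within_subset) (use \<tau>T in auto)
    have "at \<tau> within {0..<\<tau>} \<noteq> bot"
      using \<tau>0 by (simp add: trivial_limit_within islimpt_Ico)
    moreover have "\<forall>\<^sub>F s in at \<tau> within {0..<\<tau>}. 0 \<le> x \<bullet> (M s *v x)"
      unfolding eventually_at_filter using before[OF _ False] by (auto intro: always_eventually less_imp_le)
    ultimately show ?thesis using lim tendsto_lowerbound by blast
  qed simp
  have psd: "pos_semidef (M \<tau>)" using ge sym[OF \<tau>T] by (simp add: pos_semidef_def)
  have ker: "M \<tau> *v \<xi> = 0" using pos_semidef_null_vector[OF psd] q0 ge[of \<xi>] by simp
  have "0 < \<xi> \<bullet> (M' \<tau> *v \<xi>)" using crit[OF _ \<xi>0 psd ker] \<tau>0 \<tau>T by simp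
  then obtain d where d: "d > 0"
    "\<And>h. h > 0 \<Longrightarrow> \<tau> - h \<in> {0..T} \<Longrightarrow> h < d \<Longrightarrow> \<xi> \<bullet> (M (\<tau> - h) *v \<xi>) < \<xi> \<bullet> (M \<tau> *v \<xi>)"
    using has_real_derivative_pos_inc_left[of "\<lambda>s. \<xi> \<bullet> (M s *v \<xi>)"] derq[of \<xi>]
    unfolding has_real_derivative_iff_has_vector_derivative by blast
  define h where "h = min \<tau> d / 2"
  have h: "0 < h" "h < d" "h < \<tau>" using d \<tau>0 by (auto simp: h_def)
  have "\<xi> \<bullet> (M (\<tau> - h) *v \<xi>) < 0" using d(2)[of h] h \<tau>T ker by auto
  moreover have "0 < \<xi> \<bullet> (M (\<tau> - h) *v \<xi>)" using before[of "\<tau> - h"] h \<xi>0 by auto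
  ultimately show False by simp
qed

section \<open>The Riccati equation\<close>

definition outer_product :: "real^'n \<Rightarrow> real^'m \<Rightarrow> real^'m^'n"
  where "outer_product x y = (\<chi> i j. x $ i * y $ j)"

lemma outer_product_mult [simp]: "outer_product x y *v z = (y \<bullet> z) *\<^sub>R x"
  by (simp add: outer_product_def vec_eq_iff matrix_vector_mult_def inner_vec_def
      sum_distrib_left mult_ac)

lemma bounded_bilinear_outer_product: "bounded_bilinear outer_product"
  unfolding bilinear_conv_bounded_bilinear[symmetric] bilinear_def
  by (auto intro!: linearI simp: outer_product_def vec_eq_iff algebra_simps)

lemma symmetric_outer_product: "symmetric_matrix (outer_product x (x :: real^'n))"
  by (simp add: symmetric_matrix_def outer_product_def transpose_def vec_eq_iff)

lemma symmetric_matrix_diff: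
  "symmetric_matrix A \<Longrightarrow> symmetric_matrix B \<Longrightarrow> symmetric_matrix (A - B)"
  by (simp add: symmetric_matrix_def transpose_diff)

lemma symmetric_matrix_scaleR: "symmetric_matrix A \<Longrightarrow> symmetric_matrix (c *\<^sub>R A)"
  by (simp add: symmetric_matrix_def transpose_def vec_eq_iff)

lemma symmetric_matrix_mat [simp]: "symmetric_matrix (mat c)"
  by (simp add: symmetric_matrix_def)

lemma abs_quadratic_form_le: "\<bar>x \<bullet> ((M :: real^'n^'m) *v y)\<bar> \<le> norm M * norm x * norm y"
proof -
  have "\<bar>x \<bullet> (M *v y)\<bar> \<le> norm x * norm (M *v y)" by (rule Cauchy_Schwarz_ineq2)
  also have "\<dots> \<le> norm x * (norm M * norm y)"
    by (rule mult_left_mono[OF norm_matrix_vector_mult_le norm_ge_zero])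
  finally show ?thesis by (simp add: mult_ac)
qed

lemma inner_transpose_mult: "x \<bullet> (transpose (M :: real^'n^'m) *v y) = (M *v x) \<bullet> y"
  using dot_lmul_matrix[of y M x] by (simp add: inner_commute)

text \<open>\<open>K\<close> abstracts \<open>C\<^sup>T Q C\<close>, of which the estimates use
  semidefiniteness and a norm bound. The horizon \<open>T\<close> is finite because the barrier
  argument works on a compact time interval, and because the smallness assumptions made further on
  hold only up to the current time of the continuation argument.\<close>

locale riccati_solution =
  fixes T :: real and A K V P :: "real \<Rightarrow> real^'n^'n" and \<alpha> k v \<epsilon> :: real
  assumes deriv: "\<And>t. t \<in> {0..T} \<Longrightarrow> (P has_vector_derivative
      A t ** P t + P t ** transpose (A t) - P t ** K t ** P t + V t) (at t within {0..T})"
    and A_bound: "\<And>t. t \<in> {0..T} \<Longrightarrow> norm (A t) \<le> \<alpha>"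
    and K_bound: "\<And>t. t \<in> {0..T} \<Longrightarrow> norm (K t) \<le> k"
    and V_bound: "\<And>t. t \<in> {0..T} \<Longrightarrow> norm (V t) \<le> v"
    and K_psd: "\<And>t. t \<in> {0..T} \<Longrightarrow> pos_semidef (K t)"
    and V_sym: "\<And>t. t \<in> {0..T} \<Longrightarrow> symmetric_matrix (V t)"
    and V_lower: "\<And>t \<xi>. t \<in> {0..T} \<Longrightarrow> \<epsilon> * (\<xi> \<bullet> \<xi>) \<le> \<xi> \<bullet> (V t *v \<xi>)"
    and \<epsilon>_pos: "0 < \<epsilon>"
    and init: "pos_def (P 0)"
begin

lemma K_sym: "t \<in> {0..T} \<Longrightarrow> symmetric_matrix (K t)"
  using K_psd by (simp add: pos_semidef_def)

text \<open>Symmetry propagates by uniqueness for a linear equation: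
  \<open>D = P - P\<^sup>T\<close> solves \<open>D' = F D + D G\<close> with \<open>D 0 = 0\<close>,
  and a weighted square of its norm is nonincreasing. The forms of \<open>F\<close> and
  \<open>G\<close> come from splitting
  \<open>P K P - P\<^sup>T K P\<^sup>T = P\<^sup>T K D + D K P\<close>.\<close>

lemma sym: assumes t: "t \<in> {0..T}" shows "symmetric_matrix (P t)"
proof -
  define D where "D t = P t - transpose (P t)" for t
  define F where "F t = A t - transpose (P t) ** K t" for t
  define G where "G t = transpose (A t) - K t ** P t" for t
  have contP: "continuous_on {0..T} P"
    using deriv has_vector_derivative_continuous continuous_on_eq_continuous_within by blast
  have "bounded (P ` {0..T})"
    using contP compact_continuous_image compact_imp_bounded by blast
  then obtain p where p: "\<And>t. t \<in> {0..T} \<Longrightarrow> norm (P t) \<le> p"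
    unfolding bounded_iff by (meson imageI)
  \<comment> \<open>The two terms of \<open>D'\<close> contribute at most
    \<open>2 * (\<alpha> + p * k)\<close> each to the growth rate of
    \<open>D \<bullet> D\<close>.\<close>
  define c where "c = 4 * (\<alpha> + p * k)"
  have bF: "norm (F t) \<le> \<alpha> + p * k" "norm (G t) \<le> \<alpha> + p * k" if "t \<in> {0..T}" for t
  proof -
    have pk: "norm (P t) * norm (K t) \<le> p * k"
      by (rule mult_mono[OF p[OF that] K_bound[OF that] order_trans[OF norm_ge_zero p[OF that]] norm_ge_zero])
    have "norm (transpose (P t) ** K t) \<le> p * k"
      by (rule order_trans[OF norm_matrix_matrix_mult_le]) (use pk in \<open>simp add: norm_transpose\<close>)
    then show "norm (F t) \<le> \<alpha> + p * k"
      unfolding F_def using A_bound[OF that] by (intro order_trans[OF norm_triangle_ineq4] add_mono)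
    have "norm (K t ** P t) \<le> p * k"
      by (rule order_trans[OF norm_matrix_matrix_mult_le]) (use pk in \<open>simp add: mult.commute\<close>)
    then show "norm (G t) \<le> \<alpha> + p * k"
      unfolding G_def using A_bound[OF that]
      by (intro order_trans[OF norm_triangle_ineq4] add_mono) (simp_all add: norm_transpose)
  qed
  define D' where "D' t = F t ** D t + D t ** G t" for t
  have derD: "(D has_vector_derivative D' t) (at t within {0..T})" if t: "t \<in> {0..T}" for t
  proof -
    have "transpose (K t) = K t" "transpose (V t) = V t"
      using K_sym V_sym t by (auto simp: symmetric_matrix_def)
    then have "D' t = (A t ** P t + P t ** transpose (A t) - P t ** K t ** P t + V t) -
        transpose (A t ** P t + P t ** transpose (A t) - P t ** K t ** P t + V t)"
      by (simp add: D'_def D_def F_def G_def transpose_add transpose_diff matrix_transpose_mul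
          matrix_mul_assoc bounded_bilinear.diff_left[OF bounded_bilinear_matrix_matrix_mult]
          bounded_bilinear.diff_right[OF bounded_bilinear_matrix_matrix_mult])
    then show ?thesis
      unfolding D_def using deriv[OF t]
      by (auto intro!: has_vector_derivative_diff has_vector_derivative_transpose)
  qed
  define f where "f t = exp (- c * t) * (D t \<bullet> D t)" for t
  define f' where "f' t = exp (- c * t) * (2 * (D t \<bullet> D' t) - c * (D t \<bullet> D t))" for t
  have derf: "(f has_vector_derivative f' s) (at s within {0..t})" if s: "s \<in> {0..t}" for s
  proof -
    have "(D has_vector_derivative D' s) (at s within {0..t})"
      using derD[of s] s t by (auto intro: has_vector_derivative_within_subset)
    then have "((\<lambda>t. D t \<bullet> D t) has_vector_derivative D s \<bullet> D' s + D' s \<bullet> D s) (at s within {0..t})"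
      by (intro bounded_bilinear.has_vector_derivative[OF bounded_bilinear_inner])
    then show ?thesis
      unfolding f_def f'_def has_real_derivative_iff_has_vector_derivative[symmetric]
      by (auto intro!: derivative_eq_intros simp: inner_commute algebra_simps)
  qed
  have "f' s \<le> 0" if s: "s \<in> {0..t}" for s
  proof -
    have s': "s \<in> {0..T}" using s t by auto
    have "D s \<bullet> D' s \<le> norm (D s) * norm (D' s)" by (rule norm_cauchy_schwarz)
    also have "norm (D' s) \<le> norm (F s) * norm (D s) + norm (D s) * norm (G s)"
      unfolding D'_def by (intro order_trans[OF norm_triangle_ineq] add_mono norm_matrix_matrix_mult_le)
    also have "\<dots> \<le> (\<alpha> + p * k) * norm (D s) + norm (D s) * (\<alpha> + p * k)"
      using bF[OF s'] by (intro add_mono mult_right_mono mult_left_mono) auto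
    finally have "D s \<bullet> D' s \<le> norm (D s) * ((\<alpha> + p * k) * norm (D s) + norm (D s) * (\<alpha> + p * k))"
      by (simp add: mult_left_mono)
    then have "2 * (D s \<bullet> D' s) \<le> c * (norm (D s))\<^sup>2"
      by (simp add: c_def algebra_simps power2_eq_square)
    then show ?thesis
      unfolding f'_def by (intro mult_nonneg_nonpos) (simp_all add: power2_norm_eq_inner)
  qed
  then have "f t \<le> f 0" using nonpos_derivative_imp_le[of 0 t f f'] derf t by auto
  moreover have "D 0 = 0" using init by (simp add: D_def pos_def_def symmetric_matrix_def)
  ultimately have "exp (- c * t) * (D t \<bullet> D t) \<le> 0" by (simp add: f_def)
  then have "D t \<bullet> D t \<le> 0" by (simp add: mult_le_0_iff)
  then have "D t = 0" by (metis inner_eq_zero_iff inner_ge_zero order_antisym)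
  then show ?thesis by (simp add: D_def symmetric_matrix_def)
qed

text \<open>By symmetry the form sees \<open>P\<close> only through the vector
  \<open>P \<xi>\<close>. A critical direction of a barrier determines this vector, so the identity
  reduces the barrier condition to a scalar inequality.\<close>

lemma quadratic_form_rhs:
  assumes "t \<in> {0..T}"
  shows "\<xi> \<bullet> ((A t ** P t + P t ** transpose (A t) - P t ** K t ** P t + V t) *v \<xi>) =
    2 * ((P t *v \<xi>) \<bullet> (transpose (A t) *v \<xi>)) - (P t *v \<xi>) \<bullet> (K t *v (P t *v \<xi>)) + \<xi> \<bullet> (V t *v \<xi>)"
proof -
  have "\<xi> \<bullet> (P t *v y) = (P t *v \<xi>) \<bullet> y" for y
    using inner_symmetric_matrix[OF sym[OF assms], of \<xi> y] by (simp add: inner_commute)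
  moreover have "\<xi> \<bullet> (A t *v y) = y \<bullet> (transpose (A t) *v \<xi>)" for y
    using inner_transpose_mult[of y "A t" \<xi>] by (simp only: inner_commute)
  ultimately show ?thesis
    by (simp add: matrix_vector_mult_add_rdistrib matrix_vector_mult_diff_rdistrib inner_diff_right
        inner_add_right flip: matrix_vector_mul_assoc)
qed

text \<open>In a direction with \<open>P \<xi> = 0\<close> all terms containing \<open>P\<close>
  disappear, and the form of \<open>V\<close> that remains is positive.\<close>

lemma pos_def_solution: "t \<in> {0..T} \<Longrightarrow> pos_def (P t)"
proof (rule pos_def_barrier[OF deriv sym init])
  fix t \<xi> assume t: "t \<in> {0<..T}" and \<xi>: "\<xi> \<noteq> 0" and ker: "P t *v \<xi> = 0"
  have "0 < \<epsilon> * (\<xi> \<bullet> \<xi>)" using \<xi> \<epsilon>_pos by simp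
  also have "\<dots> \<le> \<xi> \<bullet> (V t *v \<xi>)" using V_lower t by simp
  finally show "0 < \<xi> \<bullet> ((A t ** P t + P t ** transpose (A t) - P t ** K t ** P t + V t) *v \<xi>)"
    using t by (subst quadratic_form_rhs) (auto simp: ker)
qed

text \<open>A crude bound without observability, for times before a full observation window has
  elapsed. The barrier is \<open>f I - P\<close> with \<open>f' = c f\<close>. In a critical
  direction \<open>P \<xi> = f \<xi>\<close>: the term in \<open>K\<close> has a favourable sign,
  \<open>A\<close> costs at most \<open>2 * \<alpha> * f\<close>, \<open>V\<close> costs at most
  \<open>v \<le> v * f\<close> because \<open>1 \<le> f\<close>, and the summand 1 of
  \<open>c\<close> is left over.\<close>

lemma growth_bound:
  assumes t: "t \<in> {0..T}"
  shows "\<xi> \<bullet> (P t *v \<xi>) \<le> (1 + norm (P 0)) * exp ((2 * \<alpha> + v + 1) * t) * (\<xi> \<bullet> \<xi>)"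
proof -
  define c where "c = 2 * \<alpha> + v + 1"
  define f where "f t = (1 + norm (P 0)) * exp (c * t)" for t
  define M where "M t = f t *\<^sub>R mat 1 - P t" for t
  define M' where "M' t = (c * f t) *\<^sub>R mat 1 -
    (A t ** P t + P t ** transpose (A t) - P t ** K t ** P t + V t)" for t
  have "pos_def (M t)"
  proof (rule pos_def_barrier[OF _ _ _ _ t])
    fix t assume t: "t \<in> {0..T}"
    have "(f has_vector_derivative c * f t) (at t within {0..T})"
      unfolding f_def has_real_derivative_iff_has_vector_derivative[symmetric]
      by (auto intro!: derivative_eq_intros)
    from bounded_linear.has_vector_derivative[OF bounded_linear_scaleR_left this]
    show "(M has_vector_derivative M' t) (at t within {0..T})"
      unfolding M_def M'_def using deriv[OF t] by (intro has_vector_derivative_diff)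
    show "symmetric_matrix (M t)"
      unfolding M_def using sym[OF t] by (intro symmetric_matrix_diff symmetric_matrix_scaleR) auto
  next
    have 0: "0 \<in> {0..T}" using t by auto
    show "pos_def (M 0)"
      unfolding pos_def_def
    proof (intro conjI allI impI)
      show "symmetric_matrix (M 0)"
        unfolding M_def using sym[OF 0] by (intro symmetric_matrix_diff symmetric_matrix_scaleR) auto
      fix x :: "real^'n" assume x: "x \<noteq> 0"
      have "x \<bullet> (M 0 *v x) = (x \<bullet> x) + norm (P 0) * (x \<bullet> x) - x \<bullet> (P 0 *v x)"
        by (simp add: M_def f_def distrib_right matrix_vector_mult_diff_rdistrib inner_diff_right
            flip: scaleR_matrix_vector_assoc)
      moreover have "x \<bullet> (P 0 *v x) \<le> norm (P 0) * (x \<bullet> x)"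
        using abs_quadratic_form_le[of x "P 0" x] by (simp add: power2_norm_eq_inner[symmetric] power2_eq_square mult.assoc)
      moreover have "0 < x \<bullet> x" using x by simp
      ultimately show "0 < x \<bullet> (M 0 *v x)" by linarith
    qed
  next
    fix t \<xi> assume t: "t \<in> {0<..T}" and \<xi>: "\<xi> \<noteq> 0" and "M t *v \<xi> = 0"
    then have t': "t \<in> {0..T}" and "f t *\<^sub>R \<xi> - P t *v \<xi> = 0"
      by (simp_all add: M_def matrix_vector_mult_diff_rdistrib scaleR_matrix_vector_assoc[symmetric])
    then have ker: "P t *v \<xi> = f t *\<^sub>R \<xi>" by simp
    have \<alpha>: "0 \<le> \<alpha>" and v: "0 \<le> v"
      using order_trans[OF norm_ge_zero A_bound[OF t']] order_trans[OF norm_ge_zero V_bound[OF t']] by auto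
    have "1 \<le> exp (c * t)" using \<alpha> v t by (simp add: c_def)
    then have f: "1 \<le> f t" unfolding f_def
      using mult_mono[of 1 "1 + norm (P 0)" 1 "exp (c * t)"] by simp
    have 1: "\<xi> \<bullet> (transpose (A t) *v \<xi>) \<le> \<alpha> * (\<xi> \<bullet> \<xi>)"
    proof -
      have "\<xi> \<bullet> (transpose (A t) *v \<xi>) \<le> norm (A t) * (\<xi> \<bullet> \<xi>)"
        using abs_quadratic_form_le[of \<xi> "transpose (A t)" \<xi>]
        by (simp add: norm_transpose power2_norm_eq_inner[symmetric] power2_eq_square mult.assoc)
      then show ?thesis using A_bound[OF t'] by (smt (verit) inner_ge_zero mult_right_mono)
    qed
    have 2: "\<xi> \<bullet> (V t *v \<xi>) \<le> v * (\<xi> \<bullet> \<xi>)"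
    proof -
      have "\<xi> \<bullet> (V t *v \<xi>) \<le> norm (V t) * (\<xi> \<bullet> \<xi>)"
        using abs_quadratic_form_le[of \<xi> "V t" \<xi>]
        by (simp add: power2_norm_eq_inner[symmetric] power2_eq_square mult.assoc)
      then show ?thesis using V_bound[OF t'] by (smt (verit) inner_ge_zero mult_right_mono)
    qed
    have 3: "0 \<le> \<xi> \<bullet> (K t *v \<xi>)" using K_psd[OF t'] by (simp add: pos_semidef_def)
    have "\<xi> \<bullet> (M' t *v \<xi>) = c * f t * (\<xi> \<bullet> \<xi>) - (2 * f t * (\<xi> \<bullet> (transpose (A t) *v \<xi>))
        - f t * f t * (\<xi> \<bullet> (K t *v \<xi>)) + \<xi> \<bullet> (V t *v \<xi>))"
      unfolding M'_def matrix_vector_mult_diff_rdistrib inner_diff_right quadratic_form_rhs[OF t'] ker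
      by (simp add: matrix_vector_mult_scaleR flip: scaleR_matrix_vector_assoc)
    also have "\<dots> \<ge> c * f t * (\<xi> \<bullet> \<xi>) - (2 * f t * (\<alpha> * (\<xi> \<bullet> \<xi>)) + f t * (v * (\<xi> \<bullet> \<xi>)))"
    proof -
      have "f t * (\<xi> \<bullet> (transpose (A t) *v \<xi>)) \<le> f t * (\<alpha> * (\<xi> \<bullet> \<xi>))"
        using 1 f by (intro mult_left_mono) auto
      moreover have "v * (\<xi> \<bullet> \<xi>) \<le> f t * (v * (\<xi> \<bullet> \<xi>))"
        using f v mult_right_mono[of 1 "f t" "v * (\<xi> \<bullet> \<xi>)"] by simp
      moreover have "0 \<le> f t * f t * (\<xi> \<bullet> (K t *v \<xi>))" using f 3 by simp
      ultimately show ?thesis using 2 by linarith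
    qed
    finally have "c * f t * (\<xi> \<bullet> \<xi>) - (2 * f t * (\<alpha> * (\<xi> \<bullet> \<xi>)) + f t * (v * (\<xi> \<bullet> \<xi>)))
      \<le> \<xi> \<bullet> (M' t *v \<xi>)" .
    moreover have "c * f t * (\<xi> \<bullet> \<xi>) - (2 * f t * (\<alpha> * (\<xi> \<bullet> \<xi>)) + f t * (v * (\<xi> \<bullet> \<xi>))) = f t * (\<xi> \<bullet> \<xi>)"
      by (simp add: c_def algebra_simps)
    moreover have "0 < f t * (\<xi> \<bullet> \<xi>)" using f \<xi> by simp
    ultimately show "0 < \<xi> \<bullet> (M' t *v \<xi>)" by linarith
  qed
  then have "0 \<le> \<xi> \<bullet> (M t *v \<xi>)" unfolding pos_def_def by (cases "\<xi> = 0") (auto intro: less_imp_le)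
  moreover have "\<xi> \<bullet> (M t *v \<xi>) = f t * (\<xi> \<bullet> \<xi>) - \<xi> \<bullet> (P t *v \<xi>)"
    by (simp add: M_def matrix_vector_mult_diff_rdistrib inner_diff_right
        flip: scaleR_matrix_vector_assoc)
  ultimately show ?thesis unfolding f_def c_def by linarith
qed

text \<open>Completion of squares in the dual control problem whose optimal cost is \<open>\<eta> \<bullet> P \<eta>\<close>,
  for the control \<open>K x\<close>.\<close>
lemma window_bound:
  assumes t: "0 \<le> t0" "t0 \<le> t1" "t1 \<le> T"
    and der: "\<And>s. s \<in> {t0..t1} \<Longrightarrow> (\<eta> has_vector_derivative
        - (transpose (A s) *v \<eta> s) - K s *v x s) (at s within {t0..t1})"
    and bound: "\<And>s. s \<in> {t0..t1} \<Longrightarrow> \<eta> s \<bullet> (V s *v \<eta> s) + x s \<bullet> (K s *v x s) \<le> B"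
  shows "\<eta> t1 \<bullet> (P t1 *v \<eta> t1) \<le> \<eta> t0 \<bullet> (P t0 *v \<eta> t0) + B * (t1 - t0)"
proof -
  define f where "f s = \<eta> s \<bullet> (P s *v \<eta> s) - B * s" for s
  define P' where "P' s = A s ** P s + P s ** transpose (A s) - P s ** K s ** P s + V s" for s
  define \<eta>' where "\<eta>' s = - (transpose (A s) *v \<eta> s) - K s *v x s" for s
  define f' where "f' s = \<eta> s \<bullet> (P s *v \<eta>' s + P' s *v \<eta> s) + \<eta>' s \<bullet> (P s *v \<eta> s) - B" for s
  have "f t1 \<le> f t0"
  proof (rule nonpos_derivative_imp_le[of t0 t1 f f'])
    fix s assume s: "s \<in> {t0..t1}"
    have sT: "s \<in> {0..T}" using s t by auto
    have dP: "(P has_vector_derivative P' s) (at s within {t0..t1})"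
      unfolding P'_def by (rule has_vector_derivative_within_subset[OF deriv[OF sT]]) (use t in auto)
    have d\<eta>: "(\<eta> has_vector_derivative \<eta>' s) (at s within {t0..t1})"
      unfolding \<eta>'_def by (rule der[OF s])
    have "((\<lambda>s. B * s) has_vector_derivative B) (at s within {t0..t1})"
      unfolding has_real_derivative_iff_has_vector_derivative[symmetric]
      by (auto intro!: derivative_eq_intros)
    then show "(f has_vector_derivative f' s) (at s within {t0..t1})"
      unfolding f_def f'_def
      by (intro has_vector_derivative_diff bounded_bilinear.has_vector_derivative[OF bounded_bilinear_inner]
          d\<eta> has_vector_derivative_matrix_vector_mult dP)
    define z where "z = P s *v \<eta> s"
    have "\<eta> s \<bullet> (P s *v \<eta>' s) = z \<bullet> \<eta>' s"
      using inner_symmetric_matrix[OF sym[OF sT]] by (simp add: z_def inner_commute)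
    then have "f' s = 2 * (z \<bullet> \<eta>' s) + \<eta> s \<bullet> (P' s *v \<eta> s) - B"
      by (simp add: f'_def z_def inner_add_right inner_commute)
    also have "\<dots> = - 2 * (z \<bullet> (K s *v x s)) - z \<bullet> (K s *v z) + \<eta> s \<bullet> (V s *v \<eta> s) - B"
      unfolding P'_def quadratic_form_rhs[OF sT] z_def[symmetric]
      by (simp add: \<eta>'_def inner_diff_right)
    also have "\<dots> \<le> - 2 * (z \<bullet> (K s *v x s)) - z \<bullet> (K s *v z) - x s \<bullet> (K s *v x s)"
      using bound[OF s] by simp
    also have "\<dots> = - ((z + x s) \<bullet> (K s *v (z + x s)))"
      using inner_symmetric_matrix[OF K_sym[OF sT], of "x s" z]
      by (simp add: matrix_vector_right_distrib inner_add_left inner_add_right)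
    also have "\<dots> \<le> 0" using K_psd[OF sT] by (simp add: pos_semidef_def)
    finally show "f' s \<le> 0" .
  qed (use t in auto)
  then show ?thesis by (simp add: f_def algebra_simps)
qed

text \<open>The estimate says \<open>x \<bullet> P\<^sup>-\<^sup>1 x \<le> w\<close> for an exponentially decaying \<open>w\<close>; it is
  proved as positivity of \<open>w P - x x\<^sup>T\<close>, which involves no matrix inverse.\<close>
lemma exponential_decay:
  assumes x: "\<And>t. t \<in> {0..T} \<Longrightarrow> (x has_vector_derivative
        A t *v x t - P t *v (K t *v x t) + r t) (at t within {0..T})"
    and r: "\<And>t. t \<in> {0..T} \<Longrightarrow> norm (r t) \<le> c * (x t \<bullet> x t)" and c: "0 \<le> c"
    and x_small: "\<And>t. t \<in> {0..T} \<Longrightarrow> norm (x t) \<le> \<sigma>" and \<sigma>: "4 * c * pm * \<sigma> \<le> \<epsilon>"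
    and pm: "0 < pm" and P_le: "\<And>t \<xi>. t \<in> {0..T} \<Longrightarrow> \<xi> \<bullet> (P t *v \<xi>) \<le> pm * (\<xi> \<bullet> \<xi>)"
    and p0: "0 < p0" and P0_ge: "\<And>\<xi>. p0 * (\<xi> \<bullet> \<xi>) \<le> \<xi> \<bullet> (P 0 *v \<xi>)"
    and t: "t \<in> {0..T}"
  shows "x t \<bullet> x t \<le> pm / p0 * exp (- (\<epsilon> / (4 * pm)) * t) * (x 0 \<bullet> x 0)"
proof -
  define \<kappa> where "\<kappa> = \<epsilon> / (4 * pm)"
  have 0: "0 \<in> {0..T}" using t by auto
  \<comment> \<open>Equality \<open>w0 = (x 0 \<bullet> x 0) / p0\<close> would make the initial
    matrix merely semidefinite. A strictly larger \<open>w0\<close> is used, and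
    \<open>dense_ge\<close> removes the slack at the end.\<close>
  have main: "x t \<bullet> x t \<le> w0 * exp (- \<kappa> * t) * pm" if w0: "(x 0 \<bullet> x 0) / p0 < w0" for w0
  proof -
    have w0p: "0 < w0" using w0 p0 by (smt (verit) divide_nonneg_pos inner_ge_zero)
    define w where "w t = w0 * exp (- \<kappa> * t)" for t
    have wp: "0 < w t" for t using w0p by (simp add: w_def)
    define P' where "P' s = A s ** P s + P s ** transpose (A s) - P s ** K s ** P s + V s" for s
    define x' where "x' t = A t *v x t - P t *v (K t *v x t) + r t" for t
    define M where "M t = w t *\<^sub>R P t - outer_product (x t) (x t)" for t
    define M' where "M' t = w t *\<^sub>R P' t + (- \<kappa> * w t) *\<^sub>R P t
      - (outer_product (x t) (x' t) + outer_product (x' t) (x t))" for t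
    have Mx: "\<xi> \<bullet> (M t *v \<xi>) = w t * (\<xi> \<bullet> (P t *v \<xi>)) - (x t \<bullet> \<xi>)\<^sup>2" for \<xi> t
      by (simp add: M_def matrix_vector_mult_diff_rdistrib inner_diff_right power2_eq_square
          inner_commute flip: scaleR_matrix_vector_assoc)
    have Msym: "symmetric_matrix (M t)" if "t \<in> {0..T}" for t
      unfolding M_def using sym[OF that]
      by (intro symmetric_matrix_diff symmetric_matrix_scaleR symmetric_outer_product)
    have "pos_def (M t)"
    proof (rule pos_def_barrier[OF _ Msym _ _ t])
      fix t assume t: "t \<in> {0..T}"
      have "(w has_vector_derivative - \<kappa> * w t) (at t within {0..T})"
        unfolding w_def has_real_derivative_iff_has_vector_derivative[symmetric]
        by (auto intro!: derivative_eq_intros)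
      then show "(M has_vector_derivative M' t) (at t within {0..T})"
        unfolding M_def M'_def
        by (intro has_vector_derivative_diff bounded_bilinear.has_vector_derivative[OF bounded_bilinear_scaleR]
            bounded_bilinear.has_vector_derivative[OF bounded_bilinear_outer_product])
          (use deriv[OF t] x[OF t] in \<open>simp_all add: P'_def x'_def\<close>)
    next
      show "pos_def (M 0)"
        unfolding pos_def_def
      proof (intro conjI allI impI Msym[OF 0])
        fix \<xi> :: "real^'n" assume "\<xi> \<noteq> 0"
        then have \<xi>: "0 < \<xi> \<bullet> \<xi>" by simp
        have "(x 0 \<bullet> \<xi>)\<^sup>2 \<le> (x 0 \<bullet> x 0) * (\<xi> \<bullet> \<xi>)" by (rule Cauchy_Schwarz_ineq)
        also have "\<dots> < w0 * p0 * (\<xi> \<bullet> \<xi>)" using w0 p0 \<xi> by (simp add: field_simps)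
        also have "\<dots> \<le> w0 * (\<xi> \<bullet> (P 0 *v \<xi>))"
          using P0_ge[of \<xi>] w0p by (simp add: mult.assoc)
        finally show "0 < \<xi> \<bullet> (M 0 *v \<xi>)" by (simp add: Mx w_def)
      qed
    next
      fix t \<xi> assume "t \<in> {0<..T}" and \<xi>: "\<xi> \<noteq> 0" and psd: "pos_semidef (M t)" and "M t *v \<xi> = 0"
      then have t: "t \<in> {0..T}" and "w t *\<^sub>R (P t *v \<xi>) = (x t \<bullet> \<xi>) *\<^sub>R x t"
        by (auto simp: M_def matrix_vector_mult_diff_rdistrib scaleR_matrix_vector_assoc[symmetric])
      then have "(1 / w t) *\<^sub>R (w t *\<^sub>R (P t *v \<xi>)) = ((x t \<bullet> \<xi>) / w t) *\<^sub>R x t"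
        by simp
      then have ker: "P t *v \<xi> = ((x t \<bullet> \<xi>) / w t) *\<^sub>R x t"
        using wp[of t] by simp
      define u where "u = x t \<bullet> \<xi>"
      have \<xi>p: "0 < \<xi> \<bullet> \<xi>" using \<xi> by simp
      \<comment> \<open>Semidefiniteness tested in the direction of the error itself bounds
        \<open>x \<bullet> x\<close> by a multiple of \<open>w\<close>; this makes the remainder
        term, cubic in the error, comparable with the term from \<open>V\<close>.\<close>
      have xx: "x t \<bullet> x t \<le> w t * pm"
      proof -
        have "0 \<le> x t \<bullet> (M t *v x t)" using psd by (simp add: pos_semidef_def)
        then have "(x t \<bullet> x t)\<^sup>2 \<le> w t * (x t \<bullet> (P t *v x t))" by (simp add: Mx)
        also have "\<dots> \<le> w t * (pm * (x t \<bullet> x t))"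
          using P_le[OF t] wp[of t] by (intro mult_left_mono) auto
        finally have "(x t \<bullet> x t) * (x t \<bullet> x t) \<le> (w t * pm) * (x t \<bullet> x t)"
          by (simp add: power2_eq_square mult.assoc)
        then show ?thesis using wp[of t] pm
          by (smt (verit) inner_ge_zero mult_pos_pos mult_le_cancel_right)
      qed
      have PKx: "\<xi> \<bullet> (P t *v y) = (u / w t) * (x t \<bullet> y)" for y
        using inner_symmetric_matrix[OF sym[OF t], of \<xi> y] by (simp add: ker u_def inner_commute)
      have Ax: "\<xi> \<bullet> (A t *v x t) = x t \<bullet> (transpose (A t) *v \<xi>)"
        by (metis inner_commute inner_transpose_mult)
      have 1: "w t * (\<xi> \<bullet> (P' t *v \<xi>)) = 2 * u * (x t \<bullet> (transpose (A t) *v \<xi>))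
          - u\<^sup>2 / w t * (x t \<bullet> (K t *v x t)) + w t * (\<xi> \<bullet> (V t *v \<xi>))"
        unfolding P'_def quadratic_form_rhs[OF t] ker u_def[symmetric]
        using wp[of t] by (simp add: matrix_vector_mult_scaleR field_simps power2_eq_square)
      have 2: "\<xi> \<bullet> x' t = x t \<bullet> (transpose (A t) *v \<xi>) - (u / w t) * (x t \<bullet> (K t *v x t)) + \<xi> \<bullet> r t"
        by (simp add: x'_def inner_diff_right inner_add_right Ax PKx)
      have "\<xi> \<bullet> (M' t *v \<xi>) = w t * (\<xi> \<bullet> (P' t *v \<xi>)) - \<kappa> * w t * (\<xi> \<bullet> (P t *v \<xi>)) - 2 * u * (\<xi> \<bullet> x' t)"
        by (simp add: M'_def matrix_vector_mult_diff_rdistrib matrix_vector_mult_add_rdistrib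
            inner_diff_right inner_add_right inner_commute u_def flip: scaleR_matrix_vector_assoc)
      \<comment> \<open>Substituting \<open>P \<xi> = (u / w) x\<close> cancels the terms in
        \<open>A\<close>. The term in \<open>K\<close> occurs once negatively from \<open>P'\<close>
        and twice positively from the derivative of \<open>x x\<^sup>T\<close>, so it remains with a
        favourable sign.\<close>
      also have "\<dots> = u\<^sup>2 / w t * (x t \<bullet> (K t *v x t)) + w t * (\<xi> \<bullet> (V t *v \<xi>))
          - \<kappa> * w t * (\<xi> \<bullet> (P t *v \<xi>)) - 2 * (u * (\<xi> \<bullet> r t))"
        unfolding 1 2 by (simp add: algebra_simps power2_eq_square)
      \<comment> \<open>The budget: of the amount
        \<open>w * \<epsilon> * (\<xi> \<bullet> \<xi>)\<close> supplied by \<open>V\<close>, the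
        decay rate takes a quarter since \<open>\<kappa> * pm = \<epsilon> / 4\<close>, the
        remainder takes two quarters by the assumption on \<open>\<sigma>\<close>, and one quarter
        is left.\<close>
      also have "\<dots> \<ge> w t * (\<epsilon> * (\<xi> \<bullet> \<xi>)) - \<kappa> * w t * (pm * (\<xi> \<bullet> \<xi>)) - 2 * (w t * (\<epsilon> / 4) * (\<xi> \<bullet> \<xi>))"
      proof -
        have "0 \<le> u\<^sup>2 / w t * (x t \<bullet> (K t *v x t))"
          using K_psd[OF t] wp[of t] by (simp add: pos_semidef_def)
        moreover have "w t * (\<epsilon> * (\<xi> \<bullet> \<xi>)) \<le> w t * (\<xi> \<bullet> (V t *v \<xi>))"
          using V_lower[OF t] wp[of t] by (intro mult_left_mono) auto
        moreover have "\<kappa> * w t * (\<xi> \<bullet> (P t *v \<xi>)) \<le> \<kappa> * w t * (pm * (\<xi> \<bullet> \<xi>))"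
          using P_le[OF t, of \<xi>] wp[of t] \<epsilon>_pos pm by (intro mult_left_mono) (auto simp: \<kappa>_def)
        moreover have "u * (\<xi> \<bullet> r t) \<le> w t * (\<epsilon> / 4) * (\<xi> \<bullet> \<xi>)"
        proof -
          have "u * (\<xi> \<bullet> r t) \<le> \<bar>u\<bar> * \<bar>\<xi> \<bullet> r t\<bar>" by (metis abs_ge_self abs_mult)
          also have "\<dots> \<le> (norm (x t) * norm \<xi>) * (norm \<xi> * (c * (x t \<bullet> x t)))"
            unfolding u_def by (intro mult_mono Cauchy_Schwarz_ineq2
                order_trans[OF Cauchy_Schwarz_ineq2] r[OF t]) auto
          also have "\<dots> = norm (x t) * (c * (x t \<bullet> x t) * (\<xi> \<bullet> \<xi>))"
            by (simp add: power2_norm_eq_inner[symmetric] power2_eq_square)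
          also have "\<dots> \<le> \<sigma> * (c * (w t * pm) * (\<xi> \<bullet> \<xi>))"
            using x_small[OF t] xx c order_trans[OF norm_ge_zero x_small[OF t]]
            by (intro mult_mono mult_left_mono mult_right_mono) auto
          also have "\<dots> = (4 * c * pm * \<sigma>) * (w t * (\<xi> \<bullet> \<xi>) / 4)" by simp
          also have "\<dots> \<le> \<epsilon> * (w t * (\<xi> \<bullet> \<xi>) / 4)"
            using \<sigma> wp[of t] by (intro mult_right_mono) auto
          finally show ?thesis by (simp add: mult_ac)
        qed
        ultimately show ?thesis by linarith
      qed
      finally have "w t * (\<epsilon> * (\<xi> \<bullet> \<xi>)) - \<kappa> * w t * (pm * (\<xi> \<bullet> \<xi>)) - 2 * (w t * (\<epsilon> / 4) * (\<xi> \<bullet> \<xi>))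
        \<le> \<xi> \<bullet> (M' t *v \<xi>)" .
      moreover have "w t * (\<epsilon> * (\<xi> \<bullet> \<xi>)) - \<kappa> * w t * (pm * (\<xi> \<bullet> \<xi>)) - 2 * (w t * (\<epsilon> / 4) * (\<xi> \<bullet> \<xi>))
          = w t * (\<epsilon> / 4) * (\<xi> \<bullet> \<xi>)"
        using pm by (simp add: \<kappa>_def field_simps)
      moreover have "0 < w t * (\<epsilon> / 4) * (\<xi> \<bullet> \<xi>)" using wp[of t] \<epsilon>_pos \<xi>p by simp
      ultimately show "0 < \<xi> \<bullet> (M' t *v \<xi>)" by linarith
    qed
    then have "0 \<le> x t \<bullet> (M t *v x t)"
      unfolding pos_def_def by (cases "x t = 0") (auto intro: less_imp_le)
    then have "(x t \<bullet> x t)\<^sup>2 \<le> w t * (x t \<bullet> (P t *v x t))" by (simp add: Mx)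
    also have "\<dots> \<le> w t * (pm * (x t \<bullet> x t))"
      using P_le[OF t] wp[of t] by (intro mult_left_mono) auto
    finally have "(x t \<bullet> x t) * (x t \<bullet> x t) \<le> (w t * pm) * (x t \<bullet> x t)"
      by (simp add: power2_eq_square mult.assoc)
    then show ?thesis using wp[of t] pm unfolding w_def
      by (smt (verit) inner_ge_zero mult_pos_pos mult_le_cancel_right)
  qed
  have "(x t \<bullet> x t) / (exp (- \<kappa> * t) * pm) \<le> (x 0 \<bullet> x 0) / p0"
  proof (rule dense_ge)
    fix w0 assume "(x 0 \<bullet> x 0) / p0 < w0"
    from main[OF this] show "(x t \<bullet> x t) / (exp (- \<kappa> * t) * pm) \<le> w0"
      using pm by (simp add: divide_le_eq mult.assoc)
  qed
  then show ?thesis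
    unfolding \<kappa>_def[symmetric] using pm p0 by (simp add: divide_le_eq mult_ac)
qed

end

section \<open>Observability of a single trajectory\<close>

lemma bounded_bilinear_cross3: "bounded_bilinear cross3"
  using bilinear_cross bilinear_conv_bounded_bilinear by blast

text \<open>\<open>x\<close> is orthogonal to \<open>\<alpha> \<times> b1\<close> and
  \<open>\<alpha> \<times> b2\<close>, whose cross product is a nonzero multiple of
  \<open>\<alpha>\<close>; only the line of \<open>\<alpha>\<close> is left.\<close>

lemma parallel_of_orthogonal_crosses:
  assumes "\<alpha> \<bullet> cross3 b1 x = 0" "\<alpha> \<bullet> cross3 b2 x = 0" "\<alpha> \<bullet> cross3 b1 b2 \<noteq> 0" "norm \<alpha> = 1"
  shows "x = (\<alpha> \<bullet> x) *\<^sub>R \<alpha>"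
proof -
  have "cross3 x (cross3 (cross3 \<alpha> b1) (cross3 \<alpha> b2))
      = (x \<bullet> cross3 \<alpha> b2) *\<^sub>R cross3 \<alpha> b1 - (x \<bullet> cross3 \<alpha> b1) *\<^sub>R cross3 \<alpha> b2"
    by (rule Lagrange)
  also have "\<dots> = 0"
    using assms(1,2) cross_triple[of \<alpha> b1 x] cross_triple[of \<alpha> b2 x] by (simp add: inner_commute)
  also have "cross3 (cross3 \<alpha> b1) (cross3 \<alpha> b2) = (\<alpha> \<bullet> cross3 b1 b2) *\<^sub>R \<alpha>"
    by (simp add: cross3_simps forall_3)
  finally have "cross3 \<alpha> (cross3 x \<alpha>) = 0"
    using assms(3) by (simp add: cross_mult_right)
  then show ?thesis
    using assms(4) by (simp add: Lagrange norm_eq_1)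
qed

text \<open>The degenerate case: \<open>\<alpha>\<close> lies in the plane of \<open>b1\<close> and
  \<open>b2\<close>, so both \<open>\<alpha> \<times> b1\<close> and
  \<open>\<alpha> \<times> b2\<close> are multiples of the normal. If \<open>x\<close> had a
  component along the normal, both would vanish, and \<open>b1\<close>, \<open>b2\<close> would be
  parallel to \<open>\<alpha>\<close> and hence to each other.\<close>

lemma orthogonal_of_orthogonal_crosses:
  assumes "\<alpha> \<bullet> cross3 b1 x = 0" "\<alpha> \<bullet> cross3 b2 x = 0" and n: "cross3 b1 b2 \<noteq> 0"
    and \<alpha>n: "\<alpha> \<bullet> cross3 b1 b2 = 0" and \<alpha>: "norm \<alpha> = 1"
  shows "x \<bullet> cross3 b1 b2 = 0"
proof (rule ccontr)
  let ?n = "cross3 b1 b2"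
  assume xn: "x \<bullet> ?n \<noteq> 0"
  have b: "b = (\<alpha> \<bullet> b) *\<^sub>R \<alpha>" if "b \<bullet> ?n = 0" "\<alpha> \<bullet> cross3 b x = 0" for b
  proof -
    have "cross3 ?n (cross3 \<alpha> b) = 0"
      using that \<alpha>n by (simp add: Lagrange inner_commute)
    then have "0 = cross3 x (cross3 ?n (cross3 \<alpha> b))" by simp
    also have "\<dots> = (x \<bullet> cross3 \<alpha> b) *\<^sub>R ?n - (x \<bullet> ?n) *\<^sub>R cross3 \<alpha> b"
      by (rule Lagrange)
    also have "x \<bullet> cross3 \<alpha> b = 0"
      using that cross_triple[of \<alpha> b x] by (simp add: inner_commute)
    finally have "cross3 \<alpha> b = 0" using xn by simp
    then have "cross3 \<alpha> (cross3 \<alpha> b) = 0" by simp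
    then show ?thesis using \<alpha> by (simp add: Lagrange norm_eq_1)
  qed
  have "b1 = (\<alpha> \<bullet> b1) *\<^sub>R \<alpha>" "b2 = (\<alpha> \<bullet> b2) *\<^sub>R \<alpha>"
    using b[of b1] b[of b2] assms(1,2) by (simp_all add: dot_cross_self)
  then have "cross3 b1 b2 = 0"
    by (metis cross_mult_left cross_mult_right cross_refl scaleR_zero_right)
  then show False using n by simp
qed

text \<open>\<open>q = r \<times> a\<close> is nonzero because \<open>r\<close> and \<open>a\<close>
  are nonzero and orthogonal. \<open>u\<close> is orthogonal to both, hence parallel to
  \<open>q\<close>, while the second hypothesis says that \<open>\<omega>\<close> is orthogonal to
  \<open>q\<close>.\<close>

lemma orthogonal_through_common_normal:
  assumes "a \<bullet> r = 0" "a \<bullet> cross3 \<omega> r = 0" "u \<bullet> a = 0" "u \<bullet> r = 0" "a \<noteq> 0" "r \<noteq> 0"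
  shows "\<omega> \<bullet> u = 0"
proof -
  define q where "q = cross3 r a"
  have "q \<noteq> 0"
  proof
    assume "q = 0"
    then have "r = 0 \<or> a = 0" using assms(1) norm_and_cross_eq_0[of r a] by (simp add: q_def inner_commute)
    then show False using assms by simp
  qed
  have "cross3 q u = - cross3 u q" by (rule cross_skew)
  also have "\<dots> = 0" using assms(3,4) by (simp add: q_def Lagrange)
  finally have "0 = cross3 \<omega> (cross3 q u)" by simp
  also have "\<dots> = (\<omega> \<bullet> u) *\<^sub>R q - (\<omega> \<bullet> q) *\<^sub>R u" by (rule Lagrange)
  also have "\<omega> \<bullet> q = 0" using assms(2) cross_triple[of \<omega> r a] by (simp add: q_def inner_commute)
  finally show ?thesis using \<open>q \<noteq> 0\<close> by simp
qed

lemma locally_zero_derivative: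
  fixes f :: "real \<Rightarrow> 'a::real_normed_vector"
  assumes "(f has_vector_derivative f') (at s)" "open U" "s \<in> U" "\<And>t. t \<in> U \<Longrightarrow> f t = 0"
  shows "f' = 0"
proof -
  have "(f has_vector_derivative 0) (at s)"
    by (rule has_vector_derivative_transform_within_open[of "\<lambda>_. 0" 0 s U]) (use assms in auto)
  then show ?thesis using assms(1) vector_derivative_unique_at by blast
qed

text \<open>\<open>x\<close> and \<open>w\<close> are the attitude and bias parts of an unforced
  trajectory of the linearized error with vanishing outputs. In the body frame \<open>a\<close> is
  constant, and \<open>y = R\<^sup>T x\<close>, \<open>r = R\<^sup>T (b1 \<times> b2)\<close>
  satisfy \<open>y' = w - \<Omega> \<times> y\<close>, \<open>r' = - \<Omega> \<times> r\<close>.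
  The sign-free question whether \<open>\<phi> = a \<bullet> r\<close> vanishes separates two
  regimes. Differentiating the constraint of each regime shows that \<open>\<Omega>\<close> is
  orthogonal to the part \<open>wp\<close> of \<open>w\<close> perpendicular to \<open>a\<close>, so
  \<open>wp = 0\<close> by \<open>spe\<close>; a second pass removes the component of
  \<open>w\<close> along \<open>a\<close>.\<close>

lemma exact_observability:
  fixes \<Omega> x :: "real \<Rightarrow> real^3" and R :: "real \<Rightarrow> real^3^3"
  assumes T: "0 < T"
    and cont_\<Omega>: "continuous_on {0..T} \<Omega>"
    and dR: "\<And>s. s \<in> {0..T} \<Longrightarrow> (R has_vector_derivative R s ** skew (\<Omega> s)) (at s within {0..T})"
    and orth: "\<And>s. s \<in> {0..T} \<Longrightarrow> orthogonal_matrix (R s)"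
    and dx: "\<And>s. s \<in> {0..T} \<Longrightarrow> (x has_vector_derivative R s *v w) (at s within {0..T})"
    and a: "norm a = 1" and n: "cross3 b1 b2 \<noteq> 0"
    and obs: "\<And>s. s \<in> {0..T} \<Longrightarrow> (R s *v a) \<bullet> cross3 b1 (x s) = 0 \<and> (R s *v a) \<bullet> cross3 b2 (x s) = 0"
    and spe: "\<And>u. (\<And>s. s \<in> {0<..<T} \<Longrightarrow> \<Omega> s \<bullet> u = 0) \<Longrightarrow> u = 0"
    and exc: "\<And>z. (\<And>s. s \<in> {0<..<T} \<Longrightarrow>
        (R s *v a) \<bullet> cross3 b1 z = 0 \<and> (R s *v a) \<bullet> cross3 b2 z = 0) \<Longrightarrow> z = 0"
  shows "w = 0 \<and> x 0 = 0"
proof -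
  let ?n = "cross3 b1 b2" and ?I = "{0<..<T}"
  define r where "r s = transpose (R s) *v ?n" for s
  define y where "y s = transpose (R s) *v x s" for s
  define \<phi> where "\<phi> s = a \<bullet> r s" for s
  define wp where "wp = w - (a \<bullet> w) *\<^sub>R a"
  have aa: "a \<bullet> a = 1" "a \<noteq> 0" using a by (auto simp: norm_eq_1)
  have at: "at s within {0..T} = at s" if "s \<in> ?I" for s
    using that by (intro at_within_interior) auto
  have oRR: "transpose (R s) ** R s = mat 1" "R s ** transpose (R s) = mat 1" if "s \<in> ?I" for s
    using orth[of s] that by (auto simp: orthogonal_matrix_def)
  have RtR: "transpose (R s) *v (R s *v z) = z" and RRt: "R s *v (transpose (R s) *v z) = z"
    if "s \<in> ?I" for s z
    using oRR[OF that] by (simp_all only: matrix_vector_mul_assoc matrix_vector_mul_lid)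
  have iRt: "(transpose (R s) *v p) \<bullet> q = p \<bullet> (R s *v q)" for s p q
    using inner_transpose_mult[of q "R s" p] by (simp only: inner_commute)
  have norm\<alpha>: "norm (R s *v a) = 1" if "s \<in> ?I" for s
    using iRt[of s "R s *v a" a] RtR[OF that, of a] aa by (simp add: norm_eq_1)
  have dRt: "((\<lambda>s. transpose (R s) *v z s) has_vector_derivative
      transpose (R s) *v z' - cross3 (\<Omega> s) (transpose (R s) *v z s)) (at s)"
    if s: "s \<in> ?I" and z: "(z has_vector_derivative z') (at s)" for s z z'
  proof -
    have "(R has_vector_derivative R s ** skew (\<Omega> s)) (at s)"
      using dR[of s] s at[OF s] by auto
    from has_vector_derivative_matrix_vector_mult[OF has_vector_derivative_transpose[OF this] z]
    show ?thesis
      by (simp only: matrix_transpose_mul transpose_skew matrix_vector_mul_assoc[symmetric])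
        (simp add: bounded_bilinear.minus_left[OF bounded_bilinear_matrix_vector_mult])
  qed
  have dr: "(r has_vector_derivative - cross3 (\<Omega> s) (r s)) (at s)" if "s \<in> ?I" for s
    using dRt[OF that, of "\<lambda>_. ?n" 0] unfolding r_def by simp
  have dy: "(y has_vector_derivative w - cross3 (\<Omega> s) (y s)) (at s)" if "s \<in> ?I" for s
    using dRt[OF that, of x "R s *v w"] dx[of s] that at[OF that] RtR[OF that, of w]
    unfolding y_def by simp
  have d\<phi>: "(\<phi> has_vector_derivative - (a \<bullet> cross3 (\<Omega> s) (r s))) (at s)" if "s \<in> ?I" for s
    using bounded_linear.has_vector_derivative[OF bounded_linear_inner_right dr[OF that], of a]
    unfolding \<phi>_def by simp
  have \<phi>_eq: "\<phi> s = (R s *v a) \<bullet> ?n" for s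
    using iRt[of s ?n a] by (simp only: \<phi>_def r_def inner_commute)
  have cont_\<phi>: "continuous_on ?I \<phi>"
    using d\<phi> has_vector_derivative_continuous
    by (metis continuous_at_imp_continuous_on)
  have cont_\<Omega>': "continuous_on ?I \<Omega>"
    by (rule continuous_on_subset[OF cont_\<Omega>]) auto
  have y_par: "y s = (a \<bullet> y s) *\<^sub>R a" if s: "s \<in> ?I" and "\<phi> s \<noteq> 0" for s
  proof -
    have "x s = ((R s *v a) \<bullet> x s) *\<^sub>R (R s *v a)"
      by (rule parallel_of_orthogonal_crosses[of _ b1 _ b2])
        (use obs[of s] that norm\<alpha>[OF s] in \<open>simp_all add: \<phi>_eq\<close>)
    then have "y s = transpose (R s) *v (((R s *v a) \<bullet> x s) *\<^sub>R (R s *v a))"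
      unfolding y_def by (rule arg_cong)
    also have "\<dots> = ((R s *v a) \<bullet> x s) *\<^sub>R a"
      by (simp only: matrix_vector_mult_scaleR RtR[OF s])
    also have "(R s *v a) \<bullet> x s = a \<bullet> y s"
      using iRt[of s "x s" a] by (simp only: y_def inner_commute)
    finally show ?thesis .
  qed
  have y_orth: "r s \<bullet> y s = 0" if s: "s \<in> ?I" and "\<phi> s = 0" for s
  proof -
    have "x s \<bullet> ?n = 0"
      by (rule orthogonal_of_orthogonal_crosses[of "R s *v a"])
        (use obs[of s] that norm\<alpha>[OF s] n in \<open>simp_all add: \<phi>_eq\<close>)
    moreover have "r s \<bullet> y s = ?n \<bullet> (R s *v (transpose (R s) *v x s))"
      unfolding r_def y_def by (rule iRt)
    ultimately show ?thesis using RRt[OF s, of "x s"] by (simp add: inner_commute)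
  qed
  have nbhd: "\<exists>U. open U \<and> s \<in> U \<and> U \<subseteq> ?I \<and> (\<forall>t\<in>U. f t \<noteq> 0)"
    if "continuous_on ?I f" "s \<in> ?I" "f s \<noteq> 0" for s and f :: "real \<Rightarrow> 'b::{t2_space,zero}"
  proof (intro exI conjI)
    show "open (?I \<inter> f -` (- {0}))"
      using continuous_open_preimage[OF that(1)] by auto
  qed (use that in auto)
  \<comment> \<open>Near \<open>s\<close> the vector \<open>y\<close> stays parallel to
    \<open>a\<close>. Differentiating \<open>y \<times> a = 0\<close> shows that
    \<open>w - \<Omega> \<times> y\<close> is parallel to \<open>a\<close>, and its part
    perpendicular to \<open>a\<close> gives the formula. In particular \<open>wp\<close> is
    orthogonal to \<open>\<Omega>\<close> in this regime.\<close>
  have wp: "wp = (a \<bullet> y s) *\<^sub>R cross3 (\<Omega> s) a" if s: "s \<in> ?I" and \<phi>: "\<phi> s \<noteq> 0" for s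
  proof -
    obtain U where U: "open U" "s \<in> U" "U \<subseteq> ?I" "\<forall>t\<in>U. \<phi> t \<noteq> 0"
      using nbhd[OF cont_\<phi> s \<phi>] by blast
    have "((\<lambda>s. cross3 (y s) a) has_vector_derivative cross3 (w - cross3 (\<Omega> s) (y s)) a) (at s)"
      by (rule bounded_linear.has_vector_derivative[OF
            bounded_bilinear.bounded_linear_left[OF bounded_bilinear_cross3] dy[OF s]])
    moreover have "cross3 (y t) a = 0" if "t \<in> U" for t
      by (subst y_par[of t]) (use U that in \<open>auto simp: cross_mult_left\<close>)
    ultimately have "cross3 (w - cross3 (\<Omega> s) (y s)) a = 0"
      using locally_zero_derivative U by blast
    then have "cross3 a (cross3 (w - cross3 (\<Omega> s) (y s)) a) = 0" by simp
    then have "w - cross3 (\<Omega> s) (y s) = (a \<bullet> (w - cross3 (\<Omega> s) (y s))) *\<^sub>R a"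
      unfolding Lagrange using aa by simp
    moreover have cr: "cross3 (\<Omega> s) (y s) = (a \<bullet> y s) *\<^sub>R cross3 (\<Omega> s) a"
      by (subst y_par[OF s \<phi>]) (simp add: cross_mult_right)
    ultimately show ?thesis
      by (simp add: wp_def inner_diff_right dot_cross_self algebra_simps)
  qed
  \<comment> \<open>A point with \<open>\<Omega> \<bullet> wp \<noteq> 0\<close> has a neighbourhood
    of such points. There the formula for \<open>wp\<close> excludes
    \<open>\<phi> \<noteq> 0\<close>, so the constraints \<open>\<phi> = 0\<close> and
    \<open>r \<bullet> y = 0\<close> hold on an open set and may be differentiated.\<close>
  have "wp = 0"
  proof (rule spe, rule ccontr)
    fix s assume s: "s \<in> ?I" and ne: "\<Omega> s \<bullet> wp \<noteq> 0"
    have "continuous_on ?I (\<lambda>s. \<Omega> s \<bullet> wp)" by (intro continuous_intros cont_\<Omega>')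
    then obtain U where U: "open U" "s \<in> U" "U \<subseteq> ?I" "\<forall>t\<in>U. \<Omega> t \<bullet> wp \<noteq> 0"
      using nbhd[of "\<lambda>s. \<Omega> s \<bullet> wp", OF _ s ne] by blast
    have \<phi>0: "\<phi> t = 0" if "t \<in> U" for t
    proof (rule ccontr)
      assume "\<phi> t \<noteq> 0"
      then have eq: "wp = (a \<bullet> y t) *\<^sub>R cross3 (\<Omega> t) a" using wp[of t] U that by auto
      have "\<Omega> t \<bullet> wp = 0" by (subst eq) (simp add: dot_cross_self)
      then show False using U that by auto
    qed
    \<comment> \<open>Both vectors are seen in the same rotating frame, so the terms in
      \<open>\<Omega>\<close> cancel in the derivative of \<open>r \<bullet> y\<close> and
      \<open>r \<bullet> w\<close> is left.\<close>
    have wr: "r t \<bullet> w = 0" if "t \<in> U" for t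
    proof -
      have t: "t \<in> ?I" using U that by auto
      have "((\<lambda>t. r t \<bullet> y t) has_vector_derivative
          r t \<bullet> (w - cross3 (\<Omega> t) (y t)) + - cross3 (\<Omega> t) (r t) \<bullet> y t) (at t)"
        by (rule bounded_bilinear.has_vector_derivative[OF bounded_bilinear_inner dr[OF t] dy[OF t]])
      moreover have "r t \<bullet> cross3 (\<Omega> t) (y t) = - (cross3 (\<Omega> t) (r t) \<bullet> y t)"
        by (simp add: cross3_simps)
      ultimately have "((\<lambda>t. r t \<bullet> y t) has_vector_derivative r t \<bullet> w) (at t)"
        by (simp add: inner_diff_right)
      then show ?thesis
        using locally_zero_derivative[OF _ U(1) that] y_orth \<phi>0 U by blast
    qed
    have "- (a \<bullet> cross3 (\<Omega> s) (r s)) = 0"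
      using locally_zero_derivative[OF d\<phi>[OF s] U(1,2)] \<phi>0 by blast
    moreover have "r s \<noteq> 0"
      using RRt[OF s, of ?n] n by (auto simp: r_def simp del: transpose_matrix_vector)
    moreover have "a \<bullet> r s = 0" using \<phi>0[OF U(2)] by (simp add: \<phi>_def)
    moreover have "wp \<bullet> a = 0" by (simp add: wp_def inner_diff_left aa inner_commute[of w])
    moreover have "wp \<bullet> r s = 0"
      using wr[OF U(2)] \<open>a \<bullet> r s = 0\<close>
      by (simp only: wp_def inner_diff_left inner_scaleR_left inner_commute[of "r s" w])
    ultimately have "\<Omega> s \<bullet> wp = 0"
      using orthogonal_through_common_normal[of a "r s" "\<Omega> s" wp] aa by simp
    then show False using ne by simp
  qed
  then have w_par: "w = (a \<bullet> w) *\<^sub>R a" by (simp add: wp_def)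
  have "a \<bullet> w = 0"
  proof (rule ccontr)
    assume aw: "a \<bullet> w \<noteq> 0"
    \<comment> \<open>Otherwise \<open>\<Omega> \<times> a\<close> is nonzero near \<open>s\<close>,
      and \<open>wp = 0\<close> forces \<open>a \<bullet> y = 0\<close> there. Since
      \<open>y\<close> is parallel to \<open>a\<close>, the derivative of
      \<open>a \<bullet> y\<close> at \<open>s\<close> is \<open>a \<bullet> w\<close>, which was
      assumed nonzero.\<close>
    have \<Omega>a: "cross3 (\<Omega> s) a = 0" if s: "s \<in> ?I" and \<phi>: "\<phi> s \<noteq> 0" for s
    proof (rule ccontr)
      assume ne: "cross3 (\<Omega> s) a \<noteq> 0"
      obtain U where U: "open U" "s \<in> U" "U \<subseteq> ?I" "\<forall>t\<in>U. \<phi> t \<noteq> 0"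
        using nbhd[OF cont_\<phi> s \<phi>] by blast
      have "continuous_on ?I (\<lambda>s. cross3 (\<Omega> s) a)" by (intro continuous_on_cross cont_\<Omega>' continuous_intros)
      then obtain W where W: "open W" "s \<in> W" "W \<subseteq> ?I" "\<forall>t\<in>W. cross3 (\<Omega> t) a \<noteq> 0"
        using nbhd[of "\<lambda>s. cross3 (\<Omega> s) a", OF _ s ne] by blast
      have "a \<bullet> y t = 0" if "t \<in> U \<inter> W" for t
        using wp[of t] that U W \<open>wp = 0\<close> by auto
      moreover have "((\<lambda>t. a \<bullet> y t) has_vector_derivative a \<bullet> (w - cross3 (\<Omega> s) (y s))) (at s)"
        by (rule bounded_linear.has_vector_derivative[OF bounded_linear_inner_right dy[OF s]])
      ultimately have "a \<bullet> (w - cross3 (\<Omega> s) (y s)) = 0"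
        using locally_zero_derivative[of _ _ s "U \<inter> W"] U W by blast
      moreover have "a \<bullet> cross3 (\<Omega> s) (y s) = 0"
        by (subst y_par[OF s \<phi>]) (simp add: cross_mult_right dot_cross_self)
      ultimately show False using aw by (simp add: inner_diff_right)
    qed
    \<comment> \<open>The square is used because its derivative vanishes in both regimes: where
      \<open>\<phi> \<noteq> 0\<close> because \<open>\<Omega>\<close> is parallel to
      \<open>a\<close>, and where \<open>\<phi> = 0\<close> because of the factor
      \<open>\<phi>\<close>. At a zero the derivative of \<open>\<phi>\<close> itself is not
      controlled.\<close>
    have d\<phi>2: "((\<lambda>s. \<phi> s * \<phi> s) has_derivative (\<lambda>h. 0)) (at s within ?I)" if s: "s \<in> ?I" for s
    proof -
      have "\<phi> s * (a \<bullet> cross3 (\<Omega> s) (r s)) = 0"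
      proof (cases "\<phi> s = 0")
        case False
        have "a \<bullet> cross3 (\<Omega> s) (r s) = - (cross3 (\<Omega> s) a \<bullet> r s)" by (simp add: cross3_simps)
        then show ?thesis using \<Omega>a[OF s False] by simp
      qed simp
      then have "\<phi> s * - (a \<bullet> cross3 (\<Omega> s) (r s)) + - (a \<bullet> cross3 (\<Omega> s) (r s)) * \<phi> s = 0"
        by (simp add: mult.commute)
      moreover have "((\<lambda>s. \<phi> s * \<phi> s) has_vector_derivative
          \<phi> s * - (a \<bullet> cross3 (\<Omega> s) (r s)) + - (a \<bullet> cross3 (\<Omega> s) (r s)) * \<phi> s) (at s within ?I)"
        using has_vector_derivative_mult[OF d\<phi>[OF s] d\<phi>[OF s]]
        by (rule has_vector_derivative_at_within)
      ultimately show ?thesis by (simp only: has_vector_derivative_def scaleR_zero_right)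
    qed
    obtain c where c: "\<And>s. s \<in> ?I \<Longrightarrow> \<phi> s * \<phi> s = c"
      using has_derivative_zero_constant[OF convex_real_interval(8) d\<phi>2] by auto
    show False
    proof (cases "c = 0")
      case True
      \<comment> \<open>If \<open>\<phi>\<close> is zero throughout, \<open>b1\<close> is invisible:
        its first output contains \<open>b1 \<times> b1\<close>, and its second is
        \<open>- \<phi>\<close>.\<close>
      have "b1 = 0"
      proof (rule exc)
        fix s assume s: "s \<in> ?I"
        have "\<phi> s = 0" using c[OF s] True by simp
        then show "(R s *v a) \<bullet> cross3 b1 b1 = 0 \<and> (R s *v a) \<bullet> cross3 b2 b1 = 0"
          using cross_skew[of b2 b1] by (simp add: \<phi>_eq)
      qed
      then show False using n by simp
    next
      case False
      \<comment> \<open>If \<open>\<phi>\<close> never vanishes, \<open>\<Omega>\<close> stays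
        parallel to \<open>a\<close>, and any nonzero vector orthogonal to \<open>a\<close>
        contradicts \<open>spe\<close>.\<close>
      obtain u where u: "u \<noteq> 0" "a \<bullet> u = 0"
        using cross_basis_nonzero[OF aa(2)] dot_cross_self by metis
      have "u = 0"
      proof (rule spe)
        fix s assume s: "s \<in> ?I"
        then have "cross3 (\<Omega> s) a = 0" using \<Omega>a[OF s] c[OF s] False by auto
        then have "cross3 a (cross3 (\<Omega> s) a) = 0" by simp
        then have "\<Omega> s = (a \<bullet> \<Omega> s) *\<^sub>R a" using aa by (simp add: Lagrange)
        then show "\<Omega> s \<bullet> u = 0" by (metis inner_scaleR_left mult_zero_right u(2))
      qed
      then show False using u by simp
    qed
  qed
  then have w0: "w = 0" using w_par by simp
  \<comment> \<open>With \<open>w = 0\<close> the state is constant, so its initial value is a fixed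
    vector to which \<open>exc\<close> applies.\<close>
  have "x 0 = 0"
  proof (rule exc)
    fix s assume s: "s \<in> ?I"
    have "(x has_derivative (\<lambda>h. 0)) (at t within {0..T})" if "t \<in> {0..T}" for t
      using dx[OF that] w0 by (simp add: has_vector_derivative_def)
    then have "x s = x 0"
      using has_derivative_zero_unique[of "{0..T}" x 0 s] s T by (auto simp: convex_real_interval)
    then show "(R s *v a) \<bullet> cross3 b1 (x 0) = 0 \<and> (R s *v a) \<bullet> cross3 b2 (x 0) = 0"
      using obs[of s] s by simp
  qed
  with w0 show ?thesis by simp
qed

section \<open>Uniform observability\<close>

text \<open>\<open>G\<close> is uniformly continuous only on compact sets. Since the limit is
  bounded, all late \<open>f n\<close> stay in one closed ball around the origin, where this is
  enough.\<close>

lemma uniform_limit_continuous_compose: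
  fixes f :: "'n \<Rightarrow> 'a \<Rightarrow> 'b::{heine_borel,real_normed_vector}" and G :: "'b \<Rightarrow> 'c::metric_space"
  assumes lim: "uniform_limit S f l F" and bdd: "bounded (l ` S)" and G: "continuous_on UNIV G"
  shows "uniform_limit S (\<lambda>n s. G (f n s)) (\<lambda>s. G (l s)) F"
proof -
  obtain M where M: "\<And>s. s \<in> S \<Longrightarrow> norm (l s) \<le> M"
    using bdd unfolding bounded_iff by (meson imageI)
  have "uniformly_continuous_on (cball 0 (M + 1)) G"
    by (intro compact_uniformly_continuous continuous_on_subset[OF G]) auto
  moreover have "\<forall>\<^sub>F n in F. f n ` S \<subseteq> cball 0 (M + 1)"
    using uniform_limitD[OF lim zero_less_one]
  proof eventually_elim
    case (elim n)
    have "norm (f n s) \<le> M + 1" if "s \<in> S" for s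
      using elim[rule_format, OF that] M[OF that] norm_triangle_sub[of "f n s" "l s"]
      by (simp add: dist_norm)
    then show ?case by auto
  qed
  moreover have "l ` S \<subseteq> cball 0 (M + 1)" using M by force
  ultimately show ?thesis
    using uniform_limit_compose[OF lim] by (simp add: comp_def)
qed

lemma uniform_limit_Pair:
  assumes "uniform_limit S f l F" "uniform_limit S g m F"
  shows "uniform_limit S (\<lambda>n s. (f n s, g n s)) (\<lambda>s. (l s, m s)) F"
proof (rule uniform_limitI)
  fix e :: real assume "0 < e"
  then have e: "0 < e / 2" by simp
  from uniform_limitD[OF assms(1) e] uniform_limitD[OF assms(2) e]
  show "\<forall>\<^sub>F n in F. \<forall>s\<in>S. dist (f n s, g n s) (l s, m s) < e"
  proof eventually_elim
    case (elim n)
    show ?case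
    proof
      fix s assume "s \<in> S"
      then have "dist (f n s) (l s) + dist (g n s) (m s) < e"
        using elim by (metis add_strict_mono field_sum_of_halves)
      moreover have "dist (f n s, g n s) (l s, m s) \<le> dist (f n s) (l s) + dist (g n s) (m s)"
        unfolding dist_Pair_Pair by (rule sqrt_sum_squares_le_sum) auto
      ultimately show "dist (f n s, g n s) (l s, m s) < e" by linarith
    qed
  qed
qed

lemma uniform_limit_indefinite_integral:
  fixes f :: "nat \<Rightarrow> real \<Rightarrow> 'a::banach"
  assumes lim: "uniform_limit {0..T} f l sequentially" and T: "0 \<le> T"
    and cont: "\<And>n. continuous_on {0..T} (f n)"
  shows "uniform_limit {0..T} (\<lambda>n s. integral {0..s} (f n)) (\<lambda>s. integral {0..s} l) sequentially"
proof (rule uniform_limitI)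
  fix e :: real assume e: "0 < e"
  have cl: "continuous_on {0..T} l"
    using uniform_limit_theorem[OF _ lim] cont by simp
  \<comment> \<open>\<open>T + 1\<close> covers \<open>T = 0\<close>, and the factor 2 makes the
    final inequality strict.\<close>
  have "0 < e / (2 * (T + 1))" using e T by simp
  from uniform_limitD[OF lim this]
  show "\<forall>\<^sub>F n in sequentially. \<forall>s\<in>{0..T}. dist (integral {0..s} (f n)) (integral {0..s} l) < e"
  proof eventually_elim
    case (elim n)
    show ?case
    proof
      fix s assume s: "s \<in> {0..T}"
      have cs: "continuous_on {0..s} (f n)" "continuous_on {0..s} l"
        using s by (auto intro: continuous_on_subset[OF cont] continuous_on_subset[OF cl])
      have "integral {0..s} (f n) - integral {0..s} l = integral {0..s} (\<lambda>u. f n u - l u)"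
        by (intro Henstock_Kurzweil_Integration.integral_diff[symmetric] integrable_continuous_real cs)
      also have "norm \<dots> \<le> e / (2 * (T + 1)) * (s - 0)"
        using s elim by (intro integral_bound continuous_on_diff cs)
          (auto simp: dist_norm intro!: less_imp_le)
      also have "\<dots> \<le> e / (2 * (T + 1)) * (T + 1)"
        using s e T by (intro mult_left_mono) auto
      also have "\<dots> = e / 2" using T by (simp add: field_simps)
      finally show "dist (integral {0..s} (f n)) (integral {0..s} l) < e"
        using e by (simp add: dist_norm)
    qed
  qed
qed

text \<open>Serves to pass to the limit in the kinematic equation. The theorem on sequences yields
  some function with the right derivative; uniqueness of pointwise limits identifies it with
  \<open>l\<close> on \<open>S\<close>.\<close>

lemma uniform_limit_has_vector_derivative:
  fixes f :: "nat \<Rightarrow> real \<Rightarrow> 'a::banach"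
  assumes der: "\<And>n s. s \<in> S \<Longrightarrow> (f n has_vector_derivative f' n s) (at s within S)"
    and lim: "uniform_limit S f l sequentially" and lim': "uniform_limit S f' l' sequentially"
    and S: "convex S" and s: "s \<in> S"
  shows "(l has_vector_derivative l' s) (at s within S)"
proof -
  have "\<exists>g. \<forall>x\<in>S. (\<lambda>n. f n x) \<longlonglongrightarrow> g x \<and> (g has_derivative (\<lambda>h. h *\<^sub>R l' x)) (at x within S)"
  proof (rule has_derivative_sequence[OF S _ _ s])
    show "(f n has_derivative (\<lambda>h. h *\<^sub>R f' n x)) (at x within S)" if "x \<in> S" for n x
      using der[OF that] by (simp add: has_vector_derivative_def)
    show "(\<lambda>n. f n s) \<longlonglongrightarrow> l s" by (rule tendsto_uniform_limitI[OF lim s])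
    fix e :: real assume "0 < e"
    from uniform_limitD[OF lim' this]
    show "\<forall>\<^sub>F n in sequentially. \<forall>x\<in>S. \<forall>h. norm (h *\<^sub>R f' n x - h *\<^sub>R l' x) \<le> e * norm h"
    proof eventually_elim
      case (elim n)
      then show ?case
        by (simp add: dist_norm less_imp_le mult.commute[of e] mult_left_mono flip: scaleR_right_diff_distrib)
    qed
  qed
  then obtain g where g: "\<And>x. x \<in> S \<Longrightarrow> (\<lambda>n. f n x) \<longlonglongrightarrow> g x"
    "\<And>x. x \<in> S \<Longrightarrow> (g has_derivative (\<lambda>h. h *\<^sub>R l' x)) (at x within S)" by blast
  have "g x = l x" if "x \<in> S" for x
    using g(1)[OF that] tendsto_uniform_limitI[OF lim that] LIMSEQ_unique by blast
  then show ?thesis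
    unfolding has_vector_derivative_def
    using has_derivative_transform[OF s _ g(2)[OF s]] by simp
qed

lemma bounded_derivative_imp_uniformly_continuous:
  fixes f :: "real \<Rightarrow> 'a::real_normed_vector"
  assumes der: "\<And>s. s \<in> S \<Longrightarrow> (f has_vector_derivative f' s) (at s within S)"
    and bd: "\<And>s. s \<in> S \<Longrightarrow> norm (f' s) \<le> B" and S: "convex S"
  shows "uniformly_continuous_on S f"
proof -
  have "norm (f x - f y) \<le> (\<bar>B\<bar> + 1) * norm (x - y)" if "x \<in> S" "y \<in> S" for x y
  proof (rule differentiable_bound[OF S _ _ that])
    fix s assume s: "s \<in> S"
    show "(f has_derivative (\<lambda>h. h *\<^sub>R f' s)) (at s within S)"
      using der[OF s] by (simp add: has_vector_derivative_def)
    show "onorm (\<lambda>h. h *\<^sub>R f' s) \<le> \<bar>B\<bar> + 1"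
      using bd[OF s] by (intro onorm_bound)
        (auto simp: mult.commute[of _ "norm (f' s)"] intro!: mult_right_mono)
  qed
  then have "(\<bar>B\<bar> + 1)-lipschitz_on S f"
    by (intro lipschitz_onI) (auto simp: dist_norm)
  then show ?thesis by (rule lipschitz_on_uniformly_continuous)
qed

lemma norm_orthogonal_matrix_mult:
  fixes M :: "real^'n^'n"
  assumes "orthogonal_matrix M" shows "norm (M *v x) = norm x"
  using assms orthogonal_transformation_matrix[of "(*v) M"] orthogonal_transformation_norm
  by (metis matrix_of_matrix_vector_mul matrix_vector_mul_linear)

lemma norm_orthogonal_matrix:
  fixes M :: "real^'n^'n"
  assumes "orthogonal_matrix M" shows "norm M = sqrt (CARD('n))"
proof -
  have "norm (M $ i) = 1" for i
  proof -
    have "(M ** transpose M) $ i $ i = M $ i \<bullet> M $ i"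
      by (simp add: matrix_matrix_mult_def inner_vec_def transpose_def)
    then show ?thesis using assms by (simp add: orthogonal_matrix_def mat_def norm_eq_1)
  qed
  then show ?thesis by (simp add: norm_vec_def L2_set_def)
qed

text \<open>The squared norm of the two linearized outputs of an attitude error \<open>x\<close> at
  attitude \<open>M\<close>, with unit weight. The weight \<open>Q\<close> is brought in later
  through its uniform lower bound.\<close>

definition output_energy :: "real^3 \<Rightarrow> real^3 \<Rightarrow> real^3 \<Rightarrow> real^3^3 \<Rightarrow> real^3 \<Rightarrow> real"
  where "output_energy a b1 b2 M x = ((M *v a) \<bullet> cross3 b1 x)\<^sup>2 + ((M *v a) \<bullet> cross3 b2 x)\<^sup>2"

lemma output_energy_nonneg [simp]: "0 \<le> output_energy a b1 b2 M x"
  by (simp add: output_energy_def)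

lemma continuous_on_output_energy [continuous_intros]:
  "continuous_on S M \<Longrightarrow> continuous_on S x \<Longrightarrow> continuous_on S (\<lambda>s. output_energy a b1 b2 (M s) (x s))"
  unfolding output_energy_def
  by (intro continuous_intros bounded_bilinear.continuous_on[OF bounded_bilinear_cross3])

text \<open>\<open>v + integral {t..s} Rh *v w\<close> is the attitude part of the unforced
  trajectory starting at \<open>(v, w)\<close>. \<open>Rh\<close> is an arbitrary continuous
  function near \<open>R\<close>, which keeps the constant independent of the observer. The same
  \<open>\<rho>\<close> is the tolerance and the lower bound, so a failure for every
  \<open>\<rho>\<close> yields a sequence along which both tend to zero.\<close>

lemma uniform_observability_unit:
  fixes \<Omega> :: "real \<Rightarrow> real^3" and R :: "real \<Rightarrow> real^3^3"
  assumes kin: "attitude_kinematics \<Omega> R"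
    and uc: "uniformly_continuous_on {0..} \<Omega>" and bdd: "bounded (\<Omega> ` {0..})"
    and a: "norm a = 1" and n: "cross3 b1 b2 \<noteq> 0" and T: "0 < T"
    and \<beta>: "0 < \<beta>" "\<And>t u. 0 \<le> t \<Longrightarrow> \<beta> * (u \<bullet> u) \<le> integral {t..t + T} (\<lambda>s. (\<Omega> s \<bullet> u)\<^sup>2)"
    and \<mu>: "0 < \<mu>" "\<And>t z. 0 \<le> t \<Longrightarrow> \<mu> * (z \<bullet> z) \<le> integral {t..t + T} (\<lambda>s. output_energy a b1 b2 (R s) z)"
  shows "\<exists>\<rho>>0. \<forall>t\<ge>0. \<forall>Rh v w. continuous_on {t..t + T} Rh \<longrightarrow>
    (\<forall>s\<in>{t..t + T}. norm (Rh s - R s) \<le> \<rho>) \<longrightarrow> v \<bullet> v + w \<bullet> w = 1 \<longrightarrow>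
    \<rho> \<le> integral {t..t + T} (\<lambda>s. output_energy a b1 b2 (Rh s) (v + integral {t..s} Rh *v w))"
proof (rule ccontr)
  let ?E = "output_energy a b1 b2"
  assume neg: "\<not> ?thesis"
  define bad where "bad \<rho> = (\<lambda>(t, Rh, v, w). 0 \<le> t \<and> continuous_on {t..t + T} Rh \<and>
    (\<forall>s\<in>{t..t + T}. norm (Rh s - R s) \<le> \<rho>) \<and> v \<bullet> v + w \<bullet> w = 1 \<and>
    integral {t..t + T} (\<lambda>s. ?E (Rh s) (v + integral {t..s} Rh *v w)) < \<rho>)" for \<rho>
  have "\<exists>p. bad \<rho> p" if "0 < \<rho>" for \<rho>
    using neg that unfolding bad_def by (simp add: not_le)
  then have "\<forall>n::nat. \<exists>p. bad (inverse (Suc n)) p"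
    by simp
  from choice[OF this] obtain p where p: "\<And>n::nat. bad (inverse (Suc n)) (p n)" by blast
  define t Rh v w where "t n = fst (p n)" and "Rh n = fst (snd (p n))"
    and "v n = fst (snd (snd (p n)))" and "w n = snd (snd (snd (p n)))" for n
  have "bad (inverse (Suc n)) (t n, Rh n, v n, w n)" for n
    using p[of n] by (simp add: t_def Rh_def v_def w_def)
  then have t: "\<And>n. 0 \<le> t n" and contRh: "\<And>n. continuous_on {t n..t n + T} (Rh n)"
    and close: "\<And>n s. s \<in> {t n..t n + T} \<Longrightarrow> norm (Rh n s - R s) \<le> inverse (Suc n)"
    and unit: "\<And>n. v n \<bullet> v n + w n \<bullet> w n = 1"
    and small: "\<And>n. integral {t n..t n + T} (\<lambda>s. ?E (Rh n s) (v n + integral {t n..s} (Rh n) *v w n)) < inverse (Suc n)"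
    unfolding bad_def prod.case by blast+
  have orth: "orthogonal_matrix (R s)" if "0 \<le> s" for s
    using kin that by (auto simp: attitude_kinematics_def rotation_matrix_def)
  have dR: "(R has_vector_derivative R s ** skew (\<Omega> s)) (at s within {0..})" if "0 \<le> s" for s
    using kin that by (auto simp: attitude_kinematics_def)
  obtain B where B: "\<And>s. 0 \<le> s \<Longrightarrow> norm (\<Omega> s) \<le> B"
    using bdd unfolding bounded_iff by (meson atLeast_iff imageI)
  obtain K where K: "\<And>w. norm (skew w) \<le> norm w * K"
    using bounded_linear.bounded[OF bounded_linear_skew] by blast
  \<comment> \<open>Rotations have norm \<open>sqrt 3\<close>, so the bound on
    \<open>\<Omega>\<close> bounds the derivative of \<open>R\<close>. This provides the
    equicontinuity of the shifted attitudes.\<close>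
  have ucR: "uniformly_continuous_on {0..} R"
  proof (rule bounded_derivative_imp_uniformly_continuous)
    fix s :: real assume s: "s \<in> {0..}"
    show "(R has_vector_derivative R s ** skew (\<Omega> s)) (at s within {0..})" using dR s by auto
    have "norm (R s ** skew (\<Omega> s)) \<le> norm (R s) * norm (skew (\<Omega> s))"
      by (rule norm_matrix_matrix_mult_le)
    also have "\<dots> \<le> sqrt 3 * (B * \<bar>K\<bar>)"
    proof (rule mult_mono)
      show "norm (R s) \<le> sqrt 3" using norm_orthogonal_matrix[OF orth[of s]] s by simp
      have "norm (skew (\<Omega> s)) \<le> norm (\<Omega> s) * \<bar>K\<bar>"
        by (rule order_trans[OF K]) (simp add: mult_left_mono)
      then show "norm (skew (\<Omega> s)) \<le> B * \<bar>K\<bar>"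
        using B[of s] s by (meson abs_ge_zero atLeast_iff mult_right_mono order_trans)
    qed auto
    finally show "norm (R s ** skew (\<Omega> s)) \<le> sqrt 3 * (B * \<bar>K\<bar>)" .
  qed auto
  have cont\<Omega>: "continuous_on {0..} \<Omega>" and contR: "continuous_on {0..} R"
    using uc ucR uniformly_continuous_imp_continuous by blast+
  \<comment> \<open>A single tuple, so that one extraction of a subsequence serves the shifted
    velocities and attitudes together with the initial states, which are constant in
    \<open>s\<close>.\<close>
  define F where "F n s = (\<Omega> (s + t n), R (s + t n), v n, w n)" for n s
  have vw1: "norm (v n) \<le> 1" "norm (w n) \<le> 1" for n
  proof -
    have "v n \<bullet> v n \<le> 1" "w n \<bullet> w n \<le> 1"
      using unit[of n] inner_ge_zero[of "v n"] inner_ge_zero[of "w n"] by linarith+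
    then show "norm (v n) \<le> 1" "norm (w n) \<le> 1" by (simp_all add: norm_le_square)
  qed
  obtain g k where contg: "continuous_on {0..T} g" and k: "strict_mono (k :: nat \<Rightarrow> nat)"
    and limF: "\<And>e. 0 < e \<Longrightarrow> \<exists>N. \<forall>n s. N \<le> n \<and> s \<in> {0..T} \<longrightarrow> norm (F (k n) s - g s) < e"
  proof (rule Arzela_Ascoli[of "{0..T}" F "B + (sqrt 3 + 2)"])
    show "norm (F n s) \<le> B + (sqrt 3 + 2)" if "s \<in> {0..T}" for n s
    proof -
      have "norm (F n s) \<le> norm (\<Omega> (s + t n)) + norm (R (s + t n), v n, w n)"
        unfolding F_def by (rule norm_Pair_le)
      also have "norm (R (s + t n), v n, w n) \<le> norm (R (s + t n)) + norm (v n, w n)"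
        by (rule norm_Pair_le)
      also have "norm (v n, w n) \<le> norm (v n) + norm (w n)" by (rule norm_Pair_le)
      finally show ?thesis
        using B[of "s + t n"] norm_orthogonal_matrix[OF orth[of "s + t n"]] that t[of n] vw1[of n] by simp
    qed
    fix s e :: real assume s: "s \<in> {0..T}" and e: "0 < e"
    obtain d1 where d1: "d1 > 0"
      "\<And>p q. p \<in> {0..} \<Longrightarrow> q \<in> {0..} \<Longrightarrow> dist p q < d1 \<Longrightarrow> dist (\<Omega> p) (\<Omega> q) < e / 2"
      using uc e unfolding uniformly_continuous_on_def by (metis half_gt_zero)
    obtain d2 where d2: "d2 > 0"
      "\<And>p q. p \<in> {0..} \<Longrightarrow> q \<in> {0..} \<Longrightarrow> dist p q < d2 \<Longrightarrow> dist (R p) (R q) < e / 2"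
      using ucR e unfolding uniformly_continuous_on_def by (metis half_gt_zero)
    show "\<exists>d>0. \<forall>n y. y \<in> {0..T} \<and> norm (s - y) < d \<longrightarrow> norm (F n s - F n y) < e"
    proof (intro exI[of _ "min d1 d2"] conjI allI impI)
      fix n y assume y: "y \<in> {0..T} \<and> norm (s - y) < min d1 d2"
      have "norm (F n s - F n y) \<le> norm (\<Omega> (s + t n) - \<Omega> (y + t n)) + norm (R (s + t n) - R (y + t n))"
        using norm_Pair_le[of "\<Omega> (s + t n) - \<Omega> (y + t n)" "(R (s + t n) - R (y + t n), 0 :: (real^3) \<times> (real^3))"]
        by (simp add: F_def norm_Pair zero_prod_def)
      also have "\<dots> < e / 2 + e / 2"
        using d1(2)[of "s + t n" "y + t n"] d2(2)[of "s + t n" "y + t n"] s y t[of n]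
        by (intro add_strict_mono) (auto simp: dist_norm)
      finally show "norm (F n s - F n y) < e" by simp
    qed (use d1 d2 in auto)
  qed auto
  have ulF: "uniform_limit {0..T} (\<lambda>n. F (k n)) g sequentially"
    unfolding uniform_limit_iff eventually_sequentially dist_norm using limF by (metis)
  define \<Omega>' where "\<Omega>' = (\<lambda>s. fst (g s))"
  define R' where "R' = (\<lambda>s. fst (snd (g s)))"
  define v' where "v' = fst (snd (snd (g 0)))"
  define w' where "w' = snd (snd (snd (g 0)))"
  have ul\<Omega>: "uniform_limit {0..T} (\<lambda>n s. \<Omega> (s + t (k n))) \<Omega>' sequentially"
    using bounded_linear.uniform_limit[OF bounded_linear_fst ulF] by (simp add: F_def \<Omega>'_def)
  have ulR: "uniform_limit {0..T} (\<lambda>n s. R (s + t (k n))) R' sequentially"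
    using bounded_linear.uniform_limit[OF bounded_linear_fst bounded_linear.uniform_limit[OF bounded_linear_snd ulF]]
    by (simp add: F_def R'_def)
  have "(\<lambda>n. F (k n) 0) \<longlonglongrightarrow> g 0" using tendsto_uniform_limitI[OF ulF, of 0] T by simp
  from tendsto_snd[OF tendsto_snd[OF this]]
  have lim0: "(\<lambda>n. (v (k n), w (k n))) \<longlonglongrightarrow> snd (snd (g 0))" by (simp add: F_def)
  have limv: "(\<lambda>n. v (k n)) \<longlonglongrightarrow> v'" and limw: "(\<lambda>n. w (k n)) \<longlonglongrightarrow> w'"
    using tendsto_fst[OF lim0] tendsto_snd[OF lim0] by (simp_all add: v'_def w'_def)
  have const_lim: "uniform_limit {0..T} (\<lambda>n _. c n) (\<lambda>_. l) sequentially"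
    if "c \<longlonglongrightarrow> l" for c and l :: "real^3"
    using that by (auto intro!: uniform_limitI dest: tendstoD elim: eventually_mono)
  define Rn where "Rn n = (\<lambda>s. Rh n (s + t n))" for n
  have contRn: "continuous_on {0..T} (Rn n)" for n
    unfolding Rn_def by (rule continuous_on_compose2[OF contRh[of n]]) (auto intro!: continuous_intros)
  have contR': "continuous_on {0..T} R'" and cont\<Omega>'': "continuous_on {0..T} \<Omega>'"
    unfolding R'_def \<Omega>'_def by (intro continuous_intros contg)+
  \<comment> \<open>Nothing is known about the moduli of continuity of the \<open>Rh n\<close>; they
    converge because they are uniformly close to the shifted \<open>R\<close>, with an error tending
    to zero.\<close>
  have ulRn: "uniform_limit {0..T} (\<lambda>n. Rn (k n)) R' sequentially"
  proof -
    have "uniform_limit {0..T} (\<lambda>n s. Rn (k n) s - R (s + t (k n))) (\<lambda>_. 0) sequentially"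
    proof (rule uniform_limitI)
      fix e :: real assume e: "0 < e"
      have "\<forall>\<^sub>F n in sequentially. inverse (real (Suc n)) < e"
        using LIMSEQ_inverse_real_of_nat order_tendstoD(2) e by blast
      then show "\<forall>\<^sub>F n in sequentially. \<forall>s\<in>{0..T}. dist (Rn (k n) s - R (s + t (k n))) 0 < e"
      proof eventually_elim
        case (elim n)
        show ?case
        proof
          fix s assume s: "s \<in> {0..T}"
          have "norm (Rn (k n) s - R (s + t (k n))) \<le> inverse (Suc (k n))"
            unfolding Rn_def using s by (intro close) auto
          also have "\<dots> \<le> inverse (Suc n)" using strict_mono_imp_increasing[OF k, of n] by simp
          also have "\<dots> < e" by (rule elim)
          finally show "dist (Rn (k n) s - R (s + t (k n))) 0 < e" by simp
        qed
      qed
    qed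
    from uniform_limit_add[OF this ulR] show ?thesis by simp
  qed
  define xn where "xn n s = v n + integral {0..s} (Rn n) *v w n" for n s
  define x' where "x' s = v' + integral {0..s} R' *v w'" for s
  have ulI: "uniform_limit {0..T} (\<lambda>n s. integral {0..s} (Rn (k n))) (\<lambda>s. integral {0..s} R') sequentially"
    using T by (intro uniform_limit_indefinite_integral ulRn contRn) auto
  have contI: "continuous_on {0..T} (\<lambda>s. integral {0..s} R')"
    by (intro indefinite_integral_continuous_1 integrable_continuous_real contR')
  have contIn: "continuous_on {0..T} (\<lambda>s. integral {0..s} (Rn n))" for n
    by (intro indefinite_integral_continuous_1 integrable_continuous_real contRn)
  have contx': "continuous_on {0..T} x'" unfolding x'_def by (intro continuous_intros contI)
  have contxn: "continuous_on {0..T} (xn n)" for n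
    unfolding xn_def by (intro continuous_intros contIn)
  have bddI: "bounded (f ` {0..T})" if "continuous_on {0..T} f" for f :: "real \<Rightarrow> 'c::real_normed_vector"
    using compact_continuous_image[OF that] compact_imp_bounded by blast
  have ulx: "uniform_limit {0..T} (\<lambda>n. xn (k n)) x' sequentially"
  proof -
    have "uniform_limit {0..T} (\<lambda>n s. integral {0..s} (Rn (k n)) *v w (k n))
        (\<lambda>s. integral {0..s} R' *v w') sequentially"
      by (rule bounded_bilinear.bounded_uniform_limit[OF bounded_bilinear_matrix_vector_mult ulI const_lim[OF limw]])
        (auto intro: bddI contI)
    from uniform_limit_add[OF const_lim[OF limv] this] show ?thesis unfolding xn_def x'_def .
  qed
  have energy_limit: "\<exists>I. (\<forall>n. ((\<lambda>s. ?E (M n s) (y n s)) has_integral I n) {0..T}) \<and>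
      I \<longlonglongrightarrow> integral {0..T} (\<lambda>s. ?E (M' s) (y' s))"
    if M: "uniform_limit {0..T} M M' sequentially" and y: "uniform_limit {0..T} y y' sequentially"
      and cont_n: "\<And>n. continuous_on {0..T} (M n)" "\<And>n. continuous_on {0..T} (y n)"
      and M': "continuous_on {0..T} M'" and y': "continuous_on {0..T} y'" for M M' y y'
  proof -
    have "uniform_limit {0..T} (\<lambda>n s. (\<lambda>(m, x). ?E m x) (M n s, y n s)) (\<lambda>s. (\<lambda>(m, x). ?E m x) (M' s, y' s)) sequentially"
    proof (rule uniform_limit_continuous_compose[where f = "\<lambda>n s. (M n s, y n s)" and l = "\<lambda>s. (M' s, y' s)"
          and G = "\<lambda>(m, x). ?E m x"])
      show "uniform_limit {0..T} (\<lambda>n s. (M n s, y n s)) (\<lambda>s. (M' s, y' s)) sequentially"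
        using M y by (rule uniform_limit_Pair)
      show "bounded ((\<lambda>s. (M' s, y' s)) ` {0..T})" by (intro bddI continuous_intros M' y')
      show "continuous_on UNIV (\<lambda>(m, x). ?E m x)"
        unfolding split_def by (intro continuous_intros)
    qed
    then have "uniform_limit {0..T} (\<lambda>n s. ?E (M n s) (y n s)) (\<lambda>s. ?E (M' s) (y' s)) sequentially" by simp
    then obtain I J where "\<And>n. ((\<lambda>s. ?E (M n s) (y n s)) has_integral I n) {0..T}"
      "((\<lambda>s. ?E (M' s) (y' s)) has_integral J) {0..T}" "I \<longlonglongrightarrow> J"
      by (rule uniform_limit_integral) (auto intro!: continuous_intros cont_n)
    then show ?thesis by (metis integral_unique)
  qed
  have shift: "integral {t n..t n + T} f = integral {0..T} (\<lambda>s. f (s + t n))" for n and f :: "real \<Rightarrow> real"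
    using integral_shift_real_ivl[of "t n" "t n" "t n + T" f] by simp
  \<comment> \<open>The energies are below \<open>1 / (n + 1)\<close>, so the limit energy is zero.
    Its integrand is continuous and nonnegative, hence the limit state is invisible at every time of
    the window.\<close>
  have "integral {0..T} (\<lambda>s. ?E (R' s) (x' s)) = 0"
  proof (rule antisym)
    obtain I where I: "\<And>n. ((\<lambda>s. ?E (Rn (k n) s) (xn (k n) s)) has_integral I n) {0..T}"
      "I \<longlonglongrightarrow> integral {0..T} (\<lambda>s. ?E (R' s) (x' s))"
      using energy_limit[OF ulRn ulx contRn contxn contR' contx'] by blast
    have "I n \<le> inverse (real (Suc n))" for n
    proof -
      have "integral {t (k n)..s + t (k n)} (Rh (k n)) = integral {0..s} (Rn (k n))" for s
        using integral_shift_real_ivl[of "t (k n)" "t (k n)" "s + t (k n)" "Rh (k n)"] by (simp add: Rn_def)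
      then have "I n < inverse (Suc (k n))"
        using small[of "k n"] I(1)[of n] unfolding shift by (simp add: Rn_def xn_def integral_unique)
      also have "\<dots> \<le> inverse (Suc n)" using strict_mono_imp_increasing[OF k, of n] by simp
      finally show ?thesis by simp
    qed
    then show "integral {0..T} (\<lambda>s. ?E (R' s) (x' s)) \<le> 0"
      using LIMSEQ_le[OF I(2) LIMSEQ_inverse_real_of_nat] by blast
    show "0 \<le> integral {0..T} (\<lambda>s. ?E (R' s) (x' s))"
      by (intro Henstock_Kurzweil_Integration.integral_nonneg integrable_continuous_real continuous_intros contR' contx') simp
  qed
  then have "\<forall>s\<in>{0..T}. ?E (R' s) (x' s) = 0"
    using integral_eq_0_iff[of 0 T "\<lambda>s. ?E (R' s) (x' s)"] T contR' contx' by (auto intro!: continuous_intros)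
  then have obs: "(R' s *v a) \<bullet> cross3 b1 (x' s) = 0 \<and> (R' s *v a) \<bullet> cross3 b2 (x' s) = 0" if "s \<in> {0..T}" for s
    using that by (auto simp: output_energy_def sum_power2_eq_zero_iff)
  have shiftcont: "continuous_on {0..T} (\<lambda>s. f (s + t n))" if "continuous_on {0..} f" for n and f :: "real \<Rightarrow> 'c::real_normed_vector"
    by (rule continuous_on_compose2[OF that]) (use t[of n] in \<open>auto intro!: continuous_intros\<close>)
  have "w' = 0 \<and> x' 0 = 0"
  proof (rule exact_observability[OF T cont\<Omega>'' _ _ _ a n obs])
    fix s assume s: "s \<in> {0..T}"
    show "(R' has_vector_derivative R' s ** skew (\<Omega>' s)) (at s within {0..T})"
    proof (rule uniform_limit_has_vector_derivative[OF _ ulR _ _ s])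
      show "((\<lambda>s. R (s + t (k n))) has_vector_derivative R (u + t (k n)) ** skew (\<Omega> (u + t (k n)))) (at u within {0..T})"
        if u: "u \<in> {0..T}" for n u
      proof -
        have "(R has_vector_derivative R (u + t (k n)) ** skew (\<Omega> (u + t (k n))))
            (at (u + t (k n)) within (\<lambda>s. s + t (k n)) ` {0..T})"
          by (rule has_vector_derivative_within_subset[OF dR]) (use u t[of "k n"] in auto)
        moreover have "((\<lambda>s. s + t (k n)) has_vector_derivative 1) (at u within {0..T})"
          unfolding has_real_derivative_iff_has_vector_derivative[symmetric]
          by (auto intro!: derivative_eq_intros)
        ultimately show ?thesis
          using vector_diff_chain_within by (fastforce simp: comp_def)
      qed
      have "uniform_limit {0..T} (\<lambda>n s. (\<lambda>(m, z). m ** skew z) (R (s + t (k n)), \<Omega> (s + t (k n))))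
          (\<lambda>s. (\<lambda>(m, z). m ** skew z) (R' s, \<Omega>' s)) sequentially"
      proof (rule uniform_limit_continuous_compose[where f = "\<lambda>n s. (R (s + t (k n)), \<Omega> (s + t (k n)))"
            and l = "\<lambda>s. (R' s, \<Omega>' s)" and G = "\<lambda>(m, z). m ** skew z"])
        show "uniform_limit {0..T} (\<lambda>n s. (R (s + t (k n)), \<Omega> (s + t (k n)))) (\<lambda>s. (R' s, \<Omega>' s)) sequentially"
          using ulR ul\<Omega> by (rule uniform_limit_Pair)
        show "bounded ((\<lambda>s. (R' s, \<Omega>' s)) ` {0..T})" by (intro bddI continuous_intros contR' cont\<Omega>'')
        show "continuous_on UNIV (\<lambda>(m::real^3^3, z). m ** skew z)"
          unfolding split_def by (intro continuous_intros)
      qed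
      then show "uniform_limit {0..T} (\<lambda>n s. R (s + t (k n)) ** skew (\<Omega> (s + t (k n))))
          (\<lambda>s. R' s ** skew (\<Omega>' s)) sequentially" by simp
    qed (rule convex_real_interval)
    have limR: "(\<lambda>n. R (s + t (k n))) \<longlonglongrightarrow> R' s" by (rule tendsto_uniform_limitI[OF ulR s])
    have "(\<lambda>n. transpose (R (s + t (k n))) ** R (s + t (k n))) \<longlonglongrightarrow> transpose (R' s) ** R' s"
      by (rule bounded_bilinear.tendsto[OF bounded_bilinear_matrix_matrix_mult
            bounded_linear.tendsto[OF bounded_linear_transpose limR] limR])
    moreover have "transpose (R (s + t (k n))) ** R (s + t (k n)) = mat 1" for n
      using orth[of "s + t (k n)"] s t[of "k n"] by (auto simp: orthogonal_matrix_def)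
    ultimately have "transpose (R' s) ** R' s = mat 1" by (simp add: LIMSEQ_const_iff)
    then show "orthogonal_matrix (R' s)" by (simp add: orthogonal_matrix)
    have "((\<lambda>s. integral {0..s} R') has_vector_derivative R' s) (at s within {0..T})"
      by (rule integral_has_vector_derivative[OF contR' s])
    then show "(x' has_vector_derivative R' s *v w') (at s within {0..T})"
      unfolding x'_def
      using has_vector_derivative_add[OF has_vector_derivative_const
          has_vector_derivative_matrix_vector_mult[OF _ has_vector_derivative_const]] by fastforce
  next
    \<comment> \<open>Excitation passes to the limit in integral form: if \<open>\<Omega>'\<close>
      is orthogonal to \<open>u\<close>, the integrals over the shifted windows tend to zero, while
      each is at least \<open>\<beta> * (u \<bullet> u)\<close>. The excitation of the outputs is
      handled in the same way with \<open>\<mu>\<close>.\<close>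
    fix u assume u: "\<And>s. s \<in> {0<..<T} \<Longrightarrow> \<Omega>' s \<bullet> u = 0"
    have "uniform_limit {0..T} (\<lambda>n s. (\<lambda>z. (z \<bullet> u)\<^sup>2) (\<Omega> (s + t (k n)))) (\<lambda>s. (\<lambda>z. (z \<bullet> u)\<^sup>2) (\<Omega>' s)) sequentially"
      by (rule uniform_limit_continuous_compose[OF ul\<Omega>, where G = "\<lambda>z. (z \<bullet> u)\<^sup>2"])
        (auto intro!: bddI cont\<Omega>'' continuous_intros)
    then obtain I J where I: "\<And>n. ((\<lambda>s. (\<Omega> (s + t (k n)) \<bullet> u)\<^sup>2) has_integral I n) {0..T}"
      "((\<lambda>s. (\<Omega>' s \<bullet> u)\<^sup>2) has_integral J) {0..T}" "I \<longlonglongrightarrow> J"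
      by (rule uniform_limit_integral) (auto intro!: continuous_intros shiftcont cont\<Omega>)
    have "J = integral {0<..<T} (\<lambda>s. (\<Omega>' s \<bullet> u)\<^sup>2)"
      using I(2) integral_open_interval_real integral_unique by metis
    also have "\<dots> = integral {0<..<T} (\<lambda>s. 0)" by (intro integral_cong) (simp add: u)
    finally have "J = 0" by simp
    moreover have "\<beta> * (u \<bullet> u) \<le> I n" for n
      using \<beta>(2)[OF t[of "k n"], of u] I(1)[of n] unfolding shift by (simp add: integral_unique)
    ultimately have "\<beta> * (u \<bullet> u) \<le> 0" using I(3) by (metis LIMSEQ_le_const)
    then show "u = 0" using \<beta>(1) by (metis inner_eq_zero_iff inner_ge_zero mult_le_cancel_left_pos mult_zero_right order_antisym)
  next
    fix z assume z: "\<And>s. s \<in> {0<..<T} \<Longrightarrow> (R' s *v a) \<bullet> cross3 b1 z = 0 \<and> (R' s *v a) \<bullet> cross3 b2 z = 0"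
    obtain I where I: "\<And>n. ((\<lambda>s. ?E (R (s + t (k n))) z) has_integral I n) {0..T}"
      "I \<longlonglongrightarrow> integral {0..T} (\<lambda>s. ?E (R' s) z)"
      using energy_limit[OF ulR const_lim[OF tendsto_const] shiftcont[OF contR] continuous_on_const
          contR' continuous_on_const, of z] by blast
    have "integral {0..T} (\<lambda>s. ?E (R' s) z) = integral {0<..<T} (\<lambda>s. ?E (R' s) z)"
      by (rule integral_open_interval_real)
    also have "\<dots> = integral {0<..<T} (\<lambda>s. 0)"
      by (intro integral_cong) (simp add: z output_energy_def)
    finally have "I \<longlonglongrightarrow> 0" using I(2) by simp
    moreover have "\<mu> * (z \<bullet> z) \<le> I n" for n
      using \<mu>(2)[OF t[of "k n"], of z] I(1)[of n] unfolding shift by (simp add: integral_unique)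
    ultimately have "\<mu> * (z \<bullet> z) \<le> 0" by (metis LIMSEQ_le_const)
    then show "z = 0" using \<mu>(1) by (metis inner_eq_zero_iff inner_ge_zero mult_le_cancel_left_pos mult_zero_right order_antisym)
  qed
  then have "v' = 0" "w' = 0" by (auto simp: x'_def)
  \<comment> \<open>The initial states converge, so the normalization to 1 is inherited by the
    limit, which has just been shown to be zero.\<close>
  moreover have "(\<lambda>n. v (k n) \<bullet> v (k n) + w (k n) \<bullet> w (k n)) \<longlonglongrightarrow> v' \<bullet> v' + w' \<bullet> w'"
    by (intro tendsto_intros limv limw)
  ultimately show False using unit by (simp add: LIMSEQ_const_iff)
qed

section \<open>Upper bound on the Riccati solution from one observation window\<close>

context riccati_solution
begin

text \<open>By \<open>nil\<close>, \<open>\<Phi>\<close> is the transition matrix of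
  \<open>x' = A x\<close>, and the adjoint equation with control \<open>K x\<close>,
  \<open>x = \<Phi> z\<close>, is solved in closed form from the value 0. The Gramian bound makes
  its final value an invertible linear function of \<open>z\<close>, the inverse having norm at most
  \<open>h / g\<close>. For the \<open>z\<close> that leads to \<open>\<xi>\<close>,
  \<open>window_bound\<close> estimates the form of \<open>P\<close> at \<open>\<xi>\<close> by the
  cost over the window; since \<open>\<eta>\<close> starts at 0 the term with \<open>P t0\<close>
  drops out, and the bound is uniform in time. \<open>h\<close> bounds \<open>\<Phi>\<close> and
  \<open>e\<close> bounds the adjoint solution.\<close>

lemma steady_bound:
  assumes t: "0 \<le> t0" "t0 \<le> t1" "t1 \<le> T"
    and contA: "continuous_on {t0..t1} A" and contK: "continuous_on {t0..t1} K"
    and nil: "\<And>s u. s \<in> {t0..t1} \<Longrightarrow> u \<in> {t0..t1} \<Longrightarrow> A s ** A u = 0"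
    and \<Phi>: "\<And>s. \<Phi> s = mat 1 + integral {t0..s} A"
    and gram: "\<And>z. g * (z \<bullet> z) \<le> integral {t0..t1} (\<lambda>s. (\<Phi> s *v z) \<bullet> (K s *v (\<Phi> s *v z)))"
    and g: "0 < g"
    and h: "h = norm (mat 1 :: real^'n^'n) + \<alpha> * (t1 - t0)"
    and e: "e = k * h * (t1 - t0) * (1 + \<alpha> * (t1 - t0))"
  shows "\<xi> \<bullet> (P t1 *v \<xi>) \<le> (v * e\<^sup>2 + k * h\<^sup>2) * (t1 - t0) * (h / g)\<^sup>2 * (\<xi> \<bullet> \<xi>)"
proof -
  let ?J = "{t0..t1}"
  have sub: "s \<in> ?J \<Longrightarrow> s \<in> {0..T}" for s using t by auto
  have t0T: "t0 \<in> {0..T}" using t by auto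
  have \<alpha>0: "0 \<le> \<alpha>" using order_trans[OF norm_ge_zero A_bound[OF t0T]] .
  have k0: "0 \<le> k" using order_trans[OF norm_ge_zero K_bound[OF t0T]] .
  have v0: "0 \<le> v" using order_trans[OF norm_ge_zero V_bound[OF t0T]] .
  define G where "G s = integral {t0..s} (\<lambda>u. K u ** \<Phi> u)" for s
  define H where "H s = integral {t0..s} (\<lambda>u. transpose (A u) ** G u)" for s
  define x where "x z s = \<Phi> s *v z" for z s
  \<comment> \<open>Variation of constants: \<open>- G\<close> integrates the control,
    \<open>H\<close> is the first correction through \<open>transpose (A s)\<close>, and the next
    one would contain a product of two values of \<open>A\<close> and is zero.\<close>
  define \<eta> where "\<eta> z s = (H s - G s) *v z" for z s
  have cont_int: "continuous_on ?J (\<lambda>s. integral {t0..s} f)" if "continuous_on ?J f"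
    for f :: "real \<Rightarrow> real^'n^'n"
    by (intro indefinite_integral_continuous_1 integrable_continuous_real that)
  have cont\<Phi>: "continuous_on ?J \<Phi>" unfolding \<Phi> by (intro continuous_intros cont_int contA)
  have contK\<Phi>: "continuous_on ?J (\<lambda>u. K u ** \<Phi> u)" by (intro continuous_intros contK cont\<Phi>)
  have contG: "continuous_on ?J G" unfolding G_def by (rule cont_int[OF contK\<Phi>])
  have contAG: "continuous_on ?J (\<lambda>u. transpose (A u) ** G u)" by (intro continuous_intros contA contG)
  have int_mult: "B ** integral {t0..s} f = integral {t0..s} (\<lambda>u. B ** f u)"
    if "continuous_on ?J f" "s \<in> ?J" for f :: "real \<Rightarrow> real^'n^'n" and B s
  proof -
    have "f integrable_on {t0..s}"
      using that by (intro integrable_continuous_real continuous_on_subset[OF that(1)]) auto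
    from integral_linear[OF this bounded_bilinear.bounded_linear_right[OF bounded_bilinear_matrix_matrix_mult, of B]]
    show ?thesis by (simp add: comp_def)
  qed
  have A\<Phi>: "A s ** \<Phi> s = A s" if s: "s \<in> ?J" for s
  proof -
    have "A s ** integral {t0..s} A = integral {t0..s} (\<lambda>u. A s ** A u)" by (rule int_mult[OF contA s])
    also have "\<dots> = integral {t0..s} (\<lambda>u. 0)" by (intro integral_cong) (use s nil[OF s] in auto)
    finally show ?thesis by (simp add: \<Phi> bounded_bilinear.add_right[OF bounded_bilinear_matrix_matrix_mult])
  qed
  have AH: "transpose (A s) ** H s = 0" if s: "s \<in> ?J" for s
  proof -
    have z: "transpose (A s) ** (transpose (A u) ** G u) = 0" if u: "u \<in> {t0..s}" for u
    proof -
      have "transpose (A s) ** transpose (A u) = transpose (A u ** A s)" by (simp add: matrix_transpose_mul)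
      also have "\<dots> = 0" using nil[of u s] u s by (simp add: transpose_def vec_eq_iff)
      finally show ?thesis
        by (simp add: matrix_mul_assoc bounded_bilinear.zero_left[OF bounded_bilinear_matrix_matrix_mult])
    qed
    have "transpose (A s) ** H s = integral {t0..s} (\<lambda>u. transpose (A s) ** (transpose (A u) ** G u))"
      unfolding H_def by (rule int_mult[OF contAG s])
    also have "\<dots> = integral {t0..s} (\<lambda>u. 0)" by (intro integral_cong) (use z in auto)
    finally show ?thesis by simp
  qed
  have der_int: "((\<lambda>s. integral {t0..s} f) has_vector_derivative f s) (at s within ?J)"
    if "continuous_on ?J f" "s \<in> ?J" for f :: "real \<Rightarrow> real^'n^'n" and s
    by (rule integral_has_vector_derivative[OF that])
  have dx: "(x z has_vector_derivative A s *v x z s) (at s within ?J)" if s: "s \<in> ?J" for z s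
  proof -
    have "(\<Phi> has_vector_derivative A s) (at s within ?J)"
      using has_vector_derivative_add[OF has_vector_derivative_const der_int[OF contA s], of "mat 1"]
      unfolding \<Phi>[abs_def] by simp
    from has_vector_derivative_matrix_vector_mult[OF this has_vector_derivative_const, of z]
    have "(x z has_vector_derivative A s *v z) (at s within ?J)" by (simp add: x_def[abs_def])
    moreover have "A s *v x z s = A s *v z"
      by (simp add: x_def matrix_vector_mul_assoc A\<Phi>[OF s])
    ultimately show ?thesis by simp
  qed
  have d\<eta>: "(\<eta> z has_vector_derivative - (transpose (A s) *v \<eta> z s) - K s *v x z s) (at s within ?J)"
    if s: "s \<in> ?J" for z s
  proof -
    have "((\<lambda>s. H s - G s) has_vector_derivative transpose (A s) ** G s - K s ** \<Phi> s) (at s within ?J)"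
      unfolding H_def[abs_def] G_def[abs_def]
      by (intro has_vector_derivative_diff der_int contK\<Phi> s contAG[unfolded G_def])
    from has_vector_derivative_matrix_vector_mult[OF this has_vector_derivative_const, of z]
    have "(\<eta> z has_vector_derivative (transpose (A s) ** G s - K s ** \<Phi> s) *v z) (at s within ?J)"
      by (simp add: \<eta>_def[abs_def])
    moreover have "transpose (A s) *v \<eta> z s = - ((transpose (A s) ** G s) *v z)"
    proof -
      have "transpose (A s) *v \<eta> z s = (transpose (A s) ** H s) *v z - (transpose (A s) ** G s) *v z"
        unfolding \<eta>_def matrix_vector_mult_diff_rdistrib matrix_vector_mult_diff_distrib
        by (simp only: matrix_vector_mul_assoc)
      then show ?thesis by (simp only: AH[OF s] matrix_vector_mult_0 diff_0)
    qed
    ultimately show ?thesis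
      by (simp only: x_def matrix_vector_mult_diff_rdistrib matrix_vector_mul_assoc minus_minus)
  qed
  have norm_int: "norm (integral {t0..s} f) \<le> B * (t1 - t0)"
    if "continuous_on ?J f" "\<And>u. u \<in> ?J \<Longrightarrow> norm (f u) \<le> B" "s \<in> ?J" for f :: "real \<Rightarrow> real^'n^'n" and B s
  proof -
    have "norm (integral {t0..s} f) \<le> B * (s - t0)"
      using that by (intro integral_bound continuous_on_subset[OF that(1)]) auto
    also have "\<dots> \<le> B * (t1 - t0)"
      using that(3) order_trans[OF norm_ge_zero that(2)[OF that(3)]] by (intro mult_left_mono) auto
    finally show ?thesis .
  qed
  have h0: "0 \<le> h" using h \<alpha>0 t by simp
  have n\<Phi>: "norm (\<Phi> s) \<le> h" if s: "s \<in> ?J" for s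
  proof -
    have "norm (integral {t0..s} A) \<le> \<alpha> * (t1 - t0)"
      by (rule norm_int[OF contA A_bound[OF sub] s])
    then show ?thesis unfolding \<Phi> h by (rule norm_triangle_le[OF add_left_mono])
  qed
  have nG: "norm (G s) \<le> k * h * (t1 - t0)" if s: "s \<in> ?J" for s
    unfolding G_def
  proof (rule norm_int[OF contK\<Phi> _ s])
    fix u assume u: "u \<in> ?J"
    show "norm (K u ** \<Phi> u) \<le> k * h"
      by (rule order_trans[OF norm_matrix_matrix_mult_le]) (intro mult_mono K_bound[OF sub[OF u]] n\<Phi>[OF u] k0 norm_ge_zero)
  qed
  have nH: "norm (H s) \<le> \<alpha> * (k * h * (t1 - t0)) * (t1 - t0)" if s: "s \<in> ?J" for s
    unfolding H_def
  proof (rule norm_int[OF contAG _ s])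
    fix u assume u: "u \<in> ?J"
    have "norm (transpose (A u)) \<le> \<alpha>" using A_bound[OF sub[OF u]] by (simp add: norm_transpose)
    then show "norm (transpose (A u) ** G u) \<le> \<alpha> * (k * h * (t1 - t0))"
      by (intro order_trans[OF norm_matrix_matrix_mult_le] mult_mono nG[OF u] \<alpha>0 norm_ge_zero)
  qed
  have nx: "norm (x z s) \<le> h * norm z" if s: "s \<in> ?J" for z s
    unfolding x_def using n\<Phi>[OF s]
    by (intro order_trans[OF norm_matrix_vector_mult_le] mult_right_mono) auto
  have n\<eta>: "norm (\<eta> z s) \<le> e * norm z" if s: "s \<in> ?J" for z s
  proof -
    have "norm (H s - G s) \<le> norm (H s) + norm (G s)" by (rule norm_triangle_ineq4)
    also have "\<dots> \<le> e" using nG[OF s] nH[OF s] unfolding e by (simp add: algebra_simps)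
    finally show ?thesis
      unfolding \<eta>_def by (intro order_trans[OF norm_matrix_vector_mult_le] mult_right_mono) auto
  qed
  have \<eta>0: "\<eta> z t0 = 0" for z by (simp add: \<eta>_def H_def G_def)
  have t1J: "t1 \<in> ?J" using t by simp
  \<comment> \<open>\<open>x\<close> and \<open>\<eta>\<close> solve mutually adjoint equations up
    to the control, so the derivative of \<open>x \<bullet> \<eta>\<close> is minus the integrand of
    the Gramian.\<close>
  have pairing: "g * (z \<bullet> z) \<le> - (x z t1 \<bullet> \<eta> z t1)" for z
  proof -
    have "((\<lambda>s. x z s \<bullet> \<eta> z s) has_vector_derivative - (x z s \<bullet> (K s *v x z s))) (at s within ?J)"
      if s: "s \<in> ?J" for s
    proof -
      have "x z s \<bullet> (transpose (A s) *v \<eta> z s) = (A s *v x z s) \<bullet> \<eta> z s" by (rule inner_transpose_mult)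
      then have "x z s \<bullet> (- (transpose (A s) *v \<eta> z s) - K s *v x z s) + (A s *v x z s) \<bullet> \<eta> z s
          = - (x z s \<bullet> (K s *v x z s))" by (simp only: inner_diff_right inner_minus_right)
      then show ?thesis
        using bounded_bilinear.has_vector_derivative[OF bounded_bilinear_inner dx[OF s, of z] d\<eta>[OF s, of z]]
        by (simp only:)
    qed
    then have "((\<lambda>s. - (x z s \<bullet> (K s *v x z s))) has_integral x z t1 \<bullet> \<eta> z t1 - x z t0 \<bullet> \<eta> z t0) ?J"
      by (intro fundamental_theorem_of_calculus t)
    then have "((\<lambda>s. - (- (x z s \<bullet> (K s *v x z s)))) has_integral (- (x z t1 \<bullet> \<eta> z t1))) ?J"
      unfolding \<eta>0 inner_zero_right diff_0_right by (rule has_integral_neg)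
    then show ?thesis using gram[of z] by (simp add: integral_unique x_def)
  qed
  have lower: "norm z \<le> (h / g) * norm (\<eta> z t1)" for z
  proof (cases "z = 0")
    case False
    have "g * (norm z * norm z) \<le> \<bar>x z t1 \<bullet> \<eta> z t1\<bar>"
      using pairing[of z] by (simp add: power2_norm_eq_inner[symmetric] power2_eq_square)
    also have "\<dots> \<le> norm (x z t1) * norm (\<eta> z t1)" by (rule Cauchy_Schwarz_ineq2)
    also have "\<dots> \<le> h * norm z * norm (\<eta> z t1)" by (intro mult_right_mono nx[OF t1J]) auto
    finally have "norm z * (g * norm z) \<le> norm z * (h * norm (\<eta> z t1))" by (simp add: mult_ac)
    then have "g * norm z \<le> h * norm (\<eta> z t1)" using False by simp
    then show ?thesis using g by (simp add: field_simps)
  qed (use h0 g in simp)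
  have "linear (\<lambda>z. \<eta> z t1)" unfolding \<eta>_def by (rule matrix_vector_mul_linear)
  moreover have "inj (\<lambda>z. \<eta> z t1)"
  proof (rule injI)
    fix z1 z2 assume "\<eta> z1 t1 = \<eta> z2 t1"
    then have "\<eta> (z1 - z2) t1 = 0" by (simp add: \<eta>_def matrix_vector_mult_diff_distrib)
    then show "z1 = z2" using lower[of "z1 - z2"] by simp
  qed
  ultimately have "surj (\<lambda>z. \<eta> z t1)" by (rule linear_inj_imp_surj)
  then obtain z where z: "\<eta> z t1 = \<xi>" by (metis surjD)
  have "\<eta> z t1 \<bullet> (P t1 *v \<eta> z t1) \<le> \<eta> z t0 \<bullet> (P t0 *v \<eta> z t0) + (v * e\<^sup>2 + k * h\<^sup>2) * (norm z)\<^sup>2 * (t1 - t0)"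
  proof (rule window_bound[OF t d\<eta>])
    fix s assume s: "s \<in> ?J"
    have "\<eta> z s \<bullet> (V s *v \<eta> z s) \<le> norm (V s) * norm (\<eta> z s) * norm (\<eta> z s)"
      using abs_quadratic_form_le[of "\<eta> z s" "V s" "\<eta> z s"] by simp
    also have "\<dots> \<le> v * (e * norm z) * (e * norm z)"
      using n\<eta>[OF s, of z] V_bound[OF sub[OF s]] v0 order_trans[OF norm_ge_zero n\<eta>[OF s, of z]] by (intro mult_mono) auto
    finally have 1: "\<eta> z s \<bullet> (V s *v \<eta> z s) \<le> v * (e * norm z) * (e * norm z)" .
    have "x z s \<bullet> (K s *v x z s) \<le> norm (K s) * norm (x z s) * norm (x z s)"
      using abs_quadratic_form_le[of "x z s" "K s" "x z s"] by simp
    also have "\<dots> \<le> k * (h * norm z) * (h * norm z)"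
      using nx[OF s, of z] K_bound[OF sub[OF s]] k0 h0 by (intro mult_mono) auto
    finally show "\<eta> z s \<bullet> (V s *v \<eta> z s) + x z s \<bullet> (K s *v x z s) \<le> (v * e\<^sup>2 + k * h\<^sup>2) * (norm z)\<^sup>2"
      using 1 by (simp add: power2_eq_square algebra_simps)
  qed
  then have "\<xi> \<bullet> (P t1 *v \<xi>) \<le> (v * e\<^sup>2 + k * h\<^sup>2) * (t1 - t0) * (norm z)\<^sup>2"
    by (simp add: z \<eta>0 mult_ac)
  also have "\<dots> \<le> (v * e\<^sup>2 + k * h\<^sup>2) * (t1 - t0) * ((h / g) * norm \<xi>)\<^sup>2"
    using lower[of z] v0 k0 t unfolding z by (intro mult_left_mono power_mono) auto
  finally show ?thesis by (simp only: power_mult_distrib power2_norm_eq_inner mult.assoc)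
qed

end

section \<open>Excitation as lower bounds on integrals of quadratic forms\<close>

lemma finite_eigenvalues:
  fixes M :: "real^'n^'n"
  assumes "symmetric_matrix M"
  shows "finite {l. \<exists>v. v \<noteq> 0 \<and> M *v v = l *\<^sub>R v}" (is "finite ?S")
proof -
  have "\<forall>l\<in>?S. \<exists>v. v \<noteq> 0 \<and> M *v v = l *\<^sub>R v" by blast
  from bchoice[OF this] obtain f where f: "\<And>l. l \<in> ?S \<Longrightarrow> f l \<noteq> 0" "\<And>l. l \<in> ?S \<Longrightarrow> M *v f l = l *\<^sub>R f l"
    by blast
  have orth: "f l \<bullet> f m = 0" if "l \<in> ?S" "m \<in> ?S" "l \<noteq> m" for l m
  proof -
    have "m * (f l \<bullet> f m) = f l \<bullet> (M *v f m)" using f(2)[OF that(2)] by simp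
    also have "\<dots> = f m \<bullet> (M *v f l)" by (rule inner_symmetric_matrix[OF assms])
    also have "\<dots> = l * (f l \<bullet> f m)" using f(2)[OF that(1)] by (simp add: inner_commute)
    finally show ?thesis using that(3) by simp
  qed
  \<comment> \<open>Eigenvectors of a symmetric matrix for distinct eigenvalues are orthogonal, so
    the dimension bounds their number. Finiteness is what makes the \<open>Min\<close> in
    \<open>smallest_eigenvalue\<close> a true minimum.\<close>
  have "independent (f ` ?S)"
  proof (rule pairwise_orthogonal_independent)
    show "pairwise orthogonal (f ` ?S)"
      unfolding pairwise_def orthogonal_def using orth by blast
    show "0 \<notin> f ` ?S" using f(1) by force
  qed
  then have "finite (f ` ?S)" by (rule independent_imp_finite)
  moreover have "inj_on f ?S"
    using orth f(1) by (metis (no_types, lifting) inj_onI inner_eq_zero_iff)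
  ultimately show ?thesis by (rule finite_imageD)
qed

lemma quadratic_form_attains_min:
  fixes M :: "real^'n^'n"
  obtains x0 where "norm x0 = 1" "\<And>y. x0 \<bullet> (M *v x0) * (y \<bullet> y) \<le> y \<bullet> (M *v y)"
proof -
  have "continuous_on (sphere 0 1) (\<lambda>x. x \<bullet> (M *v x))" by (intro continuous_intros)
  moreover have "sphere (0::real^'n) 1 \<noteq> {}" by simp
  ultimately obtain x0 where x0: "x0 \<in> sphere 0 1"
    "\<forall>y\<in>sphere 0 1. x0 \<bullet> (M *v x0) \<le> y \<bullet> (M *v y)"
    using continuous_attains_inf[OF compact_sphere] by blast
  have "x0 \<bullet> (M *v x0) * (y \<bullet> y) \<le> y \<bullet> (M *v y)" for y
  proof (cases "y = 0")
    case False
    have "x0 \<bullet> (M *v x0) \<le> (y /\<^sub>R norm y) \<bullet> (M *v (y /\<^sub>R norm y))"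
      by (rule x0(2)[rule_format]) (use False in simp)
    also have "\<dots> = (y \<bullet> (M *v y)) / (norm y * norm y)"
      by (simp add: matrix_vector_mult_scaleR field_simps)
    finally show ?thesis
      using False by (simp add: pos_le_divide_eq power2_norm_eq_inner[symmetric] power2_eq_square)
  qed simp
  with x0(1) show thesis using that by simp
qed

text \<open>The minimum \<open>m\<close> of the form on the unit sphere is an eigenvalue:
  \<open>M - m I\<close> is semidefinite with vanishing form at the minimizer, which therefore lies
  in its kernel. Hence the smallest eigenvalue is at most \<open>m\<close>.\<close>

lemma smallest_eigenvalue_le:
  fixes M :: "real^'n^'n"
  assumes sym: "symmetric_matrix M"
  shows "smallest_eigenvalue M * (x \<bullet> x) \<le> x \<bullet> (M *v x)"
proof -
  obtain x0 where x0: "norm x0 = 1" and min: "\<And>y. x0 \<bullet> (M *v x0) * (y \<bullet> y) \<le> y \<bullet> (M *v y)"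
    using quadratic_form_attains_min[of M] by blast
  define m where "m = x0 \<bullet> (M *v x0)"
  have le: "m * (y \<bullet> y) \<le> y \<bullet> (M *v y)" for y unfolding m_def by (rule min)
  have psd: "pos_semidef (M - m *\<^sub>R mat 1)"
    unfolding pos_semidef_def
    using le sym by (auto intro!: symmetric_matrix_diff symmetric_matrix_scaleR
        simp: matrix_vector_mult_diff_rdistrib inner_diff_right scaleR_matrix_vector_assoc[symmetric])
  have "x0 \<bullet> ((M - m *\<^sub>R mat 1) *v x0) = 0"
    using x0 by (simp add: matrix_vector_mult_diff_rdistrib inner_diff_right scaleR_matrix_vector_assoc[symmetric]
        m_def norm_eq_1)
  from pos_semidef_null_vector[OF psd this] have "M *v x0 = m *\<^sub>R x0"
    by (simp add: matrix_vector_mult_diff_rdistrib scaleR_matrix_vector_assoc[symmetric])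
  moreover have "x0 \<noteq> 0" using x0 by auto
  ultimately have "smallest_eigenvalue M \<le> m"
    unfolding smallest_eigenvalue_def using finite_eigenvalues[OF sym] by (intro Min_le) auto
  then have "smallest_eigenvalue M * (x \<bullet> x) \<le> m * (x \<bullet> x)" by (intro mult_right_mono) auto
  also have "\<dots> \<le> x \<bullet> (M *v x)" by (rule le)
  finally show ?thesis .
qed

lemma quadratic_form_integral:
  fixes M :: "real \<Rightarrow> real^'n^'n"
  assumes "M integrable_on S"
  shows "x \<bullet> (integral S M *v x) = integral S (\<lambda>s. x \<bullet> (M s *v x))"
proof -
  have "bounded_linear (\<lambda>B. x \<bullet> (B *v x))"
    using bounded_linear_compose[OF bounded_linear_inner_right
        bounded_bilinear.bounded_linear_left[OF bounded_bilinear_matrix_vector_mult]] by blast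
  from integral_linear[OF assms this] show ?thesis by (simp add: comp_def)
qed

text \<open>The form of the averaged matrix at \<open>u\<close> is the average of
  \<open>(\<alpha> s \<bullet> u)\<^sup>2\<close>; the length of the window is absorbed into the
  constant.\<close>

lemma strongly_persistently_exciting_integral:
  assumes spe: "strongly_persistently_exciting \<alpha>" and cont: "continuous_on {0..} \<alpha>"
  shows "\<exists>\<delta>>0. \<exists>\<beta>>0. \<forall>t\<ge>0. \<forall>u. \<beta> * (u \<bullet> u) \<le> integral {t..t + \<delta>} (\<lambda>s. (\<alpha> s \<bullet> u)\<^sup>2)"
proof -
  obtain \<delta> \<beta> where d: "\<delta> > 0" "\<beta> > 0" and ev: "\<And>t. 0 \<le> t \<Longrightarrow> \<beta> \<le> smallest_eigenvalue
      ((1 / \<delta>) *\<^sub>R integral {t..t + \<delta>} (\<lambda>s. outer_product (\<alpha> s) (\<alpha> s)))"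
    using spe unfolding strongly_persistently_exciting_def outer_product_def by blast
  have "\<delta> * \<beta> * (u \<bullet> u) \<le> integral {t..t + \<delta>} (\<lambda>s. (\<alpha> s \<bullet> u)\<^sup>2)" if t: "0 \<le> t" for t u
  proof -
    let ?M = "(1 / \<delta>) *\<^sub>R integral {t..t + \<delta>} (\<lambda>s. outer_product (\<alpha> s) (\<alpha> s))"
    have c: "continuous_on {t..t + \<delta>} (\<lambda>s. outer_product (\<alpha> s) (\<alpha> s))"
      by (intro bounded_bilinear.continuous_on[OF bounded_bilinear_outer_product] continuous_on_subset[OF cont])
        (use t in auto)
    then have int: "(\<lambda>s. outer_product (\<alpha> s) (\<alpha> s)) integrable_on {t..t + \<delta>}" by (rule integrable_continuous_real)
    have "symmetric_matrix ?M"
    proof (rule symmetric_matrix_scaleR)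
      have "transpose (integral {t..t + \<delta>} (\<lambda>s. outer_product (\<alpha> s) (\<alpha> s)))
          = integral {t..t + \<delta>} (\<lambda>s. transpose (outer_product (\<alpha> s) (\<alpha> s)))"
        using integral_linear[OF int bounded_linear_transpose] by (simp add: comp_def)
      then show "symmetric_matrix (integral {t..t + \<delta>} (\<lambda>s. outer_product (\<alpha> s) (\<alpha> s)))"
        using symmetric_outer_product[where 'n = 3] by (simp add: symmetric_matrix_def)
    qed
    then have "\<beta> * (u \<bullet> u) \<le> u \<bullet> (?M *v u)"
      by (rule order_trans[OF mult_right_mono[OF ev[OF t] inner_ge_zero] smallest_eigenvalue_le])
    also have "\<dots> = (1 / \<delta>) * integral {t..t + \<delta>} (\<lambda>s. (\<alpha> s \<bullet> u)\<^sup>2)"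
      by (simp add: scaleR_matrix_vector_assoc[symmetric] quadratic_form_integral[OF int]
          power2_eq_square inner_commute[of u])
    finally show ?thesis using d by (simp add: field_simps)
  qed
  then show ?thesis using d by (metis mult_pos_pos)
qed

lemma output_energy_scaleR: "output_energy a b1 b2 M (c *\<^sub>R x) = c\<^sup>2 * output_energy a b1 b2 M x"
  by (simp add: output_energy_def cross_mult_right power_mult_distrib algebra_simps)

text \<open>Both sides are homogeneous of degree 2 in \<open>(v, w)\<close>, so normalization
  reduces the claim to unit initial states.\<close>

lemma uniform_observability:
  fixes \<Omega> :: "real \<Rightarrow> real^3" and R :: "real \<Rightarrow> real^3^3"
  assumes "attitude_kinematics \<Omega> R" "uniformly_continuous_on {0..} \<Omega>" "bounded (\<Omega> ` {0..})"
    "norm a = 1" "cross3 b1 b2 \<noteq> 0" and T: "0 < T"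
    "0 < \<beta>" "\<And>t u. 0 \<le> t \<Longrightarrow> \<beta> * (u \<bullet> u) \<le> integral {t..t + T} (\<lambda>s. (\<Omega> s \<bullet> u)\<^sup>2)"
    "0 < \<mu>" "\<And>t z. 0 \<le> t \<Longrightarrow> \<mu> * (z \<bullet> z) \<le> integral {t..t + T} (\<lambda>s. output_energy a b1 b2 (R s) z)"
  obtains \<rho> where "0 < \<rho>" "\<And>t Rh v w. 0 \<le> t \<Longrightarrow> continuous_on {t..t + T} Rh \<Longrightarrow>
    (\<And>s. s \<in> {t..t + T} \<Longrightarrow> norm (Rh s - R s) \<le> \<rho>) \<Longrightarrow> \<rho> * (v \<bullet> v + w \<bullet> w)
      \<le> integral {t..t + T} (\<lambda>s. output_energy a b1 b2 (Rh s) (v + integral {t..s} Rh *v w))"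
proof -
  let ?I = "\<lambda>t Rh v w. integral {t..t + T} (\<lambda>s. output_energy a b1 b2 (Rh s) (v + integral {t..s} Rh *v w))"
  obtain \<rho> where \<rho>: "0 < \<rho>" and unit: "\<And>t Rh v w. 0 \<le> t \<Longrightarrow> continuous_on {t..t + T} Rh \<Longrightarrow>
    (\<And>s. s \<in> {t..t + T} \<Longrightarrow> norm (Rh s - R s) \<le> \<rho>) \<Longrightarrow> v \<bullet> v + w \<bullet> w = 1 \<Longrightarrow> \<rho> \<le> ?I t Rh v w"
    using uniform_observability_unit[OF assms] by blast
  have "\<rho> * (v \<bullet> v + w \<bullet> w) \<le> ?I t Rh v w"
    if t: "0 \<le> t" and Rh: "continuous_on {t..t + T} Rh"
      and close: "\<And>s. s \<in> {t..t + T} \<Longrightarrow> norm (Rh s - R s) \<le> \<rho>" for t Rh v w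
  proof (cases "v \<bullet> v + w \<bullet> w = 0")
    case True
    then have "v = 0" "w = 0" by (simp_all add: add_nonneg_eq_0_iff)
    then show ?thesis by (simp add: output_energy_def)
  next
    case False
    define N where "N = sqrt (v \<bullet> v + w \<bullet> w)"
    have "0 < v \<bullet> v + w \<bullet> w" using False by (simp add: order_less_le)
    then have N: "0 < N" "N\<^sup>2 = v \<bullet> v + w \<bullet> w" by (simp_all add: N_def)
    have "(v /\<^sub>R N) \<bullet> (v /\<^sub>R N) + (w /\<^sub>R N) \<bullet> (w /\<^sub>R N) = (v \<bullet> v + w \<bullet> w) / N\<^sup>2"
      using N(1) by (simp add: power2_eq_square field_simps)
    also have "\<dots> = 1" using N(1) by (simp flip: N(2))
    finally have "\<rho> \<le> ?I t Rh (v /\<^sub>R N) (w /\<^sub>R N)" using unit[OF t Rh close] by blast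
    also have "\<dots> = integral {t..t + T} (\<lambda>s. (inverse N)\<^sup>2 * output_energy a b1 b2 (Rh s) (v + integral {t..s} Rh *v w))"
      by (simp only: matrix_vector_mult_scaleR scaleR_add_right[symmetric] output_energy_scaleR)
    also have "\<dots> = (inverse N)\<^sup>2 * ?I t Rh v w" by (rule integral_mult_right)
    finally have "N\<^sup>2 * \<rho> \<le> N\<^sup>2 * ((inverse N)\<^sup>2 * ?I t Rh v w)" by (rule mult_left_mono) simp
    also have "\<dots> = ?I t Rh v w" using N(1) by (simp add: power2_eq_square field_simps)
    finally show ?thesis by (simp add: N(2) mult.commute)
  qed
  then show thesis using that \<rho> by blast
qed

section \<open>Error coordinates\<close>

definition stack :: "real^3 \<Rightarrow> real^3 \<Rightarrow> real^(3+3)"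
  where "stack p q = (\<chi> i. case i of Inl k \<Rightarrow> p $ k | Inr k \<Rightarrow> q $ k)"

lemma attitude_part_stack [simp]: "attitude_part (stack p q) = p"
  and bias_part_stack [simp]: "bias_part (stack p q) = q"
  by (simp_all add: stack_def attitude_part_def bias_part_def vec_eq_iff)

lemma stack_parts [simp]: "stack (attitude_part x) (bias_part x) = x"
  by (simp add: stack_def attitude_part_def bias_part_def vec_eq_iff split: sum.split)

lemma sum_UNIV_plus:
  fixes f :: "'a::finite + 'b::finite \<Rightarrow> 'c::comm_monoid_add"
  shows "sum f UNIV = (\<Sum>k\<in>UNIV. f (Inl k)) + (\<Sum>k\<in>UNIV. f (Inr k))"
  by (simp add: sum.Plus flip: UNIV_Plus_UNIV)

lemma inner_stack: "stack p q \<bullet> stack p' q' = p \<bullet> p' + q \<bullet> q'"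
  by (simp add: inner_vec_def sum_UNIV_plus stack_def)

lemma inner_parts: "x \<bullet> y = attitude_part x \<bullet> attitude_part y + bias_part x \<bullet> bias_part y"
  using inner_stack[of "attitude_part x" "bias_part x" "attitude_part y" "bias_part y"] by simp

lemma norm_attitude_part_le: "norm (attitude_part x) \<le> norm x"
  and norm_bias_part_le: "norm (bias_part x) \<le> norm x"
  by (simp_all add: norm_le inner_parts[of x x])

lemma norm_stack_left [simp]: "norm (stack p 0) = norm p"
  and norm_stack_right [simp]: "norm (stack 0 q) = norm q"
  by (simp_all add: norm_eq_sqrt_inner inner_stack)

lemma stack_add: "stack (p + p') (q + q') = stack p q + stack p' q'"
  by (simp add: stack_def vec_eq_iff split: sum.split)

lemma stack_zero [simp]: "stack 0 0 = 0"
  by (simp add: stack_def vec_eq_iff split: sum.split)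

lemma norm_stack_le: "norm (stack p q) \<le> norm p + norm q"
  using norm_triangle_ineq[of "stack p 0" "stack 0 q"] by (simp flip: stack_add)

lemma bounded_linear_stack: "bounded_linear (\<lambda>z. stack (fst z) (snd z))"
proof -
  have "linear (\<lambda>z. stack (fst z) (snd z))"
    by (rule linearI) (auto simp: stack_def vec_eq_iff split: sum.split)
  then show ?thesis by (rule linear_conv_bounded_linear[THEN iffD1])
qed

lemma has_vector_derivative_stack:
  assumes "(p has_vector_derivative p') (at t within S)" "(q has_vector_derivative q') (at t within S)"
  shows "((\<lambda>t. stack (p t) (q t)) has_vector_derivative stack p' q') (at t within S)"
  using bounded_linear.has_vector_derivative[OF bounded_linear_stack has_vector_derivative_Pair[OF assms]] by simp

lemma continuous_on_stack [continuous_intros]: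
  "continuous_on S p \<Longrightarrow> continuous_on S q \<Longrightarrow> continuous_on S (\<lambda>t. stack (p t) (q t))"
  using bounded_linear.continuous_on[OF bounded_linear_stack, of S "\<lambda>t. (p t, q t)"]
  by (simp add: continuous_on_Pair)

lemma A_matrix_mult: "A_matrix M *v x = stack (M *v bias_part x) 0"
  by (simp add: vec_eq_iff A_matrix_def matrix_vector_mult_def sum_UNIV_plus stack_def bias_part_def
      split: sum.split)

text \<open>\<open>A_matrix M\<close> reads only the bias part and writes only the attitude
  part.\<close>

lemma A_matrix_nilpotent: "A_matrix M ** A_matrix N = 0"
proof -
  have "(A_matrix M ** A_matrix N) *v x = 0 *v x" for x
    unfolding matrix_vector_mul_assoc[symmetric] A_matrix_mult by simp
  then show ?thesis by (simp add: matrix_eq)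
qed

lemma norm_A_matrix: "norm (A_matrix M) = norm M"
  by (simp add: norm_eq_sqrt_inner inner_vec_def sum_UNIV_plus A_matrix_def)

lemma bounded_linear_A_matrix: "bounded_linear A_matrix"
proof -
  have "linear A_matrix"
    by (rule linearI) (auto simp: A_matrix_def vec_eq_iff split: sum.split)
  then show ?thesis by (rule linear_conv_bounded_linear[THEN iffD1])
qed

lemmas continuous_on_A_matrix [continuous_intros] =
  bounded_linear.continuous_on[OF bounded_linear_A_matrix]

lemma norm_cross3_le: "norm (cross3 x y) \<le> norm x * norm y"
proof -
  have "(norm (cross3 x y))\<^sup>2 \<le> (norm x * norm y)\<^sup>2"
    using norm_cross_dot[of x y] zero_le_power2[of "x \<bullet> y"] by linarith
  then show ?thesis by (rule power2_le_imp_le) simp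
qed

text \<open>\<open>a\<^sup>T M\<^sup>T b\<^sup>\<times>\<close> is the row vector of
  \<open>(M a) \<times> b\<close>, by the cyclic symmetry of the triple product.\<close>

lemma C_matrix_row:
  assumes "\<Lambda> i = columnvector a"
  shows "C_matrix \<Lambda> b M $ i = stack (cross3 (M *v a) (b i)) 0"
  unfolding vec_eq_iff
proof
  fix j :: "3 + 3"
  show "C_matrix \<Lambda> b M $ i $ j = stack (cross3 (M *v a) (b i)) 0 $ j"
  proof (cases j)
    case (Inl k)
    have "C_block (columnvector a) (b i) M $ 1 $ k = cross3 (M *v a) (b i) $ k" for k
      using exhaust_3[of k]
      by (auto simp: C_block_def columnvector_def transpose_def matrix_matrix_mult_def
          matrix_vector_mult_def skew_entries sum_3 cross_components algebra_simps)
    then show ?thesis by (simp add: C_matrix_def stack_def Inl assms)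
  qed (simp add: C_matrix_def stack_def)
qed

lemma C_matrix_mult:
  assumes "\<Lambda> i = columnvector a"
  shows "(C_matrix \<Lambda> b M *v x) $ i = (M *v a) \<bullet> cross3 (b i) (attitude_part x)"
  using cross_triple[of "M *v a" "b i" "attitude_part x"]
  by (simp add: matrix_vector_mul_component C_matrix_row[of \<Lambda> i a, OF assms] inner_parts[of "stack _ _"] cross_triple
      inner_commute[of "M *v a"])

lemma continuous_on_C_matrix:
  assumes "\<And>i. \<Lambda> i = columnvector a" "continuous_on S M"
  shows "continuous_on S (\<lambda>t. C_matrix \<Lambda> b (M t))"
proof -
  have "(\<lambda>t. C_matrix \<Lambda> b (M t)) = (\<lambda>t. \<chi> i. stack (cross3 (M t *v a) (b i)) 0)"
    by (simp add: fun_eq_iff vec_eq_iff C_matrix_row[OF assms(1)])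
  then show ?thesis
    by (simp only:) (intro continuous_intros bounded_bilinear.continuous_on[OF bounded_bilinear_cross3] assms)
qed

lemma norm_C_matrix_le:
  fixes \<Lambda> :: "2 \<Rightarrow> real^1^3"
  assumes "\<And>i. \<Lambda> i = columnvector a" "norm a = 1" "\<And>i. norm (b i) = 1" "orthogonal_matrix M"
  shows "norm (C_matrix \<Lambda> b M) \<le> 2"
proof -
  have "norm (C_matrix \<Lambda> b M $ i) \<le> 1" for i
    using norm_cross3_le[of "M *v a" "b i"] assms(2-4)
    by (simp add: C_matrix_row[OF assms(1)] norm_orthogonal_matrix_mult)
  then have "(\<Sum>i\<in>UNIV. norm (C_matrix \<Lambda> b M $ i)) \<le> (\<Sum>i\<in>(UNIV::2 set). 1)" by (intro sum_mono)
  then show ?thesis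
    unfolding norm_vec_def[of "C_matrix \<Lambda> b M"]
    using L2_set_le_sum[of UNIV "\<lambda>i. norm (C_matrix \<Lambda> b M $ i)"] by simp
qed

lemma norm_C_matrix_mult:
  fixes \<Lambda> :: "2 \<Rightarrow> real^1^3"
  assumes "\<And>i. \<Lambda> i = columnvector a"
  shows "(C_matrix \<Lambda> b M *v x) \<bullet> (C_matrix \<Lambda> b M *v x) = output_energy a (b 1) (b 2) M (attitude_part x)"
  by (simp add: inner_vec_def sum_2 C_matrix_mult[OF assms] output_energy_def power2_eq_square)

text \<open>The left inverse of \<open>skew\<close>, extended to all matrices by annihilating the
  symmetric part.\<close>

definition vex :: "real^3^3 \<Rightarrow> real^3"
  where "vex M = vector [(M$3$2 - M$2$3) / 2, (M$1$3 - M$3$1) / 2, (M$2$1 - M$1$2) / 2]"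

lemma vex_skew [simp]: "vex (skew w) = w"
  by (simp add: vex_def skew_entries vec_eq_iff forall_3)

lemma skew_vex: "skew (vex M) = (1/2) *\<^sub>R (M - transpose M)"
  by (simp add: vex_def skew_entries vec_eq_iff forall_3 transpose_def field_simps)

lemma linear_vex: "linear vex"
  by (rule linearI) (auto simp: vex_def vec_eq_iff forall_3 field_simps)

lemmas bounded_linear_vex = linear_conv_bounded_linear[THEN iffD1, OF linear_vex]

lemma norm_skew: "norm (skew w) \<le> 2 * norm w"
proof -
  have "(norm (skew w))\<^sup>2 = 2 * (norm w)\<^sup>2"
    unfolding power2_norm_eq_inner by (simp add: skew_entries inner_vec_def sum_3)
  also have "\<dots> \<le> (2 * norm w)\<^sup>2" by (simp add: power_mult_distrib)
  finally show ?thesis by (rule power2_le_imp_le) simp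
qed

lemma norm_vex: "norm (vex M) \<le> norm M"
proof -
  have sq: "((p - q) / 2)\<^sup>2 \<le> p\<^sup>2 + q\<^sup>2" for p q :: real
  proof -
    have "p\<^sup>2 + q\<^sup>2 - ((p - q) / 2)\<^sup>2 = (p + q)\<^sup>2 / 4 + (p\<^sup>2 + q\<^sup>2) / 2"
      by (simp add: field_simps power2_eq_square)
    then show ?thesis by (smt (verit) divide_nonneg_pos zero_le_power2)
  qed
  have "(norm (vex M))\<^sup>2 \<le> (norm M)\<^sup>2"
    unfolding power2_norm_eq_inner
    using sq[of "M$3$2" "M$2$3"] sq[of "M$1$3" "M$3$1"] sq[of "M$2$1" "M$1$2"]
    by (simp add: vex_def inner_vec_def sum_3 flip: power2_eq_square)
      (insert zero_le_power2[of "M$1$1"] zero_le_power2[of "M$2$2"] zero_le_power2[of "M$3$3"], linarith)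
  then show ?thesis by (rule power2_le_imp_le) simp
qed

text \<open>The symmetric part of \<open>E\<close> is quadratically small because \<open>(1 + E) (1 + E)\<^sup>T = 1\<close>.\<close>
lemma orthogonal_minus_identity:
  fixes M :: "real^3^3"
  assumes "orthogonal_matrix M"
  defines "E \<equiv> M - mat 1"
  shows "norm (E - skew (vex E)) \<le> (norm E)\<^sup>2 / 2"
    and "norm E \<le> 1 \<Longrightarrow> norm E \<le> 4 * norm (vex E)"
proof -
  have "M ** transpose M = mat 1" using assms(1) by (simp add: orthogonal_matrix_def)
  moreover have "M = mat 1 + E" by (simp add: E_def)
  ultimately have "(mat 1 + E) ** (mat 1 + transpose E) = mat 1" by (simp add: transpose_add)
  then have "E + transpose E + E ** transpose E = 0"
    by (simp add: bounded_bilinear.add_left[OF bounded_bilinear_matrix_matrix_mult]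
        bounded_bilinear.add_right[OF bounded_bilinear_matrix_matrix_mult] ac_simps)
  then have "E + transpose E = - (E ** transpose E)" by (simp only: eq_neg_iff_add_eq_0)
  moreover have "E - skew (vex E) = (1/2) *\<^sub>R (E + transpose E)"
    by (simp add: skew_vex vec_eq_iff field_simps)
  ultimately have "norm (E - skew (vex E)) = norm (E ** transpose E) / 2" by simp
  also have "\<dots> \<le> (norm E)\<^sup>2 / 2"
    using norm_matrix_matrix_mult_le[of E "transpose E"] by (simp add: norm_transpose power2_eq_square)
  finally show 1: "norm (E - skew (vex E)) \<le> (norm E)\<^sup>2 / 2" .
  assume "norm E \<le> 1"
  \<comment> \<open>Now the symmetric part is at most \<open>norm E / 2\<close> and can be absorbed;
    \<open>norm_skew\<close> then gives the factor 4.\<close>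
  then have "(norm E)\<^sup>2 \<le> norm E" by (simp add: power2_eq_square mult_left_le)
  moreover have "norm E \<le> norm (skew (vex E)) + norm (E - skew (vex E))"
    using norm_triangle_ineq[of "skew (vex E)" "E - skew (vex E)"] by simp
  ultimately show "norm E \<le> 4 * norm (vex E)" using 1 norm_skew[of "vex E"] by linarith
qed

text \<open>Rotations preserve the cross product, while a reflection would reverse its sign. For
  this reason \<open>Rh\<close> must be shown to remain a rotation and not only an orthogonal
  matrix.\<close>

lemma rotation_skew:
  assumes "rotation_matrix M" shows "M ** skew w = skew (M *v w) ** M"
proof -
  have "(M ** skew w) *v x = (skew (M *v w) ** M) *v x" for x
    using cross_rotation_matrix[OF assms] by (simp flip: matrix_vector_mul_assoc)
  then show ?thesis by (simp add: matrix_eq)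
qed

text \<open>Multiplication by a skew matrix, on either side, is skew-adjoint for the Frobenius inner
  product.\<close>

lemma inner_skew_mult: "D \<bullet> (skew w ** D) = 0" and inner_mult_skew: "D \<bullet> (D ** skew w) = 0"
  for D :: "real^3^3"
  by (simp_all add: inner_vec_def sum_3 skew_entries matrix_matrix_mult_def algebra_simps)

text \<open>At the first time at which \<open>g\<close> reaches \<open>\<rho>\<close> the weak bound
  holds up to and including that time, and \<open>step\<close> improves it to a strict one, a
  contradiction. The weak bound includes the endpoint so that estimates on closed intervals can be
  used in \<open>step\<close>.\<close>

lemma continuation_below:
  fixes g :: "real \<Rightarrow> real"
  assumes cont: "continuous_on {0..} g" and g0: "g 0 < \<rho>"
    and step: "\<And>\<tau>. 0 \<le> \<tau> \<Longrightarrow> (\<And>s. s \<in> {0..\<tau>} \<Longrightarrow> g s \<le> \<rho>) \<Longrightarrow> g \<tau> < \<rho>"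
    and t: "0 \<le> t"
  shows "g t < \<rho>"
proof (rule ccontr)
  assume "\<not> g t < \<rho>"
  define S where "S = {0..t} \<inter> g -` {\<rho>..}"
  have ct: "continuous_on {0..t} g" by (rule continuous_on_subset[OF cont]) auto
  have "compact S"
    unfolding S_def using continuous_closedin_preimage[OF ct closed_atLeast] compact_Icc closedin_compact by blast
  moreover have "S \<noteq> {}" using \<open>\<not> g t < \<rho>\<close> t by (auto simp: S_def)
  ultimately obtain \<tau> where \<tau>: "\<tau> \<in> S" "\<forall>s\<in>S. \<tau> \<le> s" using compact_attains_inf by blast
  have \<tau>t: "0 \<le> \<tau>" "\<tau> \<le> t" "\<rho> \<le> g \<tau>" using \<tau>(1) by (auto simp: S_def)
  have before: "g s < \<rho>" if "s \<in> {0..<\<tau>}" for s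
    using \<tau>(2) that \<tau>t by (force simp: S_def not_less)
  obtain s where s: "0 \<le> s" "s \<le> \<tau>" "g s = \<rho>"
    using IVT'[of g 0 \<rho> \<tau>] g0 \<tau>t continuous_on_subset[OF ct, of "{0..\<tau>}"] by auto
  have "s = \<tau>" using before[of s] s by force
  then have "g s' \<le> \<rho>" if "s' \<in> {0..\<tau>}" for s'
    using before[of s'] that s by (cases "s' = \<tau>") auto
  then show False using step[of \<tau>] \<tau>t by auto
qed

lemma pos_def_lower_bound:
  fixes M :: "real^'n^'n"
  assumes "pos_def M"
  obtains p where "0 < p" "\<And>x. p * (x \<bullet> x) \<le> x \<bullet> (M *v x)"
proof -
  obtain x0 where x0: "norm x0 = 1" "\<And>y. x0 \<bullet> (M *v x0) * (y \<bullet> y) \<le> y \<bullet> (M *v y)"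
    using quadratic_form_attains_min[of M] by blast
  have "x0 \<noteq> 0" using x0(1) by auto
  then have "0 < x0 \<bullet> (M *v x0)" using assms by (simp add: pos_def_def)
  with x0(2) show thesis using that by blast
qed

text \<open>By polarization a bound on the form of a semidefinite matrix bounds the bilinear form on
  unit vectors with the same constant. This turns the bound on the form of \<open>P\<close> into a
  bound on the observer gain.\<close>

lemma norm_mult_le_of_quadratic_form_le:
  fixes M :: "real^'n^'n"
  assumes psd: "pos_semidef M" and le: "\<And>x. x \<bullet> (M *v x) \<le> p * (x \<bullet> x)"
  shows "norm (M *v y) \<le> p * norm y"
proof -
  have sym: "symmetric_matrix M" and nn: "\<And>x. 0 \<le> x \<bullet> (M *v x)"
    using psd by (auto simp: pos_semidef_def)
  have unit: "u \<bullet> (M *v w) \<le> p" if "norm u = 1" "norm w = 1" for u w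
  proof -
    have "4 * (u \<bullet> (M *v w)) = (u + w) \<bullet> (M *v (u + w)) - (u - w) \<bullet> (M *v (u - w))"
      using inner_symmetric_matrix[OF sym, of u w]
      by (simp add: matrix_vector_right_distrib matrix_vector_mult_diff_distrib
          inner_add_left inner_add_right inner_diff_left inner_diff_right)
    also have "\<dots> \<le> p * ((u + w) \<bullet> (u + w))" using le[of "u + w"] nn[of "u - w"] by linarith
    also have "(u + w) \<bullet> (u + w) = 2 + 2 * (u \<bullet> w)"
      using that by (simp add: inner_add_left inner_add_right inner_commute norm_eq_1)
    also have "p * (2 + 2 * (u \<bullet> w)) \<le> p * 4"
    proof (rule mult_left_mono)
      show "2 + 2 * (u \<bullet> w) \<le> 4" using norm_cauchy_schwarz[of u w] that by simp
      show "0 \<le> p" using le[of u] nn[of u] that by (simp add: norm_eq_1)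
    qed
    finally show ?thesis by simp
  qed
  show ?thesis
  proof (cases "y = 0 \<or> M *v y = 0")
    case True
    have "0 \<le> p * norm y"
    proof (cases "y = 0")
      case False
      have "0 \<le> p * (y \<bullet> y)" using le[of y] nn[of y] by linarith
      moreover have "0 < y \<bullet> y" using False by simp
      ultimately have "0 \<le> p" using mult_neg_pos[of p "y \<bullet> y"] by (cases "0 \<le> p") auto
      then show ?thesis by simp
    qed simp
    then show ?thesis using True by auto
  next
    case False
    then have "(M *v y /\<^sub>R norm (M *v y)) \<bullet> (M *v (y /\<^sub>R norm y)) \<le> p" by (intro unit) auto
    then have "(M *v y) \<bullet> (M *v y) / (norm (M *v y) * norm y) \<le> p"
      by (simp add: matrix_vector_mult_scaleR field_simps)
    then show ?thesis
      using False by (simp add: pos_divide_le_eq power2_norm_eq_inner[symmetric] power2_eq_square)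
  qed
qed

section \<open>Outputs and the excitation integrand in terms of the attitude\<close>

lemma columnvector_mult: "columnvector a *v (y :: real^1) = y $ 1 *\<^sub>R (a :: real^'n)"
  by (simp add: columnvector_def matrix_vector_mult_def vec_eq_iff)

lemma transpose_columnvector_mult: "(transpose (columnvector a :: real^1^'n) *v p) $ 1 = a \<bullet> (p :: real^'n)"
  by (simp add: columnvector_def transpose_def matrix_vector_mult_def inner_vec_def)

lemma outputs_component:
  assumes "\<Lambda> i = columnvector a"
  shows "outputs \<Lambda> b M $ i = (M *v a) \<bullet> b i"
proof -
  have "outputs \<Lambda> b M $ i = a \<bullet> (transpose M *v b i)"
    unfolding outputs_def vec_lambda_beta assms by (rule transpose_columnvector_mult)
  then show ?thesis by (simp only: inner_transpose_mult)
qed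

lemma inner_cross3_swap: "p \<bullet> cross3 q r = - (r \<bullet> cross3 q p)"
  by (simp add: cross3_simps)

text \<open>The matrix is \<open>- v v\<^sup>T\<close> with \<open>v = b \<times> (M a)\<close>. The
  sign arises because the right-hand skew factor equals minus the transpose of the left-hand one;
  the minus sign in the excitation hypothesis compensates it.\<close>

lemma excitation_integrand:
  assumes "L = (columnvector a :: real^1^3)"
  shows "z \<bullet> ((skew b ** M ** L ** transpose L ** transpose M ** skew b) *v z) = - ((M *v a) \<bullet> cross3 b z)\<^sup>2"
proof -
  let ?k = "a \<bullet> (transpose M *v cross3 b z)"
  have "(skew b ** M ** L ** transpose L ** transpose M ** skew b) *v z
      = skew b *v (M *v (L *v (transpose L *v (transpose M *v (skew b *v z)))))"
    by (simp only: matrix_vector_mul_assoc matrix_mul_assoc)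
  also have "\<dots> = cross3 b (M *v (?k *\<^sub>R a))"
    unfolding assms columnvector_mult transpose_columnvector_mult skew_mult ..
  also have "z \<bullet> \<dots> = ?k * (z \<bullet> cross3 b (M *v a))"
    by (simp only: matrix_vector_mult_scaleR cross_mult_right inner_scaleR_right)
  also have "z \<bullet> cross3 b (M *v a) = - ((M *v a) \<bullet> cross3 b z)"
    by (rule inner_cross3_swap)
  also have "?k = (M *v a) \<bullet> cross3 b z" by (rule inner_transpose_mult)
  finally show ?thesis by (simp add: power2_eq_square)
qed

lemma derivative_zero_imp_const:
  fixes f :: "real \<Rightarrow> 'a::real_normed_vector"
  assumes "\<And>s. 0 \<le> s \<Longrightarrow> (f has_vector_derivative 0) (at s within {0..})" "0 \<le> t"
  shows "f t = f 0"
  using has_derivative_zero_unique[of "{0..}" f 0 t] assms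
  by (auto simp: has_vector_derivative_def)

text \<open>One observer trajectory together with bounds on the weights. The bounds are parameters,
  so that constants built from them can be named outside before any trajectory is given.\<close>

locale observer_error =
  fixes \<Omega> :: "real \<Rightarrow> real^3" and R :: "real \<Rightarrow> real^3^3" and d :: "real^3"
    and a :: "real^3" and b :: "2 \<Rightarrow> real^3" and \<Lambda> :: "2 \<Rightarrow> real^1^3"
    and Q :: "real \<Rightarrow> real^2^2" and V :: "real \<Rightarrow> real^(3+3)^(3+3)" and P0 :: "real^(3+3)^(3+3)"
    and Rh :: "real \<Rightarrow> real^3^3" and dh :: "real \<Rightarrow> real^3" and P :: "real \<Rightarrow> real^(3+3)^(3+3)"
    and qu ql vu vl :: real
  assumes kinematics: "attitude_kinematics \<Omega> R"
    and observer: "riccati_observer \<Lambda> b Q V P0 (\<lambda>t. \<Omega> t + d) (\<lambda>t. outputs \<Lambda> b (R t)) Rh dh P"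
    and \<Lambda>: "\<And>i. \<Lambda> i = columnvector a" and a_unit: "norm a = 1" and b_unit: "\<And>i. norm (b i) = 1"
    and Q_sym: "\<And>t. 0 \<le> t \<Longrightarrow> symmetric_matrix (Q t)"
    and Q_upper: "\<And>t. 0 \<le> t \<Longrightarrow> norm (Q t) \<le> qu"
    and Q_lower: "\<And>t y. 0 \<le> t \<Longrightarrow> ql * (y \<bullet> y) \<le> y \<bullet> (Q t *v y)" and ql: "0 < ql"
    and Q_cont: "continuous_on {0..} Q"
    and V_sym: "\<And>t. 0 \<le> t \<Longrightarrow> symmetric_matrix (V t)"
    and V_upper: "\<And>t. 0 \<le> t \<Longrightarrow> norm (V t) \<le> vu"
    and V_lower: "\<And>t y. 0 \<le> t \<Longrightarrow> vl * (y \<bullet> y) \<le> y \<bullet> (V t *v y)" and vl: "0 < vl"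
    and P0: "pos_def P0"
begin

definition "E t = Rh t ** transpose (R t) - mat 1"
definition "dt t = d - dh t"
definition "x t = stack (vex (E t)) (dt t)"
definition "\<Delta> t = innovation \<Lambda> b (Q t) (P t) (Rh t) (outputs \<Lambda> b (R t))"
abbreviation "C t \<equiv> C_matrix \<Lambda> b (Rh t)"
definition "K t = transpose (C t) ** Q t ** C t"
text \<open>The angular velocity of the error rotation \<open>Rh R\<^sup>T\<close>, acting from the
  left.\<close>

definition "\<nu> t = Rh t *v dt t + attitude_part (\<Delta> t)"
definition "output_remainder t = outputs \<Lambda> b (Rh t) - outputs \<Lambda> b (R t) - C t *v x t"
text \<open>What is left of \<open>x'\<close> beside its linear part: the product of
  \<open>\<nu>\<close> with \<open>E\<close>, and the nonlinear part of the output error sent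
  through the gain. Both are quadratic in the error.\<close>

definition "r t = stack (vex (skew (\<nu> t) ** E t)) 0 - (P t ** transpose (C t) ** Q t) *v output_remainder t"

lemma R_rotation: "0 \<le> t \<Longrightarrow> rotation_matrix (R t)"
  and dR: "0 \<le> t \<Longrightarrow> (R has_vector_derivative R t ** skew (\<Omega> t)) (at t within {0..})"
  using kinematics by (auto simp: attitude_kinematics_def)

lemma R_orth: "0 \<le> t \<Longrightarrow> orthogonal_matrix (R t)"
  using R_rotation by (simp add: rotation_matrix_def)

lemma dRh: "0 \<le> t \<Longrightarrow> (Rh has_vector_derivative
      Rh t ** skew (\<Omega> t + dt t) + skew (attitude_part (\<Delta> t)) ** Rh t) (at t within {0..})"
  and ddh: "0 \<le> t \<Longrightarrow> (dh has_vector_derivative - bias_part (\<Delta> t)) (at t within {0..})"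
  and dP: "0 \<le> t \<Longrightarrow> (P has_vector_derivative riccati_rhs \<Lambda> b (Q t) (V t) (Rh t) (P t)) (at t within {0..})"
  and Rh0: "rotation_matrix (Rh 0)" and P_0: "P 0 = P0"
  using observer by (auto simp: riccati_observer_def \<Delta>_def dt_def Let_def add_diff_eq)

lemma cont_Rh: "continuous_on {0..} Rh" and cont_dh: "continuous_on {0..} dh"
  and cont_R: "continuous_on {0..} R"
  using dRh ddh dR has_vector_derivative_continuous
  by (metis atLeast_iff continuous_on_eq_continuous_within)+

lemmas matrix_mult_distribs =
  bounded_bilinear.add_left[OF bounded_bilinear_matrix_matrix_mult]
  bounded_bilinear.add_right[OF bounded_bilinear_matrix_matrix_mult]
  bounded_bilinear.diff_left[OF bounded_bilinear_matrix_matrix_mult]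
  bounded_bilinear.diff_right[OF bounded_bilinear_matrix_matrix_mult]
  bounded_bilinear.minus_left[OF bounded_bilinear_matrix_matrix_mult]
  bounded_bilinear.minus_right[OF bounded_bilinear_matrix_matrix_mult]

text \<open>\<open>Rh Rh\<^sup>T - 1\<close> evolves by a commutator with a skew matrix, which preserves its Frobenius norm.\<close>
lemma Rh_orth: assumes t: "0 \<le> t" shows "orthogonal_matrix (Rh t)"
proof -
  define D where "D t = Rh t ** transpose (Rh t) - mat 1" for t
  have "((\<lambda>t. D t \<bullet> D t) has_vector_derivative 0) (at s within {0..})" if s: "0 \<le> s" for s
  proof -
    let ?S = "skew (attitude_part (\<Delta> s))" and ?W = "skew (\<Omega> s + dt s)"
    have "(D has_vector_derivative
        Rh s ** transpose (Rh s ** ?W + ?S ** Rh s) + (Rh s ** ?W + ?S ** Rh s) ** transpose (Rh s) - 0) (at s within {0..})"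
      unfolding D_def
      by (intro has_vector_derivative_diff has_vector_derivative_const
          has_vector_derivative_matrix_matrix_mult has_vector_derivative_transpose dRh s)
    moreover have "Rh s ** transpose (Rh s ** ?W + ?S ** Rh s) + (Rh s ** ?W + ?S ** Rh s) ** transpose (Rh s) - 0
        = ?S ** D s - D s ** ?S"
      by (simp add: D_def transpose_add matrix_transpose_mul matrix_mult_distribs matrix_mul_assoc)
    ultimately have "(D has_vector_derivative ?S ** D s - D s ** ?S) (at s within {0..})" by simp
    from bounded_bilinear.has_vector_derivative[OF bounded_bilinear_inner this this]
    show ?thesis by (simp add: inner_diff_right inner_diff_left inner_skew_mult inner_mult_skew
          inner_commute[of _ "D s"])
  qed
  from derivative_zero_imp_const[OF this t] have "D t \<bullet> D t = D 0 \<bullet> D 0" .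
  moreover have "D 0 = 0" using Rh0 by (simp add: D_def rotation_matrix_def orthogonal_matrix_def)
  ultimately have "D t = 0" by simp
  then have "Rh t ** transpose (Rh t) = mat 1" by (simp add: D_def)
  then show ?thesis by (simp add: orthogonal_matrix_def matrix_left_right_inverse)
qed

text \<open>The determinant is continuous, starts at 1, and on orthogonal matrices takes only the
  values 1 and -1.\<close>

lemma Rh_rotation: assumes t: "0 \<le> t" shows "rotation_matrix (Rh t)"
proof -
  have "det (Rh t) \<noteq> -1"
  proof
    assume neg: "det (Rh t) = -1"
    have "continuous_on {0..t} (\<lambda>s. det (Rh s))"
      unfolding det_3 by (intro continuous_intros continuous_on_subset[OF cont_Rh]) auto
    moreover have "det (Rh 0) = 1" using Rh0 by (simp add: rotation_matrix_def)
    ultimately obtain s where s: "0 \<le> s" "s \<le> t" "det (Rh s) = 0"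
      using IVT2'[of "\<lambda>s. det (Rh s)" t 0 0] neg t by auto
    then show False using det_orthogonal_matrix[OF Rh_orth[OF s(1)]] by simp
  qed
  then show ?thesis
    using det_orthogonal_matrix[OF Rh_orth[OF t]] Rh_orth[OF t] by (auto simp: rotation_matrix_def)
qed

lemma norm_Rh: "0 \<le> t \<Longrightarrow> norm (Rh t) \<le> 2" and norm_R: "0 \<le> t \<Longrightarrow> norm (R t) \<le> 2"
  using norm_orthogonal_matrix[OF Rh_orth] norm_orthogonal_matrix[OF R_orth]
  by (auto simp: real_le_lsqrt)

lemma error_orth: "0 \<le> t \<Longrightarrow> orthogonal_matrix (Rh t ** transpose (R t))"
  by (intro orthogonal_matrix_mul Rh_orth orthogonal_matrix_transpose[THEN iffD2] R_orth)

text \<open>\<open>E R = Rh - R\<close>, and a rotation has Frobenius norm \<open>sqrt 3\<close>,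
  which is below 2.\<close>

lemma Rh_close: assumes t: "0 \<le> t" shows "norm (Rh t - R t) \<le> 2 * norm (E t)"
proof -
  have "E t ** R t = Rh t - R t"
    using R_orth[OF t] by (simp add: E_def matrix_mult_distribs orthogonal_matrix_def flip: matrix_mul_assoc)
  then have "norm (Rh t - R t) \<le> norm (E t) * norm (R t)" by (metis norm_matrix_matrix_mult_le)
  also have "\<dots> \<le> norm (E t) * 2" by (intro mult_left_mono norm_R t) simp
  finally show ?thesis by simp
qed

text \<open>\<open>Rh skew(\<Omega>) R\<^sup>T\<close> occurs with both signs, so the true angular
  velocity cancels. The bias error is moved to the left of \<open>Rh\<close> by
  \<open>rotation_skew\<close>, which collects everything in \<open>\<nu>\<close>.\<close>

lemma dE:
  assumes t: "0 \<le> t"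
  shows "(E has_vector_derivative skew (\<nu> t) + skew (\<nu> t) ** E t) (at t within {0..})"
proof -
  let ?S = "skew (attitude_part (\<Delta> t))"
  have "(E has_vector_derivative Rh t ** transpose (R t ** skew (\<Omega> t))
      + (Rh t ** skew (\<Omega> t + dt t) + ?S ** Rh t) ** transpose (R t) - 0) (at t within {0..})"
    unfolding E_def[abs_def]
    by (intro has_vector_derivative_diff has_vector_derivative_const
        has_vector_derivative_matrix_matrix_mult has_vector_derivative_transpose dRh dR t)
  moreover have "skew (\<Omega> t + dt t) = skew (\<Omega> t) + skew (dt t)" "skew (\<nu> t) = skew (Rh t *v dt t) + ?S"
    unfolding \<nu>_def using bounded_linear_skew by (simp_all add: bounded_linear.linear linear_add)
  moreover have "Rh t ** skew (dt t) = skew (Rh t *v dt t) ** Rh t"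
    by (rule rotation_skew[OF Rh_rotation[OF t]])
  ultimately show ?thesis
    by (simp add: E_def matrix_transpose_mul matrix_mult_distribs matrix_mul_assoc add.commute)
qed

lemma innovation_split: "\<Delta> t = - (P t *v (K t *v x t)) - (P t ** transpose (C t) ** Q t) *v output_remainder t"
proof -
  have "outputs \<Lambda> b (Rh t) - outputs \<Lambda> b (R t) = C t *v x t + output_remainder t"
    by (simp add: output_remainder_def)
  then have "\<Delta> t = - ((P t ** transpose (C t) ** Q t) *v (C t *v x t + output_remainder t))"
    by (simp only: \<Delta>_def innovation_def)
  also have "\<dots> = - ((P t ** transpose (C t) ** Q t) *v (C t *v x t))
      - (P t ** transpose (C t) ** Q t) *v output_remainder t"
    by (simp only: matrix_vector_right_distrib minus_add_distrib) simp
  also have "(P t ** transpose (C t) ** Q t) *v (C t *v x t) = P t *v (K t *v x t)"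
    by (simp only: K_def matrix_vector_mul_assoc matrix_mul_assoc)
  finally show ?thesis .
qed

lemma dx:
  assumes t: "0 \<le> t"
  shows "(x has_vector_derivative A_matrix (Rh t) *v x t - P t *v (K t *v x t) + r t) (at t within {0..})"
proof -
  have "(dt has_vector_derivative 0 - - bias_part (\<Delta> t)) (at t within {0..})"
    unfolding dt_def[abs_def] by (intro has_vector_derivative_diff has_vector_derivative_const ddh t)
  then have "(x has_vector_derivative
      stack (vex (skew (\<nu> t) + skew (\<nu> t) ** E t)) (bias_part (\<Delta> t))) (at t within {0..})"
    unfolding x_def[abs_def]
    using has_vector_derivative_stack[OF bounded_linear.has_vector_derivative[OF bounded_linear_vex dE[OF t]]] by simp
  moreover have "stack (vex (skew (\<nu> t) + skew (\<nu> t) ** E t)) (bias_part (\<Delta> t))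
      = A_matrix (Rh t) *v x t - P t *v (K t *v x t) + r t"
  proof -
    have "vex (skew (\<nu> t) + skew (\<nu> t) ** E t) = Rh t *v dt t + attitude_part (\<Delta> t) + vex (skew (\<nu> t) ** E t)"
      by (simp add: linear_add[OF linear_vex] \<nu>_def)
    then have "stack (vex (skew (\<nu> t) + skew (\<nu> t) ** E t)) (bias_part (\<Delta> t))
        = stack (Rh t *v dt t) 0 + \<Delta> t + stack (vex (skew (\<nu> t) ** E t)) 0"
      by (metis add_0 add.right_neutral stack_add stack_parts)
    also have "stack (Rh t *v dt t) 0 = A_matrix (Rh t) *v x t"
      by (simp add: A_matrix_mult x_def)
    finally show ?thesis unfolding innovation_split r_def by (simp add: algebra_simps)
  qed
  ultimately show ?thesis by simp
qed

text \<open>Component \<open>i\<close> of the output error is exactly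
  \<open>- (Rh a) \<bullet> (E (b i))\<close>, and the linear part replaces \<open>E\<close> by its
  skew part. Only the quadratically small symmetric part remains, and each of the two components
  contributes a half.\<close>

lemma output_remainder_bound: assumes t: "0 \<le> t" shows "norm (output_remainder t) \<le> (norm (E t))\<^sup>2"
proof -
  have comp: "\<bar>output_remainder t $ i\<bar> \<le> (norm (E t))\<^sup>2 / 2" for i
  proof -
    have "E t *v b i = Rh t *v (transpose (R t) *v b i) - b i"
      by (simp only: E_def matrix_vector_mult_diff_rdistrib matrix_vector_mul_assoc[symmetric]
          matrix_vector_mul_lid)
    moreover have "(Rh t *v a) \<bullet> (Rh t *v y) = a \<bullet> y" for y
    proof -
      have "(Rh t *v a) \<bullet> (Rh t *v y) = a \<bullet> (transpose (Rh t) *v (Rh t *v y))"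
        by (rule inner_transpose_mult[symmetric])
      also have "transpose (Rh t) *v (Rh t *v y) = y"
        using Rh_orth[OF t] by (simp only: matrix_vector_mul_assoc orthogonal_matrix_def matrix_vector_mul_lid)
      finally show ?thesis .
    qed
    ultimately have "(Rh t *v a) \<bullet> (E t *v b i) = (R t *v a) \<bullet> b i - (Rh t *v a) \<bullet> b i"
      by (simp only: inner_diff_right inner_transpose_mult)
    moreover have "(C t *v x t) $ i = - ((Rh t *v a) \<bullet> (skew (vex (E t)) *v b i))"
      using cross_skew[of "b i" "vex (E t)"] by (simp add: C_matrix_mult[of \<Lambda> i a, OF \<Lambda>] x_def)
    ultimately have "output_remainder t $ i = - ((Rh t *v a) \<bullet> ((E t - skew (vex (E t))) *v b i))"
      by (simp add: output_remainder_def outputs_component[of \<Lambda> i a, OF \<Lambda>]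
          matrix_vector_mult_diff_rdistrib inner_diff_right)
    then have "\<bar>output_remainder t $ i\<bar> \<le> norm (E t - skew (vex (E t))) * norm (Rh t *v a) * norm (b i)"
      using abs_quadratic_form_le by simp
    also have "\<dots> = norm (E t - skew (vex (E t)))"
      using a_unit b_unit[of i] by (simp add: norm_orthogonal_matrix_mult[OF Rh_orth[OF t]])
    also have "\<dots> \<le> (norm (E t))\<^sup>2 / 2"
      unfolding E_def by (rule orthogonal_minus_identity(1)[OF error_orth[OF t]])
    finally show ?thesis .
  qed
  have "norm (output_remainder t) \<le> (\<Sum>i\<in>UNIV. \<bar>output_remainder t $ i\<bar>)" by (rule norm_le_l1_cart)
  also have "\<dots> \<le> (norm (E t))\<^sup>2" using comp[of 1] comp[of 2] by (simp add: sum_2)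
  finally show ?thesis .
qed

lemma norm_C: "0 \<le> t \<Longrightarrow> norm (C t) \<le> 2"
  by (rule norm_C_matrix_le[OF \<Lambda> a_unit b_unit Rh_orth])

lemma qu_nonneg: "0 \<le> qu" and vu_nonneg: "0 \<le> vu"
  using order_trans[OF norm_ge_zero Q_upper[of 0]] order_trans[OF norm_ge_zero V_upper[of 0]] by simp_all

lemma norm_CQ: assumes t: "0 \<le> t" shows "norm (transpose (C t) ** Q t) \<le> 2 * qu"
  using norm_C[OF t] Q_upper[OF t]
  by (intro order_trans[OF norm_matrix_matrix_mult_le mult_mono]) (auto simp: norm_transpose)

lemma norm_K: assumes t: "0 \<le> t" shows "norm (K t) \<le> 4 * qu"
proof -
  have "norm (K t) \<le> (2 * qu) * 2" unfolding K_def
    by (rule order_trans[OF norm_matrix_matrix_mult_le mult_mono[OF norm_CQ[OF t] norm_C[OF t]]])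
      (use qu_nonneg in auto)
  then show ?thesis by simp
qed

lemma K_form: "y \<bullet> (K t *v z) = (C t *v y) \<bullet> (Q t *v (C t *v z))"
  by (simp only: K_def matrix_vector_mul_assoc[symmetric] inner_transpose_mult)

lemma K_psd: assumes t: "0 \<le> t" shows "pos_semidef (K t)"
  unfolding pos_semidef_def
proof (intro conjI allI)
  show "symmetric_matrix (K t)"
    using Q_sym[OF t] by (simp add: symmetric_matrix_def K_def matrix_transpose_mul matrix_mul_assoc)
  fix y
  have "0 \<le> ql * ((C t *v y) \<bullet> (C t *v y))" using ql by simp
  also have "\<dots> \<le> y \<bullet> (K t *v y)" unfolding K_form by (rule Q_lower[OF t])
  finally show "0 \<le> y \<bullet> (K t *v y)" .
qed

lemma K_lower:
  assumes t: "0 \<le> t"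
  shows "ql * output_energy a (b 1) (b 2) (Rh t) (attitude_part y) \<le> y \<bullet> (K t *v y)"
  using Q_lower[OF t, of "C t *v y"] by (simp only: K_form norm_C_matrix_mult[OF \<Lambda>])

lemma cont_K: "continuous_on {0..} K"
  unfolding K_def[abs_def] by (intro continuous_intros continuous_on_C_matrix[OF \<Lambda>] cont_Rh Q_cont)

lemma riccati: "riccati_solution \<tau> (\<lambda>t. A_matrix (Rh t)) K V P 2 (4 * qu) vu vl"
proof
  fix t assume t: "t \<in> {0..\<tau>}"
  have "(P has_vector_derivative riccati_rhs \<Lambda> b (Q t) (V t) (Rh t) (P t)) (at t within {0..\<tau>})"
    by (rule has_vector_derivative_within_subset[OF dP]) (use t in auto)
  then show "(P has_vector_derivative A_matrix (Rh t) ** P t + P t ** transpose (A_matrix (Rh t))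
      - P t ** K t ** P t + V t) (at t within {0..\<tau>})"
    by (simp add: riccati_rhs_def Let_def K_def matrix_mul_assoc)
qed (use norm_Rh norm_K V_upper K_psd V_sym V_lower vl P0 P_0 in \<open>auto simp: norm_A_matrix\<close>)

text \<open>In the first summand, \<open>32 = 2 * 16\<close> combines the bound
  \<open>2 * qu\<close> on \<open>C\<^sup>T Q\<close> with \<open>norm E \<le> 4 * norm x\<close>
  squared. The bracket bounds \<open>\<nu>\<close>, where \<open>12 = 4 + 8\<close> adds the linear
  and the nonlinear part of the innovation, and \<open>8 = 2 * 4\<close> comes from
  \<open>norm_skew\<close> and the bound on \<open>E\<close>.\<close>

definition "remainder_constant pm = 32 * qu * pm + 8 * (1 + pm * (12 * qu))"

lemma remainder_bound:
  assumes t: "0 \<le> t" and E1: "norm (E t) \<le> 1" and pm: "0 < pm"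
    and P: "\<And>\<xi>. \<xi> \<bullet> (P t *v \<xi>) \<le> pm * (\<xi> \<bullet> \<xi>)"
  shows "norm (r t) \<le> remainder_constant pm * (x t \<bullet> x t)"
proof -
  interpret riccati_solution t "\<lambda>t. A_matrix (Rh t)" K V P 2 "4 * qu" vu vl by (rule riccati)
  have "pos_def (P t)" using pos_def_solution[of t] t by simp
  then have psd: "pos_semidef (P t)"
    unfolding pos_def_def pos_semidef_def by (metis inner_zero_left order_less_imp_le order_refl)
  have nP: "norm (P t *v y) \<le> pm * norm y" for y
    by (rule norm_mult_le_of_quadratic_form_le[OF psd P])
  let ?n = "norm (x t)"
  have nE: "norm (E t) \<le> 4 * ?n"
  proof -
    have "norm (E t) \<le> 4 * norm (vex (E t))"
      using orthogonal_minus_identity(2)[OF error_orth[OF t]] E1 by (simp add: E_def)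
    also have "norm (vex (E t)) \<le> ?n" using norm_attitude_part_le[of "x t"] by (simp add: x_def)
    finally show ?thesis by simp
  qed
  \<comment> \<open>A linear estimate of the squared error is what the bound on \<open>\<nu>\<close>
    needs, since \<open>\<nu>\<close> is later multiplied by \<open>E\<close>; one factor is traded
    for \<open>norm E \<le> 1\<close>.\<close>
  have nE2: "(norm (E t))\<^sup>2 \<le> 4 * ?n"
    using mult_mono[OF nE E1] by (simp add: power2_eq_square)
  have nE2': "(norm (E t))\<^sup>2 \<le> 16 * (?n * ?n)"
    using mult_mono[OF nE nE] by (simp add: power2_eq_square)
  define u where "u = (P t ** transpose (C t) ** Q t) *v output_remainder t"
  have nu: "norm u \<le> pm * (2 * qu * (norm (E t))\<^sup>2)"
  proof -
    have "u = P t *v ((transpose (C t) ** Q t) *v output_remainder t)"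
      by (simp only: u_def matrix_vector_mul_assoc matrix_mul_assoc)
    then have "norm u \<le> pm * norm ((transpose (C t) ** Q t) *v output_remainder t)" using nP by simp
    also have "\<dots> \<le> pm * (2 * qu * (norm (E t))\<^sup>2)"
      using pm norm_CQ[OF t] output_remainder_bound[OF t] qu_nonneg
      by (intro mult_left_mono order_trans[OF norm_matrix_vector_mult_le] mult_mono) auto
    finally show ?thesis .
  qed
  have n\<Delta>: "norm (\<Delta> t) \<le> pm * (12 * qu) * ?n"
  proof -
    have "norm (\<Delta> t) \<le> norm (P t *v (K t *v x t)) + norm u"
      unfolding innovation_split u_def[symmetric]
      using norm_triangle_ineq4[of "- (P t *v (K t *v x t))" u] by simp
    also have "norm (P t *v (K t *v x t)) \<le> pm * (4 * qu * ?n)"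
      using pm norm_K[OF t]
      by (intro order_trans[OF nP] mult_left_mono order_trans[OF norm_matrix_vector_mult_le] mult_right_mono) auto
    also have "norm u \<le> pm * (2 * qu * (4 * ?n))"
      using nE2 pm qu_nonneg by (intro order_trans[OF nu] mult_left_mono) auto
    finally show ?thesis by (simp add: algebra_simps)
  qed
  have n\<nu>: "norm (\<nu> t) \<le> (1 + pm * (12 * qu)) * ?n"
  proof -
    have "norm (\<nu> t) \<le> norm (Rh t *v dt t) + norm (attitude_part (\<Delta> t))"
      unfolding \<nu>_def by (rule norm_triangle_ineq)
    also have "norm (Rh t *v dt t) = norm (dt t)" by (rule norm_orthogonal_matrix_mult[OF Rh_orth[OF t]])
    also have "norm (dt t) \<le> ?n" using norm_bias_part_le[of "x t"] by (simp add: x_def)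
    also have "norm (attitude_part (\<Delta> t)) \<le> pm * (12 * qu) * ?n"
      by (rule order_trans[OF norm_attitude_part_le n\<Delta>])
    finally show ?thesis by (simp add: algebra_simps)
  qed
  have "norm (r t) \<le> norm (vex (skew (\<nu> t) ** E t)) + norm u"
    unfolding r_def u_def[symmetric] using norm_triangle_ineq4[of "stack _ 0" u] by simp
  also have "norm (vex (skew (\<nu> t) ** E t)) \<le> 2 * ((1 + pm * (12 * qu)) * ?n) * (4 * ?n)"
  proof -
    have "norm (vex (skew (\<nu> t) ** E t)) \<le> norm (skew (\<nu> t)) * norm (E t)"
      by (rule order_trans[OF norm_vex norm_matrix_matrix_mult_le])
    also have "\<dots> \<le> 2 * ((1 + pm * (12 * qu)) * ?n) * (4 * ?n)"
      using n\<nu> pm qu_nonneg by (intro mult_mono order_trans[OF norm_skew] nE) auto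
    finally show ?thesis .
  qed
  also have "norm u \<le> pm * (2 * qu * (16 * (?n * ?n)))"
    using nE2' pm qu_nonneg by (intro order_trans[OF nu] mult_left_mono) auto
  finally have "norm (r t) \<le> 2 * ((1 + pm * (12 * qu)) * ?n) * (4 * ?n) + pm * (2 * qu * (16 * (?n * ?n)))"
    by simp
  also have "\<dots> = remainder_constant pm * (?n * ?n)"
    by (simp add: remainder_constant_def algebra_simps)
  finally show ?thesis by (simp add: power2_norm_eq_inner[symmetric] power2_eq_square)
qed

end

section \<open>Bounded covariance and exponential decay along one trajectory\<close>

context observer_error
begin

text \<open>The sum of the bounds of \<open>growth_bound\<close> on the first window and of
  \<open>steady_bound\<close> afterwards, for the norm bounds \<open>2\<close> on \<open>A\<close>
  and \<open>4 * qu\<close> on \<open>K\<close> and the Gramian constant \<open>ql * \<rho>\<close>.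
  The number 5 is \<open>2 * 2 + 1\<close>.\<close>

definition "covariance_constant T0 \<rho> = (let
    h = norm (mat 1 :: real^(3+3)^(3+3)) + 2 * T0;
    e = 4 * qu * h * T0 * (1 + 2 * T0)
  in (1 + norm P0) * exp ((vu + 5) * T0) + (vu * e\<^sup>2 + 4 * qu * h\<^sup>2) * T0 * (h / (ql * \<rho>))\<^sup>2)"

text \<open>Up to time \<open>T0\<close> no complete window lies in the past, and the growth bound
  is used; afterwards the window is the interval of length \<open>T0\<close> ending at
  \<open>t\<close>, where closeness of \<open>Rh\<close> to \<open>R\<close> provides the Gramian
  bound.\<close>

lemma covariance_bound:
  assumes T0: "0 < T0" and \<rho>: "0 < \<rho>"
    and observable: "\<And>t Rh v w. 0 \<le> t \<Longrightarrow> continuous_on {t..t + T0} Rh \<Longrightarrow>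
      (\<And>s. s \<in> {t..t + T0} \<Longrightarrow> norm (Rh s - R s) \<le> \<rho>) \<Longrightarrow> \<rho> * (v \<bullet> v + w \<bullet> w)
        \<le> integral {t..t + T0} (\<lambda>s. output_energy a (b 1) (b 2) (Rh s) (v + integral {t..s} Rh *v w))"
    and close: "\<And>s. s \<in> {0..\<tau>} \<Longrightarrow> norm (Rh s - R s) \<le> \<rho>"
    and t: "t \<in> {0..\<tau>}"
  shows "\<xi> \<bullet> (P t *v \<xi>) \<le> covariance_constant T0 \<rho> * (\<xi> \<bullet> \<xi>)"
proof -
  interpret riccati_solution \<tau> "\<lambda>t. A_matrix (Rh t)" K V P 2 "4 * qu" vu vl by (rule riccati)
  define h where "h = norm (mat 1 :: real^(3+3)^(3+3)) + 2 * T0"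
  define e where "e = 4 * qu * h * T0 * (1 + 2 * T0)"
  define p1 where "p1 = (1 + norm P0) * exp ((vu + 5) * T0)"
  define p2 where "p2 = (vu * e\<^sup>2 + 4 * qu * h\<^sup>2) * T0 * (h / (ql * \<rho>))\<^sup>2"
  have cc: "covariance_constant T0 \<rho> = p1 + p2"
    by (simp add: covariance_constant_def Let_def p1_def p2_def e_def h_def)
  have p0: "0 \<le> p1" "0 \<le> p2"
    using vu_nonneg qu_nonneg T0 by (simp_all add: p1_def p2_def)
  have "\<xi> \<bullet> (P t *v \<xi>) \<le> p1 * (\<xi> \<bullet> \<xi>) \<or> \<xi> \<bullet> (P t *v \<xi>) \<le> p2 * (\<xi> \<bullet> \<xi>)"
  proof (cases "t \<le> T0")
    case True
    have "\<xi> \<bullet> (P t *v \<xi>) \<le> (1 + norm P0) * exp ((2 * 2 + vu + 1) * t) * (\<xi> \<bullet> \<xi>)"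
      using growth_bound[OF t] by (simp add: P_0)
    also have "(1 + norm P0) * exp ((2 * 2 + vu + 1) * t) \<le> p1"
      using mult_left_mono[OF True, of "vu + 5"] vu_nonneg
      by (auto simp: p1_def add.commute intro!: mult_left_mono)
    then have "(1 + norm P0) * exp ((2 * 2 + vu + 1) * t) * (\<xi> \<bullet> \<xi>) \<le> p1 * (\<xi> \<bullet> \<xi>)"
      by (rule mult_right_mono) simp
    finally show ?thesis ..
  next
    case False
    define t0 where "t0 = t - T0"
    have t0: "0 \<le> t0" "t0 \<le> t" "t \<le> \<tau>" "t - t0 = T0" "t0 + T0 = t" using False t T0 by (auto simp: t0_def)
    have sub: "{t0..t} \<subseteq> {0..}" using t0 by auto
    have cRh: "continuous_on {t0..t} Rh" by (rule continuous_on_subset[OF cont_Rh sub])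
    have cK: "continuous_on {t0..t} K" by (rule continuous_on_subset[OF cont_K sub])
    define \<Phi> where "\<Phi> s = mat 1 + integral {t0..s} (\<lambda>s. A_matrix (Rh s))" for s
    have cA: "continuous_on {t0..t} (\<lambda>s. A_matrix (Rh s))" by (intro continuous_intros cRh)
    have c\<Phi>: "continuous_on {t0..t} \<Phi>"
      unfolding \<Phi>_def by (intro continuous_intros indefinite_integral_continuous_1 integrable_continuous_real cRh)
    have cI: "continuous_on {t0..t} (\<lambda>s. integral {t0..s} Rh)"
      by (intro indefinite_integral_continuous_1 integrable_continuous_real cRh)
    \<comment> \<open>The attitude part of the transition matrix has the form treated by
      \<open>observable\<close>: the bias is constant and is integrated against
      \<open>Rh\<close>.\<close>
    have \<Phi>z: "attitude_part (\<Phi> s *v z) = attitude_part z + integral {t0..s} Rh *v bias_part z"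
      if s: "s \<in> {t0..t}" for s z
    proof -
      have "Rh integrable_on {t0..s}"
        using s by (intro integrable_continuous_real continuous_on_subset[OF cRh]) auto
      from integral_linear[OF this bounded_linear_A_matrix]
      have "integral {t0..s} (\<lambda>s. A_matrix (Rh s)) = A_matrix (integral {t0..s} Rh)" by (simp add: comp_def)
      then have "\<Phi> s *v z = z + stack (integral {t0..s} Rh *v bias_part z) 0"
        by (simp add: \<Phi>_def matrix_vector_mult_add_rdistrib A_matrix_mult)
      then show ?thesis by (simp add: attitude_part_def stack_def vec_eq_iff)
    qed
    have gram: "ql * \<rho> * (z \<bullet> z) \<le> integral {t0..t} (\<lambda>s. (\<Phi> s *v z) \<bullet> (K s *v (\<Phi> s *v z)))" for z
    proof -
      let ?e = "\<lambda>s. output_energy a (b 1) (b 2) (Rh s) (attitude_part z + integral {t0..s} Rh *v bias_part z)"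
      have "\<rho> * (z \<bullet> z) \<le> integral {t0..t0 + T0} ?e"
        unfolding inner_parts[of z z]
      proof (rule observable)
        show "continuous_on {t0..t0 + T0} Rh" unfolding t0(5) by (rule cRh)
        show "norm (Rh s - R s) \<le> \<rho>" if "s \<in> {t0..t0 + T0}" for s
          using that unfolding t0(5) by (intro close) (use t0(1,3) in auto)
      qed (rule t0(1))
      then have "ql * (\<rho> * (z \<bullet> z)) \<le> ql * integral {t0..t} ?e"
        using ql t0(5) by (intro mult_left_mono) auto
      also have "\<dots> = integral {t0..t} (\<lambda>s. ql * ?e s)" by (rule integral_mult_right[symmetric])
      also have "\<dots> \<le> integral {t0..t} (\<lambda>s. (\<Phi> s *v z) \<bullet> (K s *v (\<Phi> s *v z)))"
      proof (rule integral_le)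
        show "(\<lambda>s. ql * ?e s) integrable_on {t0..t}"
          by (intro integrable_continuous_real continuous_intros cRh cI)
        show "(\<lambda>s. (\<Phi> s *v z) \<bullet> (K s *v (\<Phi> s *v z))) integrable_on {t0..t}"
          by (intro integrable_continuous_real continuous_intros cK c\<Phi>)
        show "ql * ?e s \<le> (\<Phi> s *v z) \<bullet> (K s *v (\<Phi> s *v z))" if "s \<in> {t0..t}" for s
          using K_lower[of s "\<Phi> s *v z"] that t0 by (simp add: \<Phi>z[OF that])
      qed
      finally show ?thesis by (simp add: mult.assoc)
    qed
    have "\<xi> \<bullet> (P t *v \<xi>) \<le> (vu * e\<^sup>2 + 4 * qu * h\<^sup>2) * (t - t0) * (h / (ql * \<rho>))\<^sup>2 * (\<xi> \<bullet> \<xi>)"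
    proof (rule steady_bound[where \<Phi> = \<Phi>, OF t0(1-3) cA cK _ _ gram])
      show "A_matrix (Rh s) ** A_matrix (Rh u) = 0" for s u by (rule A_matrix_nilpotent)
      show "\<Phi> s = mat 1 + integral {t0..s} (\<lambda>s. A_matrix (Rh s))" for s by (rule \<Phi>_def)
      show "0 < ql * \<rho>" using ql \<rho> by simp
      show "h = norm (mat 1 :: real^(3+3)^(3+3)) + 2 * (t - t0)" unfolding t0(4) by (rule h_def)
      show "e = 4 * qu * h * (t - t0) * (1 + 2 * (t - t0))" unfolding t0(4) by (rule e_def)
    qed
    then show ?thesis by (simp add: p2_def t0(4))
  qed
  moreover have "p1 * (\<xi> \<bullet> \<xi>) \<le> (p1 + p2) * (\<xi> \<bullet> \<xi>)" "p2 * (\<xi> \<bullet> \<xi>) \<le> (p1 + p2) * (\<xi> \<bullet> \<xi>)"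
    using p0 by (simp_all add: mult_right_mono)
  ultimately show ?thesis unfolding cc by linarith
qed

lemma covariance_constant_pos:
  assumes "0 < T0" shows "0 < covariance_constant T0 \<rho>"
proof -
  have "0 < (1 + norm P0) * exp ((vu + 5) * T0)"
    by (intro mult_pos_pos add_pos_nonneg) simp_all
  moreover have "0 \<le> (vu * e\<^sup>2 + 4 * qu * h\<^sup>2) * T0 * (h / (ql * \<rho>))\<^sup>2" for e h
    using vu_nonneg qu_nonneg assms by simp
  ultimately show ?thesis unfolding covariance_constant_def Let_def by (rule add_pos_nonneg)
qed

lemma remainder_constant_pos:
  assumes "0 < pm" shows "0 < remainder_constant pm"
proof -
  have "0 \<le> 32 * qu * pm" "0 \<le> pm * (12 * qu)" using qu_nonneg assms by simp_all
  moreover from this have "0 < 8 * (1 + pm * (12 * qu))" by simp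
  ultimately show ?thesis unfolding remainder_constant_def by (intro add_nonneg_pos)
qed

definition "err t = norm (E t) + norm (dt t)"

text \<open>Translates the decay of \<open>x \<bullet> x\<close> back to the original errors. The
  factor 5 is 4 for \<open>E\<close>, from the small-rotation estimate, plus 1 for the bias; the
  square root halves the rate.\<close>

lemma error_decay:
  assumes pm: "0 < pm" and P: "\<And>t \<xi>. t \<in> {0..\<tau>} \<Longrightarrow> \<xi> \<bullet> (P t *v \<xi>) \<le> pm * (\<xi> \<bullet> \<xi>)"
    and p0: "0 < p0" "\<And>\<xi>. p0 * (\<xi> \<bullet> \<xi>) \<le> \<xi> \<bullet> (P0 *v \<xi>)"
    and small: "\<And>t. t \<in> {0..\<tau>} \<Longrightarrow> err t \<le> \<sigma>" and \<sigma>: "\<sigma> \<le> 1" "4 * remainder_constant pm * pm * \<sigma> \<le> vl"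
    and \<tau>: "0 \<le> \<tau>"
  shows "err \<tau> \<le> 5 * sqrt (pm / p0) * exp (- (vl / (8 * pm)) * \<tau>) * err 0"
proof -
  interpret riccati_solution \<tau> "\<lambda>t. A_matrix (Rh t)" K V P 2 "4 * qu" vu vl by (rule riccati)
  have x_le: "norm (x t) \<le> err t" for t
    using norm_stack_le[of "vex (E t)" "dt t"] norm_vex[of "E t"] by (simp add: x_def err_def)
  have E1: "norm (E t) \<le> 1" if "t \<in> {0..\<tau>}" for t
    using small[OF that] \<sigma>(1) norm_ge_zero[of "dt t"] unfolding err_def by linarith
  have "x \<tau> \<bullet> x \<tau> \<le> pm / p0 * exp (- (vl / (4 * pm)) * \<tau>) * (x 0 \<bullet> x 0)"
  proof (rule exponential_decay[where r = r and c = "remainder_constant pm" and \<sigma> = \<sigma>])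
    fix t assume t: "t \<in> {0..\<tau>}"
    show "(x has_vector_derivative A_matrix (Rh t) *v x t - P t *v (K t *v x t) + r t) (at t within {0..\<tau>})"
      by (rule has_vector_derivative_within_subset[OF dx]) (use t in auto)
    show "norm (r t) \<le> remainder_constant pm * (x t \<bullet> x t)"
      by (rule remainder_bound[OF _ E1[OF t] pm P[OF t]]) (use t in auto)
    show "norm (x t) \<le> \<sigma>" using x_le[of t] small[OF t] by linarith
  next
    show "0 \<le> remainder_constant pm" using remainder_constant_pos[OF pm] by simp
    show "4 * remainder_constant pm * pm * \<sigma> \<le> vl" by (rule \<sigma>(2))
    show "0 < pm" "0 < p0" by (rule pm p0(1))+
    show "\<xi> \<bullet> (P t *v \<xi>) \<le> pm * (\<xi> \<bullet> \<xi>)" if "t \<in> {0..\<tau>}" for t \<xi> by (rule P[OF that])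
    show "p0 * (\<xi> \<bullet> \<xi>) \<le> \<xi> \<bullet> (P 0 *v \<xi>)" for \<xi> unfolding P_0 by (rule p0(2))
    show "\<tau> \<in> {0..\<tau>}" using \<tau> by simp
  qed
  also have "\<dots> = (sqrt (pm / p0) * exp (- (vl / (8 * pm)) * \<tau>) * norm (x 0))\<^sup>2"
  proof -
    have "(exp (- (vl / (8 * pm)) * \<tau>))\<^sup>2 = exp (- (vl / (4 * pm)) * \<tau>)"
      using pm by (simp add: power2_eq_square field_simps flip: exp_add)
    then show ?thesis using pm p0 by (simp add: power_mult_distrib power2_norm_eq_inner)
  qed
  finally have "(norm (x \<tau>))\<^sup>2 \<le> (sqrt (pm / p0) * exp (- (vl / (8 * pm)) * \<tau>) * norm (x 0))\<^sup>2"
    by (simp only: power2_norm_eq_inner)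
  then have x\<tau>: "norm (x \<tau>) \<le> sqrt (pm / p0) * exp (- (vl / (8 * pm)) * \<tau>) * norm (x 0)"
    by (rule power2_le_imp_le) (use pm p0 in auto)
  have "norm (E \<tau>) \<le> 4 * norm (vex (E \<tau>))"
    using orthogonal_minus_identity(2)[OF error_orth[OF \<tau>]] E1[of \<tau>] \<tau> by (simp add: E_def)
  also have "norm (vex (E \<tau>)) \<le> norm (x \<tau>)" using norm_attitude_part_le[of "x \<tau>"] by (simp add: x_def)
  finally have "err \<tau> \<le> 5 * norm (x \<tau>)"
    using norm_bias_part_le[of "x \<tau>"] by (simp add: err_def x_def)
  also have "\<dots> \<le> 5 * (sqrt (pm / p0) * exp (- (vl / (8 * pm)) * \<tau>) * norm (x 0))" using x\<tau> by simp
  also have "\<dots> \<le> 5 * (sqrt (pm / p0) * exp (- (vl / (8 * pm)) * \<tau>) * err 0)"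
    using x_le[of 0] pm p0 by (intro mult_left_mono) auto
  finally show ?thesis by (simp add: mult.assoc)
qed

lemma cont_err: "continuous_on {0..} err"
  unfolding err_def[abs_def] E_def[abs_def] dt_def[abs_def]
  by (intro continuous_intros cont_Rh cont_R cont_dh)

end

section \<open>Uniform choice of windows, weight bounds and stability constants\<close>

lemma window_monotone:
  fixes f :: "real \<Rightarrow> real"
  assumes "continuous_on {0..} f" "\<And>s. 0 \<le> f s" "0 \<le> t" "\<delta> \<le> T"
  shows "integral {t..t + \<delta>} f \<le> integral {t..t + T} f"
  using assms
  by (intro integral_subset_le integrable_continuous_real continuous_on_subset[OF assms(1)]) auto

lemma admissible_weight_bounds:
  fixes W :: "real \<Rightarrow> real^'n^'n"
  assumes "admissible_weight W"
  obtains u l where "continuous_on {0..} W" "\<And>t. 0 \<le> t \<Longrightarrow> symmetric_matrix (W t)"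
    "\<And>t. 0 \<le> t \<Longrightarrow> norm (W t) \<le> u" "0 < l" "\<And>t y. 0 \<le> t \<Longrightarrow> l * (y \<bullet> y) \<le> y \<bullet> (W t *v y)"
proof -
  obtain u where u: "\<And>t. 0 \<le> t \<Longrightarrow> norm (W t) \<le> u"
    using assms unfolding admissible_weight_def bounded_iff by (meson atLeast_iff imageI)
  obtain l where l: "0 < l" "\<And>t. 0 \<le> t \<Longrightarrow> pos_semidef (W t - l *\<^sub>R mat 1)"
    using assms unfolding admissible_weight_def loewner_ge_def by blast
  have "l * (y \<bullet> y) \<le> y \<bullet> (W t *v y)" if "0 \<le> t" for t y
    using l(2)[OF that] unfolding pos_semidef_def
    by (simp add: matrix_vector_mult_diff_rdistrib inner_diff_right scaleR_matrix_vector_assoc[symmetric])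
  then show thesis using that u l(1) assms unfolding admissible_weight_def by blast
qed

theorem corollary2:
  fixes \<Omega> :: "real \<Rightarrow> real^3" and R :: "real \<Rightarrow> real^3^3" and d :: "real^3"
    and a b :: "2 \<Rightarrow> real^3" and \<Lambda> :: "2 \<Rightarrow> real^1^3"
    and Q :: "real \<Rightarrow> real^2^2" and V :: "real \<Rightarrow> real^(3+3)^(3+3)" and P0 :: "real^(3+3)^(3+3)"
  assumes kinematics: "attitude_kinematics \<Omega> R"
    and \<Omega>_ucont: "uniformly_continuous_on {0..} \<Omega>"
    and \<Omega>_bounded: "bounded (\<Omega> ` {0..})"
    and a_unit: "\<And>i. a i \<in> sphere 0 1"
    and b_unit: "\<And>i. b i \<in> sphere 0 1"
    and \<Lambda>_def: "\<And>i. \<Lambda> i = columnvector (a i)"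
    and \<Lambda>_eq: "\<Lambda> 1 = \<Lambda> 2"
    and b_noncollinear: "\<not> collinear {0, b 1, b 2}"
    and Q: "admissible_weight Q"
    and V: "admissible_weight V"
    and P0: "pos_def P0"
    and excitation: "\<exists>\<delta>>0. \<exists>\<mu>>0. \<forall>t\<ge>0.
      loewner_ge
        (- ((1 / \<delta>) *\<^sub>R integral {t..t + \<delta>} (\<lambda>s. \<Sum>i\<in>UNIV.
            skew (b i) ** R s ** \<Lambda> i ** transpose (\<Lambda> i) ** transpose (R s) ** skew (b i))))
        (\<mu> *\<^sub>R mat 1)"
    and \<Omega>_spe: "strongly_persistently_exciting \<Omega>"
  shows "locally_exponentially_stable (error_trajectories \<Lambda> b Q V P0 \<Omega> R d)"
proof -
  have "columnvector (a 1) = (columnvector (a 2) :: real^1^3)" using \<Lambda>_eq by (simp add: \<Lambda>_def)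
  then have "a 1 = a 2" by (simp add: columnvector_def vec_eq_iff)
  then have "a i = a 1" for i by (metis exhaust_2)
  then have \<Lambda>: "\<Lambda> i = columnvector (a 1)" for i using \<Lambda>_def[of i] by metis
  have a1: "norm (a 1) = 1" and b1: "\<And>i. norm (b i) = 1" using a_unit b_unit by simp_all
  have n: "cross3 (b 1) (b 2) \<noteq> 0" using b_noncollinear by (simp add: cross_eq_0)
  let ?E = "output_energy (a 1) (b 1) (b 2)"
  have cont\<Omega>: "continuous_on {0..} \<Omega>" using \<Omega>_ucont by (rule uniformly_continuous_imp_continuous)
  have contR: "continuous_on {0..} R"
    using kinematics has_vector_derivative_continuous unfolding attitude_kinematics_def
    by (metis atLeast_iff continuous_on_eq_continuous_within)
  obtain \<delta>1 \<beta> where \<delta>1: "0 < \<delta>1" and \<beta>: "0 < \<beta>"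
    and spe: "\<And>t u. 0 \<le> t \<Longrightarrow> \<beta> * (u \<bullet> u) \<le> integral {t..t + \<delta>1} (\<lambda>s. (\<Omega> s \<bullet> u)\<^sup>2)"
    using strongly_persistently_exciting_integral[OF \<Omega>_spe cont\<Omega>] by blast
  obtain \<delta>2 \<mu> where \<delta>2: "0 < \<delta>2" and \<mu>: "0 < \<mu>" and exc: "\<And>t. 0 \<le> t \<Longrightarrow> pos_semidef
        (- ((1 / \<delta>2) *\<^sub>R integral {t..t + \<delta>2} (\<lambda>s. \<Sum>i\<in>UNIV.
            skew (b i) ** R s ** \<Lambda> i ** transpose (\<Lambda> i) ** transpose (R s) ** skew (b i))) - \<mu> *\<^sub>R mat 1)"
    using excitation unfolding loewner_ge_def by blast
  have exc': "\<delta>2 * \<mu> * (z \<bullet> z) \<le> integral {t..t + \<delta>2} (\<lambda>s. ?E (R s) z)" if t: "0 \<le> t" for t z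
  proof -
    let ?M = "\<lambda>s. \<Sum>i\<in>UNIV. skew (b i) ** R s ** \<Lambda> i ** transpose (\<Lambda> i) ** transpose (R s) ** skew (b i)"
    have "continuous_on {t..t + \<delta>2} ?M"
      by (intro continuous_intros continuous_on_subset[OF contR]) (use t in auto)
    then have int: "?M integrable_on {t..t + \<delta>2}" by (rule integrable_continuous_real)
    have form: "z \<bullet> (?M s *v z) = - ?E (R s) z" for s
    proof -
      have "z \<bullet> (?M s *v z) = (\<Sum>i\<in>UNIV. z \<bullet> ((skew (b i) ** R s ** \<Lambda> i ** transpose (\<Lambda> i) ** transpose (R s) ** skew (b i)) *v z))"
        by (simp only: sum_2 matrix_vector_mult_add_rdistrib inner_add_right)
      also have "\<dots> = - ?E (R s) z"
        by (simp only: excitation_integrand[OF \<Lambda>] sum_2 output_energy_def minus_add_distrib)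
      finally show ?thesis .
    qed
    have "\<mu> * (z \<bullet> z) \<le> z \<bullet> (- ((1 / \<delta>2) *\<^sub>R integral {t..t + \<delta>2} ?M) *v z)"
      using exc[OF t] unfolding pos_semidef_def
      by (simp only: matrix_vector_mult_diff_rdistrib inner_diff_right scaleR_matrix_vector_assoc[symmetric]
          matrix_vector_mul_lid inner_scaleR_right) simp
    also have "\<dots> = - ((1 / \<delta>2) * (z \<bullet> (integral {t..t + \<delta>2} ?M *v z)))"
      by (simp only: bounded_bilinear.minus_left[OF bounded_bilinear_matrix_vector_mult]
          scaleR_matrix_vector_assoc[symmetric] inner_minus_right inner_scaleR_right)
    also have "z \<bullet> (integral {t..t + \<delta>2} ?M *v z) = - integral {t..t + \<delta>2} (\<lambda>s. ?E (R s) z)"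
      unfolding quadratic_form_integral[OF int] form by simp
    finally show ?thesis using \<delta>2 by (simp add: field_simps)
  qed
  \<comment> \<open>The two excitation hypotheses come with windows of different lengths. Their
    integrands are nonnegative, so both lower bounds persist on the longer window.\<close>
  define T0 where "T0 = max \<delta>1 \<delta>2"
  have T0: "0 < T0" using \<delta>1 by (simp add: T0_def)
  have \<mu>': "0 < \<delta>2 * \<mu>" using \<delta>2 \<mu> by simp
  have spe_T0: "\<beta> * (u \<bullet> u) \<le> integral {t..t + T0} (\<lambda>s. (\<Omega> s \<bullet> u)\<^sup>2)" if "0 \<le> t" for t u
    by (rule order_trans[OF spe[OF that] window_monotone])
      (auto simp: T0_def that intro!: continuous_intros cont\<Omega>)
  have exc_T0: "\<delta>2 * \<mu> * (z \<bullet> z) \<le> integral {t..t + T0} (\<lambda>s. ?E (R s) z)" if "0 \<le> t" for t z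
    by (rule order_trans[OF exc'[OF that] window_monotone])
      (auto simp: T0_def that intro!: continuous_intros contR)
  obtain \<rho> where \<rho>: "0 < \<rho>" and observable: "\<And>t Rh v w. 0 \<le> t \<Longrightarrow> continuous_on {t..t + T0} Rh \<Longrightarrow>
    (\<And>s. s \<in> {t..t + T0} \<Longrightarrow> norm (Rh s - R s) \<le> \<rho>) \<Longrightarrow> \<rho> * (v \<bullet> v + w \<bullet> w)
      \<le> integral {t..t + T0} (\<lambda>s. ?E (Rh s) (v + integral {t..s} Rh *v w))"
    using uniform_observability[OF kinematics \<Omega>_ucont \<Omega>_bounded a1 n T0 \<beta> spe_T0 \<mu>' exc_T0] by blast
  obtain qu ql where Q_bounds: "continuous_on {0..} Q" "\<And>t. 0 \<le> t \<Longrightarrow> symmetric_matrix (Q t)"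
    "\<And>t. 0 \<le> t \<Longrightarrow> norm (Q t) \<le> qu" "0 < ql" "\<And>t y. 0 \<le> t \<Longrightarrow> ql * (y \<bullet> y) \<le> y \<bullet> (Q t *v y)"
    using admissible_weight_bounds[OF Q] by metis
  obtain vu vl where V_bounds: "continuous_on {0..} V" "\<And>t. 0 \<le> t \<Longrightarrow> symmetric_matrix (V t)"
    "\<And>t. 0 \<le> t \<Longrightarrow> norm (V t) \<le> vu" "0 < vl" "\<And>t y. 0 \<le> t \<Longrightarrow> vl * (y \<bullet> y) \<le> y \<bullet> (V t *v y)"
    using admissible_weight_bounds[OF V] by metis
  obtain p0 where p0: "0 < p0" "\<And>\<xi>. p0 * (\<xi> \<bullet> \<xi>) \<le> \<xi> \<bullet> (P0 *v \<xi>)"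
    using pos_def_lower_bound[OF P0] by blast
  \<comment> \<open>Named through the exported locale definitions before a trajectory is chosen, so
    that the radius, the factor and the rate are common to all trajectories.\<close>
  define pm where "pm = observer_error.covariance_constant P0 qu ql vu T0 \<rho>"
  define cr where "cr = observer_error.remainder_constant qu pm"
  \<comment> \<open>The entry 1 serves the small-rotation estimates, \<open>\<rho> / 2\<close> gives
    \<open>norm (Rh - R) \<le> \<rho>\<close> by \<open>Rh_close\<close>, and the last entry allows
    \<open>exponential_decay\<close> to absorb the quadratic remainder.\<close>
  define \<sigma> where "\<sigma> = min 1 (min (\<rho> / 2) (vl / (4 * cr * pm)))"
  define c where "c = 5 * sqrt (pm / p0)"
  have main: "0 < pm \<and> 0 < cr \<and> (norm (Re 0 - mat 1) + norm (de 0) \<le> \<sigma> / (2 * (c + 1)) \<longrightarrow>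
      (\<forall>t\<ge>0. norm (Re t - mat 1) + norm (de t)
        \<le> c * exp (- (vl / (8 * pm)) * t) * (norm (Re 0 - mat 1) + norm (de 0))))"
    if traj: "(Re, de) \<in> error_trajectories \<Lambda> b Q V P0 \<Omega> R d" for Re de
  proof -
    obtain Rh dh P where Re: "Re = (\<lambda>t. Rh t ** transpose (R t))" and de: "de = (\<lambda>t. d - dh t)"
      and obs: "riccati_observer \<Lambda> b Q V P0 (\<lambda>t. \<Omega> t + d) (\<lambda>t. outputs \<Lambda> b (R t)) Rh dh P"
      using traj unfolding error_trajectories_def by blast
    interpret observer_error \<Omega> R d "a 1" b \<Lambda> Q V P0 Rh dh P qu ql vu vl
      by unfold_locales (use kinematics obs \<Lambda> a1 b1 Q_bounds V_bounds P0 in auto)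
    have pm: "0 < pm" unfolding pm_def by (rule covariance_constant_pos[OF T0])
    have cr: "0 < cr" unfolding cr_def by (rule remainder_constant_pos[OF pm])
    have c: "0 < c" using pm p0 by (simp add: c_def)
    have \<sigma>: "0 < \<sigma>" "\<sigma> \<le> 1" "2 * \<sigma> \<le> \<rho>" using pm cr \<rho> V_bounds(4) by (auto simp: \<sigma>_def)
    have "\<sigma> \<le> vl / (4 * cr * pm)" by (simp add: \<sigma>_def)
    then have \<sigma>4: "4 * cr * pm * \<sigma> \<le> vl" using pm cr by (simp add: field_simps)
    have e: "norm (Re t - mat 1) + norm (de t) = err t" for t
      by (simp add: err_def E_def dt_def Re de)
    have step: "err \<tau> \<le> c * exp (- (vl / (8 * pm)) * \<tau>) * err 0"
      if \<tau>: "0 \<le> \<tau>" and small: "\<And>s. s \<in> {0..\<tau>} \<Longrightarrow> err s \<le> \<sigma>" for \<tau>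
    proof -
      have close: "norm (Rh s - R s) \<le> \<rho>" if s: "s \<in> {0..\<tau>}" for s
      proof -
        have "0 \<le> s" using s by simp
        from Rh_close[OF this] show ?thesis
          using small[OF s] \<sigma>(3) norm_ge_zero[of "dt s"] unfolding err_def by linarith
      qed
      have P: "\<xi> \<bullet> (P t *v \<xi>) \<le> pm * (\<xi> \<bullet> \<xi>)" if "t \<in> {0..\<tau>}" for t \<xi>
        unfolding pm_def by (rule covariance_bound[OF T0 \<rho> observable close that])
      show ?thesis
        unfolding c_def using error_decay[OF pm P p0 small \<sigma>(2) \<sigma>4[unfolded cr_def] \<tau>] by simp
    qed
    \<comment> \<open>The radius makes both \<open>err 0\<close> and \<open>c * err 0\<close>
      strictly smaller than \<open>\<sigma>\<close>, so the decay estimate returns a strict bound by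
      \<open>\<sigma>\<close> and the continuation argument closes.\<close>
    have "\<forall>t\<ge>0. err t \<le> c * exp (- (vl / (8 * pm)) * t) * err 0" if init: "err 0 \<le> \<sigma> / (2 * (c + 1))"
    proof -
      have e0: "0 \<le> err 0" by (simp add: err_def)
      have "err 0 * (2 * (c + 1)) \<le> \<sigma>" using init c by (simp add: field_simps)
      then have i: "2 * (c * err 0) + 2 * err 0 \<le> \<sigma>" by (simp add: algebra_simps)
      have ce: "0 \<le> c * err 0" using c e0 by simp
      have lt: "err t < \<sigma>" if "0 \<le> t" for t
      proof (rule continuation_below[OF cont_err _ _ that])
        show "err 0 < \<sigma>" using i ce e0 \<sigma>(1) by linarith
        fix \<tau> :: real assume \<tau>: "0 \<le> \<tau>" and small: "\<And>s. s \<in> {0..\<tau>} \<Longrightarrow> err s \<le> \<sigma>"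
        have "err \<tau> \<le> c * exp (- (vl / (8 * pm)) * \<tau>) * err 0" by (rule step[OF \<tau> small])
        also have "\<dots> \<le> c * 1 * err 0"
          using c e0 pm V_bounds(4) \<tau> by (intro mult_right_mono mult_left_mono) auto
        also have "\<dots> < \<sigma>" using i ce e0 \<sigma>(1) by linarith
        finally show "err \<tau> < \<sigma>" .
      qed
      show ?thesis using step lt by (metis atLeastAtMost_iff less_imp_le)
    qed
    then show ?thesis unfolding e using pm cr by blast
  qed
  show ?thesis
  \<comment> \<open>Positivity of \<open>pm\<close> and \<open>cr\<close> is proved inside the
    locale, hence from a given trajectory. If there is none, stability holds vacuously.\<close>
  proof (cases "error_trajectories \<Lambda> b Q V P0 \<Omega> R d = {}")
    case True
    show ?thesis unfolding locally_exponentially_stable_def True by (auto intro: exI[of _ 1])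
  next
    case False
    then obtain Re de where "(Re, de) \<in> error_trajectories \<Lambda> b Q V P0 \<Omega> R d" by auto
    from main[OF this] have pm: "0 < pm" "0 < cr" by simp_all
    have c: "0 < c" using pm p0 by (simp add: c_def)
    have \<sigma>: "0 < \<sigma> / (2 * (c + 1))" using pm \<rho> V_bounds(4) c by (simp add: \<sigma>_def)
    have \<kappa>: "0 < vl / (8 * pm)" using pm V_bounds(4) by simp
    show ?thesis
      unfolding locally_exponentially_stable_def
      by (intro exI[of _ "\<sigma> / (2 * (c + 1))"] exI[of _ c] exI[of _ "vl / (8 * pm)"] conjI \<sigma> c \<kappa> ballI)
        (use main in auto)
  qed
qed

end
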